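(* Let $X$ be a complete metric space, $n\in\mathbb N$ with $n\ge1$, and let $S\subset X$ be $n$-rectifiable with $\mathcal H^n(S)>0$. For any finite dimensional Banach space $V$ with $\dim V\ge n$ and any $L>0$, the set $$\{f\in\operatorname{Lip}(X,V,L):\mathcal H^n(f(S))>0\}$$ is open and dense in $\operatorname{Lip}(X,V,L)$.
   Context: Banach spaces are real. $\mathcal H^s$ is the $s$-dimensional Hausdorff measure, $\mathcal H^s(S)=\lim_{\delta\to0}\inf\{\sum_{i\in\mathbb N}\operatorname{diam}(S_i)^s: S\subset\bigcup_i S_i,\ \operatorname{diam}(S_i)\le\delta\}$. An $\mathcal H^n$-measurable $E\subset X$ is $n$-rectifiable if there are countably many Lipschitz maps $f_i\colon A_i\subset\mathbb R^n\to X$ with $\mathcal H^n(E\setminus\bigcup_i f_i(A_i))=0$. $\operatorname{Lip}(X,Y,L)$ is the set of all bounded $L$-Lipschitz functions $f\colon X\to Y$ with the supremum metric. *)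

theory Defs
  imports "HOL-Analysis.Analysis"
begin

(* The library's diameter is a real number and is meaningful only for bounded sets, so
   boundedness is part of "diam (U i) <= d". *)
definition hausdorff_pre :: "real \<Rightarrow> real \<Rightarrow> 'a::metric_space set \<Rightarrow> ennreal" where
  "hausdorff_pre s d S =
     Inf {\<Sum>i. ennreal (diameter (U i) powr s) | U :: nat \<Rightarrow> 'a set.
            S \<subseteq> (\<Union>i. U i) \<and> (\<forall>i. bounded (U i) \<and> diameter (U i) \<le> d)}"

(* Meant for s > 0: in Isabelle 0 powr 0 = 0, so s = 0 does not give counting measure. *)
definition hausdorff_measure :: "real \<Rightarrow> 'a::metric_space set \<Rightarrow> ennreal" where
  "hausdorff_measure s S = Lim (at_right 0) (\<lambda>d. hausdorff_pre s d S)"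

(* The limit exists, so the value of Lim above is not a junk value. *)
lemma hausdorff_pre_tendsto_SUP:
  "((\<lambda>d. hausdorff_pre s d S) \<longlongrightarrow> (SUP d\<in>{0<..}. hausdorff_pre s d S)) (at_right 0)"
proof (rule order_tendstoI)
  have mono: "hausdorff_pre s e S \<le> hausdorff_pre s d S" if "d \<le> e" for d e
  proof -
    have "diameter U \<le> e" if "diameter U \<le> d" for U :: "'a set"
      using that \<open>d \<le> e\<close> by linarith
    then show ?thesis
      unfolding hausdorff_pre_def by (intro Inf_superset_mono) blast
  qed
  fix a assume "a < (SUP d\<in>{0<..}. hausdorff_pre s d S)"
  then obtain e where e: "e > 0" "a < hausdorff_pre s e S"
    unfolding less_SUP_iff by blast
  have "a < hausdorff_pre s d S" if "d < e" for d
    using e(2) mono[of d e] that by (meson less_imp_le less_le_trans)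
  then show "\<forall>\<^sub>F d in at_right 0. a < hausdorff_pre s d S"
    unfolding eventually_at_right_field using e(1) by blast
next
  fix a assume a: "(SUP d\<in>{0<..}. hausdorff_pre s d S) < a"
  have "hausdorff_pre s d S < a" if "d > 0" for d
    using that a by (meson SUP_upper greaterThan_iff le_less_trans)
  then show "\<forall>\<^sub>F d in at_right 0. hausdorff_pre s d S < a"
    unfolding eventually_at_right_field using zero_less_one by blast
qed

lemma hausdorff_measure_eq_SUP:
  "hausdorff_measure s S = (SUP d\<in>{0<..}. hausdorff_pre s d S)"
  unfolding hausdorff_measure_def
  by (rule tendsto_Lim[OF _ hausdorff_pre_tendsto_SUP]) simp

(* Caratheodory measurability with respect to the outer measure. *)
definition hausdorff_measurable :: "real \<Rightarrow> 'a::metric_space set \<Rightarrow> bool" where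
  "hausdorff_measurable s E \<longleftrightarrow> E \<in> lambda_system UNIV UNIV (hausdorff_measure s)"

(* n-rectifiability for n = CARD('n). *)
definition rectifiable :: "'n::finite itself \<Rightarrow> 'a::metric_space set \<Rightarrow> bool" where
  "rectifiable (_ :: 'n itself) E \<longleftrightarrow>
     hausdorff_measurable (real CARD('n)) E \<and>
     (\<exists>(A :: nat \<Rightarrow> (real ^ 'n) set) (f :: nat \<Rightarrow> real ^ 'n \<Rightarrow> 'a).
        (\<forall>i. \<exists>C. C-lipschitz_on (A i) (f i)) \<and>
        hausdorff_measure (real CARD('n)) (E - (\<Union>i. f i ` A i)) = 0)"

(* Bounded L-Lipschitz functions, as a subset of the type of bounded continuous functions,
   whose metric is the supremum metric. *)
definition Lip :: "real \<Rightarrow> ('a::metric_space \<Rightarrow>\<^sub>C 'b::metric_space) set" where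
  "Lip L = {f. L-lipschitz_on UNIV (apply_bcontfun f)}"

lemma image_apply_bcontfun_Lip:
  "apply_bcontfun ` Lip L = {g. bounded (range g) \<and> L-lipschitz_on UNIV g}"
proof safe
  fix g :: "'a \<Rightarrow> 'b" assume g: "bounded (range g)" "L-lipschitz_on UNIV g"
  then have "g \<in> bcontfun"
    by (auto simp: bcontfun_def intro: lipschitz_on_continuous_on)
  then have "apply_bcontfun (Bcontfun g) = g"
    by (rule Bcontfun_inverse)
  with g(2) show "g \<in> apply_bcontfun ` Lip L"
    by (intro image_eqI[of _ _ "Bcontfun g"]) (auto simp: Lip_def)
qed (auto simp: Lip_def bounded_apply_bcontfun)

end

theory Submission
  imports Defs
begin

text \<open>Write \<open>n = CARD('n)\<close> and \<open>H\<close> for the \<open>n\<close>-dimensional Hausdorff measure. The idea is to detect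
\<open>H (f ` S) > 0\<close> by a condition on a single point that survives small perturbations of \<open>f\<close>.

A rectifiable set whose image under \<open>f\<close> has positive measure contains the image of a bounded Borel
set \<open>A \<subseteq> real ^ 'n\<close> under a Lipschitz map \<open>\<phi>\<close> with \<open>H (f ` \<phi> ` A) > 0\<close>
(\<open>rectifiable_parametrized_piece\<close>). Put \<open>h = f \<circ> \<phi>\<close>, a Lipschitz map from \<open>A\<close> into a metric space, and
let \<open>u i\<close> be real Lipschitz extensions of the distance functions from a dense sequence of points of
\<open>h ` A\<close>. By Rademacher's theorem they are differentiable almost everywhere. If at almost every point
of \<open>A\<close> their derivatives had a common nonzero kernel vector \<open>v\<close>, then near the point all \<open>u i\<close>,
and with them \<open>h\<close>, would hardly change in the direction \<open>v\<close>, uniformly in \<open>i\<close>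
(\<open>negligible_dir_lip_diff\<close>). Such a set can be cut into long thin boxes whose images are small
compared with the volumes of the boxes (\<open>hausdorff_measure_collapsed_image_le\<close>), which gives
\<open>H (h ` A) = 0\<close>. Hence some \<open>n\<close> of the distance functions form a map \<open>U\<close> whose derivative is
injective on a set of points of \<open>A\<close> that is not negligible (\<open>regular_distance_chart\<close>).

At a density point of \<open>A\<close> where \<open>U\<close> has an injective derivative, Brouwer's theorem shows that every
map close to \<open>U\<close> on \<open>A\<close> covers a ball when extended from \<open>A\<close> to a small ball, whereas the part of
that ball outside \<open>A\<close> is too small to cover it. Therefore the image of \<open>A\<close> has positive measure
for every \<open>\<Psi>\<close> with a fixed Lipschitz constant that is close enough to \<open>U\<close> on \<open>A\<close>
(\<open>stable_positive_image\<close>).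

Openness: if \<open>g\<close> is uniformly close to \<open>f\<close>, then the distance functions composed with \<open>g \<circ> \<phi>\<close> are
close to \<open>U\<close>, so \<open>g ` \<phi> ` A\<close> has a Lipschitz image of positive measure.

Density: apply the chart to the identity of \<open>X\<close> instead of \<open>f\<close>. Let \<open>G\<close> be the bounded map into an
\<open>n\<close>-dimensional subspace of \<open>V\<close> whose coordinates are the truncated distance functions. Replace
\<open>f\<close> by \<open>(1 - \<eta>) f + t G\<close>. After a linear projection of \<open>V\<close> onto \<open>real ^ 'n\<close>, the derivative at a good
point has the form \<open>(1 - \<eta>) E + t D\<close> with \<open>D\<close> invertible, which is singular for only finitely many
\<open>t > 0\<close>; so arbitrarily small \<open>t\<close> do what is needed.\<close>

section \<open>Hausdorff measure as an outer measure\<close>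

lemma diameter_leI:
  fixes S :: "'a::metric_space set"
  assumes "0 \<le> d" and "\<And>x y. x \<in> S \<Longrightarrow> y \<in> S \<Longrightarrow> dist x y \<le> d"
  shows "bounded S \<and> diameter S \<le> d"
proof
  show "bounded S"
  proof (cases "S = {}")
    case False
    then obtain x where "x \<in> S" by blast
    then show ?thesis using assms(2) unfolding bounded_def by (intro exI[of _ x] exI[of _ d]) blast
  qed simp
  show "diameter S \<le> d"
    using assms unfolding diameter_def by (auto intro!: cSUP_least)
qed

lemma hausdorff_pre_le:
  assumes "S \<subseteq> (\<Union>i. U i)" "\<And>i. bounded (U i)" "\<And>i. diameter (U i) \<le> d"
  shows "hausdorff_pre s d S \<le> (\<Sum>i. ennreal (diameter (U i) powr s))"
  unfolding hausdorff_pre_def using assms by (intro Inf_lower) blast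

lemma hausdorff_pre_lessE:
  assumes "hausdorff_pre s d S < c"
  obtains U :: "nat \<Rightarrow> 'a::metric_space set"
    where "S \<subseteq> (\<Union>i. U i)" "\<And>i. bounded (U i)" "\<And>i. diameter (U i) \<le> d"
      "(\<Sum>i. ennreal (diameter (U i) powr s)) < c"
  using assms unfolding hausdorff_pre_def Inf_less_iff by blast

lemma hausdorff_pre_mono: "S \<subseteq> T \<Longrightarrow> hausdorff_pre s d S \<le> hausdorff_pre s d T"
  unfolding hausdorff_pre_def by (intro Inf_superset_mono) blast

lemma hausdorff_pre_antimono: "d \<le> e \<Longrightarrow> hausdorff_pre s e S \<le> hausdorff_pre s d S"
  unfolding hausdorff_pre_def by (intro Inf_superset_mono) (auto intro: order.trans)

lemma hausdorff_pre_le_measure: "d > 0 \<Longrightarrow> hausdorff_pre s d S \<le> hausdorff_measure s S"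
  unfolding hausdorff_measure_eq_SUP by (intro SUP_upper) auto

lemma hausdorff_measure_leI:
  "(\<And>d. d > 0 \<Longrightarrow> hausdorff_pre s d S \<le> c) \<Longrightarrow> hausdorff_measure s S \<le> c"
  unfolding hausdorff_measure_eq_SUP by (intro SUP_least) auto

lemma hausdorff_measure_mono: "S \<subseteq> T \<Longrightarrow> hausdorff_measure s S \<le> hausdorff_measure s T"
  by (intro hausdorff_measure_leI order.trans[OF hausdorff_pre_mono hausdorff_pre_le_measure])

lemma hausdorff_measure_empty [simp]: "hausdorff_measure s {} = 0"
proof -
  have "hausdorff_pre s d ({} :: 'a set) \<le> 0" if "d > 0" for d
    using hausdorff_pre_le[of "{}" "\<lambda>_. {}::'a set" d s] that by simp
  from hausdorff_measure_leI[OF this] show ?thesis by simp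
qed

lemma hausdorff_pre_countably_subadditive:
  "hausdorff_pre s d (\<Union>i. S i) \<le> (\<Sum>i. hausdorff_pre s d (S i))"
proof (rule ennreal_le_epsilon)
  fix e :: real assume e: "e > 0" and fin: "(\<Sum>i. hausdorff_pre s d (S i)) < top"
  have "\<exists>U. S i \<subseteq> (\<Union>j. U j) \<and> (\<forall>j. bounded (U j)) \<and> (\<forall>j. diameter (U j) \<le> d) \<and>
          (\<Sum>j. ennreal (diameter (U j) powr s)) \<le> hausdorff_pre s d (S i) + e * (1/2)^Suc i" for i
  proof -
    have "hausdorff_pre s d (S i) < top"
      using ennreal_suminf_lessD[OF fin] .
    then have "hausdorff_pre s d (S i) + 0 < hausdorff_pre s d (S i) + ennreal (e * (1/2)^Suc i)"
      using e by (subst ennreal_add_left_cancel_less) (auto simp: less_top)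
    then have "hausdorff_pre s d (S i) < hausdorff_pre s d (S i) + ennreal (e * (1/2)^Suc i)"
      by simp
    then obtain U where "S i \<subseteq> (\<Union>j. U j)" "\<And>j. bounded (U j)" "\<And>j. diameter (U j) \<le> d"
      "(\<Sum>j. ennreal (diameter (U j) powr s)) < hausdorff_pre s d (S i) + ennreal (e * (1/2)^Suc i)"
      by (elim hausdorff_pre_lessE) blast
    then show ?thesis
      by (intro exI[of _ U] conjI allI) (assumption | rule less_imp_le)+
  qed
  then obtain U where U: "\<And>i. S i \<subseteq> (\<Union>j. U i j)" "\<And>i j. bounded (U i j)"
      "\<And>i j. diameter (U i j) \<le> d"
      "\<And>i. (\<Sum>j. ennreal (diameter (U i j) powr s)) \<le> hausdorff_pre s d (S i) + e * (1/2)^Suc i"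
    by metis
  define V where "V = case_prod U \<circ> prod_decode"
  have "(\<Union>i. S i) \<subseteq> (\<Union>k. V k)"
    using U(1) by (auto simp add: V_def subset_eq) (metis prod.case prod_encode_inverse)
  then have "hausdorff_pre s d (\<Union>i. S i) \<le> (\<Sum>k. ennreal (diameter (V k) powr s))"
    by (rule hausdorff_pre_le) (auto simp: V_def U split: prod.split)
  also have "\<dots> = (\<Sum>i. \<Sum>j. ennreal (diameter (U i j) powr s))"
    unfolding V_def comp_def
    by (rule suminf_ennreal_2dimen[of _ "\<lambda>p. ennreal (diameter (case_prod U p) powr s)"]) simp
  also have "\<dots> \<le> (\<Sum>i. hausdorff_pre s d (S i) + e * (1/2)^Suc i)"
    by (intro suminf_le U) auto
  also have "\<dots> = (\<Sum>i. hausdorff_pre s d (S i)) + (\<Sum>i. ennreal e * ennreal ((1/2)^Suc i))"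
    using e by (subst suminf_add[symmetric])
      (auto simp del: ennreal_suminf_cmult simp add: ennreal_mult[symmetric])
  also have "\<dots> = (\<Sum>i. hausdorff_pre s d (S i)) + e"
    unfolding ennreal_suminf_cmult
    by (subst suminf_ennreal_eq[OF zero_le_power power_half_series]) auto
  finally show "hausdorff_pre s d (\<Union>i. S i) \<le> (\<Sum>i. hausdorff_pre s d (S i)) + ennreal e" .
qed

lemma hausdorff_measure_countably_subadditive:
  "hausdorff_measure s (\<Union>i::nat. S i) \<le> (\<Sum>i. hausdorff_measure s (S i))"
proof (rule hausdorff_measure_leI)
  fix d :: real assume "d > 0"
  then show "hausdorff_pre s d (\<Union>i. S i) \<le> (\<Sum>i. hausdorff_measure s (S i))"
    by (intro order.trans[OF hausdorff_pre_countably_subadditive] suminf_le hausdorff_pre_le_measure) auto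
qed

lemma hausdorff_measure_UN_null:
  assumes "\<And>i::nat. hausdorff_measure s (S i) = 0"
  shows "hausdorff_measure s (\<Union>i. S i) = 0"
  using hausdorff_measure_countably_subadditive[of s S] assms by simp

lemma hausdorff_measure_Un_le:
  "hausdorff_measure s (S \<union> T) \<le> hausdorff_measure s S + hausdorff_measure s T"
proof -
  have "hausdorff_measure s (S \<union> T) = hausdorff_measure s (\<Union>i. binaryset S T i)"
    by (simp add: UN_binaryset_eq)
  also have "\<dots> \<le> (\<Sum>i. hausdorff_measure s (binaryset S T i))"
    by (rule hausdorff_measure_countably_subadditive)
  also have "\<dots> = hausdorff_measure s S + hausdorff_measure s T"
    by (rule suminf_binaryset_eq) simp
  finally show ?thesis .
qed

lemma hausdorff_measure_null_subset_Un:
  assumes "E \<subseteq> X \<union> Y" "hausdorff_measure s X = 0" "hausdorff_measure s Y = 0"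
  shows "hausdorff_measure s E = 0"
  using order.trans[OF hausdorff_measure_mono[OF assms(1), of s] hausdorff_measure_Un_le] assms by simp

text \<open>A Lipschitz map with constant \<open>C\<close> turns a cover into one whose diameters are larger by a factor of at
most \<open>C\<close>. Enlarging \<open>C\<close> to \<open>C + 1\<close> keeps the scale \<open>d / (C + 1)\<close> meaningful for constant maps.\<close>

lemma hausdorff_measure_lipschitz_image_null:
  assumes g: "C-lipschitz_on S g" and s: "s > 0" and null: "hausdorff_measure s S = 0"
  shows "hausdorff_measure s (g ` S) = 0"
proof -
  define C' where "C' = C + 1"
  have C': "C' > 0"
    using lipschitz_on_nonneg[OF g] by (simp add: C'_def)
  have "C'-lipschitz_on S g"
    by (rule lipschitz_on_mono[OF g order_refl]) (simp add: C'_def)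
  then have g': "\<And>x y. x \<in> S \<Longrightarrow> y \<in> S \<Longrightarrow> dist (g x) (g y) \<le> C' * dist x y"
    by (rule lipschitz_onD)
  have "hausdorff_pre s d (g ` S) \<le> 0" if d: "d > 0" for d
  proof (rule ennreal_le_epsilon)
    fix e :: real assume e: "e > 0"
    have "hausdorff_pre s (d / C') S \<le> 0"
      using hausdorff_pre_le_measure[of "d / C'" s S] d C' null by simp
    also have "0 < ennreal (e / C' powr s)"
      using e C' by simp
    finally obtain U where U: "S \<subseteq> (\<Union>i. U i)" "\<And>i. bounded (U i)" "\<And>i. diameter (U i) \<le> d / C'"
      "(\<Sum>i. ennreal (diameter (U i) powr s)) < ennreal (e / C' powr s)"
      by (elim hausdorff_pre_lessE) blast
    have V: "bounded (g ` (S \<inter> U i)) \<and> diameter (g ` (S \<inter> U i)) \<le> C' * diameter (U i)" for i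
    proof (rule diameter_leI)
      show "0 \<le> C' * diameter (U i)"
        using C' diameter_ge_0[OF U(2)] by simp
      fix a b assume "a \<in> g ` (S \<inter> U i)" "b \<in> g ` (S \<inter> U i)"
      then obtain x y where xy: "a = g x" "b = g y" "x \<in> S" "y \<in> S" "x \<in> U i" "y \<in> U i" by blast
      then have "dist a b \<le> C' * dist x y"
        using g' by simp
      also have "\<dots> \<le> C' * diameter (U i)"
        using diameter_bounded_bound[OF U(2)] xy C' by simp
      finally show "dist a b \<le> C' * diameter (U i)" .
    qed
    have "hausdorff_pre s d (g ` S) \<le> (\<Sum>i. ennreal (diameter (g ` (S \<inter> U i)) powr s))"
    proof (rule hausdorff_pre_le)
      show "diameter (g ` (S \<inter> U i)) \<le> d" for i
      proof -
        have "C' * diameter (U i) \<le> C' * (d / C')"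
          using U(3)[of i] C' by (intro mult_left_mono) auto
        then show ?thesis using V[of i] C' by simp
      qed
      show "g ` S \<subseteq> (\<Union>i. g ` (S \<inter> U i))"
      proof (rule image_subsetI)
        fix x assume "x \<in> S"
        then obtain i where "x \<in> U i" using U(1) by auto
        then show "g x \<in> (\<Union>i. g ` (S \<inter> U i))" using \<open>x \<in> S\<close> by auto
      qed
      show "bounded (g ` (S \<inter> U i))" for i using V by blast
    qed
    also have "\<dots> \<le> (\<Sum>i. ennreal (C' powr s) * ennreal (diameter (U i) powr s))"
    proof (intro suminf_le)
      fix i
      have "diameter (g ` (S \<inter> U i)) powr s \<le> (C' * diameter (U i)) powr s"
        using V[of i] s by (intro powr_mono2 diameter_ge_0) auto
      also have "\<dots> = C' powr s * diameter (U i) powr s"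
        by (rule powr_mult)
      finally show "ennreal (diameter (g ` (S \<inter> U i)) powr s)
          \<le> ennreal (C' powr s) * ennreal (diameter (U i) powr s)"
        by (simp add: ennreal_mult[symmetric] ennreal_leI)
    qed auto
    also have "\<dots> = ennreal (C' powr s) * (\<Sum>i. ennreal (diameter (U i) powr s))"
      by simp
    also have "\<dots> \<le> ennreal (C' powr s) * ennreal (e / C' powr s)"
      using U(4) by (intro mult_left_mono) auto
    also have "\<dots> = ennreal e"
      using C' e by (simp add: ennreal_mult[symmetric])
    finally show "hausdorff_pre s d (g ` S) \<le> 0 + ennreal e" by simp
  qed
  from hausdorff_measure_leI[OF this] show ?thesis by simp
qed

text \<open>Closures have the same diameters, so the covering sets may be taken closed; intersecting the unions of
covers at all scales \<open>1 / (m + 1)\<close> gives the hull.\<close>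

lemma hausdorff_borel_hull:
  fixes E :: "'a::metric_space set"
  assumes fin: "hausdorff_measure s E < top"
  obtains G where "G \<in> sets borel" "E \<subseteq> G" "hausdorff_measure s G \<le> hausdorff_measure s E"
proof -
  have "\<exists>U :: nat \<Rightarrow> 'a set. E \<subseteq> (\<Union>i. U i) \<and> (\<forall>i. bounded (U i)) \<and> (\<forall>i. diameter (U i) \<le> 1 / real (Suc m)) \<and>
     (\<Sum>i. ennreal (diameter (U i) powr s)) < hausdorff_measure s E + ennreal (1 / real (Suc m))" for m
  proof -
    have "hausdorff_pre s (1 / real (Suc m)) E \<le> hausdorff_measure s E + 0"
      using hausdorff_pre_le_measure[of "1 / real (Suc m)" s E] by simp
    also have "\<dots> < hausdorff_measure s E + ennreal (1 / real (Suc m))"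
      using fin by (subst ennreal_add_left_cancel_less) auto
    finally show ?thesis by (elim hausdorff_pre_lessE) blast
  qed
  then obtain U :: "nat \<Rightarrow> nat \<Rightarrow> 'a set" where U: "\<And>m. E \<subseteq> (\<Union>i. U m i)" "\<And>m i. bounded (U m i)"
    "\<And>m i. diameter (U m i) \<le> 1 / real (Suc m)"
    "\<And>m. (\<Sum>i. ennreal (diameter (U m i) powr s)) < hausdorff_measure s E + ennreal (1 / real (Suc m))"
    by metis
  define G where "G = (\<Inter>m. \<Union>i. closure (U m i))"
  show thesis
  proof (rule that)
    show "G \<in> sets borel"
      unfolding G_def by (intro sets.countable_INT'' sets.countable_UN) auto
    show "E \<subseteq> G"
    proof
      fix x assume "x \<in> E"
      then have "x \<in> (\<Union>i. closure (U m i))" for m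
        using subsetD[OF U(1)[of m]] closure_subset by fastforce
      then show "x \<in> G" unfolding G_def by blast
    qed
    show "hausdorff_measure s G \<le> hausdorff_measure s E"
    proof (rule hausdorff_measure_leI, rule ennreal_le_epsilon)
      fix d e :: real assume d: "d > 0" and e: "e > 0"
      then have "min d e > 0" by simp
      then obtain m :: nat where m: "1 / real (Suc m) < min d e" using nat_approx_posE by blast
      have "hausdorff_pre s d G \<le> hausdorff_pre s (1 / real (Suc m)) G"
        using m by (intro hausdorff_pre_antimono) auto
      also have "\<dots> \<le> (\<Sum>i. ennreal (diameter (closure (U m i)) powr s))"
        by (rule hausdorff_pre_le) (use U in \<open>auto simp: G_def diameter_closure\<close>)
      also have "\<dots> = (\<Sum>i. ennreal (diameter (U m i) powr s))"
        using U(2) by (simp add: diameter_closure)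
      also have "\<dots> \<le> hausdorff_measure s E + ennreal (1 / real (Suc m))" using U(4) by (rule less_imp_le)
      also have "\<dots> \<le> hausdorff_measure s E + ennreal e"
        using m by (intro add_left_mono ennreal_leI) auto
      finally show "hausdorff_pre s d G \<le> hausdorff_measure s E + ennreal e" .
    qed
  qed
qed

section \<open>Comparison of Hausdorff and Lebesgue measure\<close>

text \<open>A bounded set lies in a ball whose radius is the diameter of the set. The constant is far from
optimal, but only positivity and finiteness of constants matter in what follows.\<close>

lemma lebesgue_le_hausdorff_measure:
  fixes B :: "'m::euclidean_space set"
  assumes B: "B \<in> sets lebesgue"
  shows "emeasure lebesgue B \<le> ennreal (unit_ball_vol DIM('m)) * hausdorff_measure DIM('m) B"
proof (cases "hausdorff_measure DIM('m) B = top")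
  case True
  moreover have "ennreal (unit_ball_vol (real DIM('m))) \<noteq> 0"
    using unit_ball_vol_pos[of "real DIM('m)"] by (simp add: ennreal_eq_0_iff del: unit_ball_vol_pos)
  ultimately show ?thesis by (simp only: ennreal_mult_top top_greatest if_False)
next
  case False
  let ?n = "DIM('m)" and ?v = "unit_ball_vol DIM('m)"
  have v: "?v > 0" by simp
  then have v_ne: "?v \<noteq> 0" by linarith
  have "emeasure lebesgue B \<le> ?v * hausdorff_measure ?n B + e" if e: "e > 0" for e :: real
  proof -
    have "hausdorff_pre ?n 1 B < hausdorff_measure ?n B + ennreal (e / ?v)"
    proof -
      have "hausdorff_pre ?n 1 B \<le> hausdorff_measure ?n B + 0"
        using hausdorff_pre_le_measure[of 1 ?n B] by simp
      also have "\<dots> < hausdorff_measure ?n B + ennreal (e / ?v)"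
        using e v False by (subst ennreal_add_left_cancel_less) auto
      finally show ?thesis .
    qed
    then obtain U where U: "B \<subseteq> (\<Union>i. U i)" "\<And>i. bounded (U i)" "\<And>i. diameter (U i) \<le> 1"
      "(\<Sum>i. ennreal (diameter (U i) powr ?n)) < hausdorff_measure ?n B + ennreal (e / ?v)"
      by (elim hausdorff_pre_lessE) blast
    define c where "c i = (SOME x. x \<in> U i)" for i
    have sub: "U i \<subseteq> cball (c i) (diameter (U i))" for i
    proof
      fix x assume "x \<in> U i"
      moreover from this have "c i \<in> U i" unfolding c_def by (rule someI)
      ultimately show "x \<in> cball (c i) (diameter (U i))"
        using diameter_bounded_bound[OF U(2)] by simp
    qed
    have "emeasure lebesgue B \<le> emeasure lebesgue (\<Union>i. cball (c i) (diameter (U i)))"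
    proof (rule emeasure_mono)
      show "B \<subseteq> (\<Union>i. cball (c i) (diameter (U i)))"
      proof
        fix x assume "x \<in> B"
        then obtain i where "x \<in> U i" using U(1) by auto
        then show "x \<in> (\<Union>i. cball (c i) (diameter (U i)))" using sub[of i] by blast
      qed
    qed auto
    also have "\<dots> \<le> (\<Sum>i. emeasure lebesgue (cball (c i) (diameter (U i))))"
      by (intro emeasure_subadditive_countably) auto
    also have "\<dots> = (\<Sum>i. ennreal ?v * ennreal (diameter (U i) powr ?n))"
    proof (intro suminf_cong)
      fix i
      have d: "diameter (U i) \<ge> 0" by (rule diameter_ge_0[OF U(2)])
      have "diameter (U i) ^ ?n = diameter (U i) powr ?n"
      proof (cases "diameter (U i) = 0")
        case False
        then show ?thesis using d by (simp add: powr_realpow)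
      qed simp
      moreover have "emeasure lebesgue (cball (c i) (diameter (U i))) = ennreal (?v * diameter (U i) ^ ?n)"
        using emeasure_cball[OF d, of "c i"] by simp
      ultimately show "emeasure lebesgue (cball (c i) (diameter (U i)))
          = ennreal ?v * ennreal (diameter (U i) powr ?n)"
        using v by (simp only: ennreal_mult[OF less_imp_le powr_ge_zero])
    qed
    also have "\<dots> = ennreal ?v * (\<Sum>i. ennreal (diameter (U i) powr ?n))"
      by simp
    also have "\<dots> \<le> ennreal ?v * (hausdorff_measure ?n B + ennreal (e / ?v))"
      using U(4) by (intro mult_left_mono) auto
    also have "\<dots> = ?v * hausdorff_measure ?n B + e"
    proof -
      have "ennreal ?v * ennreal (e / ?v) = ennreal (?v * (e / ?v))"
        using v e by (intro ennreal_mult[symmetric]) auto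
      also have "?v * (e / ?v) = e" using nonzero_mult_div_cancel_left[OF v_ne, of e] by (simp only: times_divide_eq_right)
      finally show ?thesis by (simp only: distrib_left)
    qed
    finally show ?thesis .
  qed
  then show ?thesis by (rule ennreal_le_epsilon)
qed

text \<open>Cover \<open>Q\<close> by small dyadic cubes with disjoint interiors inside an open set that is only slightly larger
than \<open>Q\<close>. A cube of side \<open>l\<close> has diameter at most \<open>DIM('m) * l\<close> and volume \<open>l ^ DIM('m)\<close>, so the sum for
the images is bounded by the total volume of the cubes. The Lipschitz bound is assumed only at small scales
because the maps of collapsed sets satisfy it with a good constant only there.\<close>

lemma hausdorff_measure_image_le:
  fixes Q :: "'m::euclidean_space set" and g :: "'m \<Rightarrow> 'y::metric_space"
  assumes Q: "Q \<in> sets lebesgue" "bounded Q" and C: "C > 0" and \<delta>: "\<delta> > 0"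
    and g: "\<And>x y. x \<in> Q \<Longrightarrow> y \<in> Q \<Longrightarrow> dist x y < \<delta> \<Longrightarrow> dist (g x) (g y) \<le> C * dist x y"
  shows "hausdorff_measure DIM('m) (g ` Q) \<le> ennreal ((C * DIM('m)) ^ DIM('m)) * emeasure lebesgue Q"
proof (rule hausdorff_measure_leI)
  let ?n = "DIM('m)"
  define k where "k = (C * ?n) ^ ?n"
  have k: "k > 0" using C by (simp add: k_def)
  fix d :: real assume d: "d > 0"
  show "hausdorff_pre ?n d (g ` Q) \<le> ennreal k * emeasure lebesgue Q"
  proof (rule ennreal_le_epsilon)
    fix e :: real assume e: "e > 0"
    obtain T where T: "open T" "Q \<subseteq> T" "T - Q \<in> lmeasurable" "emeasure lebesgue (T - Q) < ennreal (e / k)"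
      using sets_lebesgue_outer_open[OF Q(1), of "e / k"] e k by auto
    \<comment> \<open>cubes of diameter below \<open>2 * \<rho>\<close> have images of diameter at most \<open>d\<close>\<close>
    define \<rho> where "\<rho> = min (\<delta> / 2) (d / (2 * C))"
    have \<rho>: "\<rho> > 0" "2 * \<rho> \<le> \<delta>" "C * (2 * \<rho>) \<le> d"
      using \<delta> d C by (auto simp: \<rho>_def min_def field_simps)
    have "\<exists>r>0. x \<in> Q \<longrightarrow> ball x r \<subseteq> T \<inter> ball x \<rho>" for x
    proof (cases "x \<in> Q")
      case True
      then have "open (T \<inter> ball x \<rho>)" "x \<in> T \<inter> ball x \<rho>"
        using T \<rho> by auto
      then show ?thesis by (meson openE)
    qed (auto intro: exI[of _ 1])
    then obtain R where R: "\<And>x. R x > 0" "\<And>x. x \<in> Q \<Longrightarrow> ball x (R x) \<subseteq> T \<inter> ball x \<rho>"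
      by metis
    have gauge: "gauge (\<lambda>x. ball x (R x))"
      using R by (simp add: gauge_def)
    obtain c where c0: "c > 0" "\<And>x. x \<in> Q \<Longrightarrow> norm x \<le> c"
      using Q(2) unfolding bounded_pos by blast
    have c: "Q \<subseteq> cbox (- c *\<^sub>R One) (c *\<^sub>R One)" "box (- c *\<^sub>R One :: 'm) (c *\<^sub>R One) \<noteq> {}"
    proof -
      have "\<bar>x \<bullet> b\<bar> \<le> c" if "x \<in> Q" "b \<in> Basis" for x b
        using Basis_le_norm[of b x] c0(2) that by force
      then show "Q \<subseteq> cbox (- c *\<^sub>R One) (c *\<^sub>R One)"
        by (auto simp: mem_box abs_le_iff minus_le_iff)
    qed (use c0 in \<open>simp add: box_ne_empty\<close>)
    obtain \<D> where D: "countable \<D>"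
      "\<And>K. K \<in> \<D> \<Longrightarrow> interior K \<noteq> {} \<and> (\<exists>c d. K = cbox c d)"
      "pairwise (\<lambda>A B. interior A \<inter> interior B = {}) \<D>"
      "\<And>K. K \<in> \<D> \<Longrightarrow> \<exists>x \<in> Q \<inter> K. K \<subseteq> ball x (R x)"
      "\<And>u v. cbox u v \<in> \<D> \<Longrightarrow> \<exists>n. \<forall>i \<in> Basis. v \<bullet> i - u \<bullet> i = (2 * c) / 2^n"
      "Q \<subseteq> \<Union>\<D>"
      using covering_lemma[OF c gauge] by force
    \<comment> \<open>the cubes as a sequence, padded with empty sets\<close>
    define K where "K i = (if i \<in> to_nat_on \<D> ` \<D> then from_nat_into \<D> i else {})" for i
    have K_in: "K i \<in> \<D> \<or> K i = {}" for i
      using D(1) by (auto simp: K_def)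
    have disj: "disjoint_family (\<lambda>i. interior (K i))"
    proof (unfold disjoint_family_on_def, intro ballI impI)
      fix i j :: nat assume "i \<noteq> j"
      show "interior (K i) \<inter> interior (K j) = {}"
      proof (cases "i \<in> to_nat_on \<D> ` \<D> \<and> j \<in> to_nat_on \<D> ` \<D>")
        case True
        then have "K i \<noteq> K j" "K i \<in> \<D>" "K j \<in> \<D>"
          using \<open>i \<noteq> j\<close> D(1) by (auto simp: K_def)
        then show ?thesis using D(3) by (auto simp: pairwise_def)
      qed (auto simp: K_def)
    qed
    have UK: "Q \<subseteq> (\<Union>i. K i)"
    proof
      fix x assume "x \<in> Q"
      then obtain L where "L \<in> \<D>" "x \<in> L" using D(6) by auto
      then show "x \<in> (\<Union>i. K i)"
        using D(1) by (auto simp: K_def intro!: exI[of _ "to_nat_on \<D> L"])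
    qed
    have KT: "K i \<subseteq> T" for i
    proof (cases "K i = {}")
      case False
      then obtain z where "z \<in> Q" "K i \<subseteq> ball z (R z)" using K_in[of i] D(4)[of "K i"] by blast
      then show ?thesis using R(2)[of z] by blast
    qed simp
    have diam: "bounded (g ` (Q \<inter> K i)) \<and> diameter (g ` (Q \<inter> K i)) \<le> d \<and>
       ennreal (diameter (g ` (Q \<inter> K i)) powr ?n) \<le> ennreal k * emeasure lebesgue (interior (K i))" for i
    proof (cases "K i \<in> \<D>")
      case True
      then obtain u v where uv: "K i = cbox u v" using D(2) by blast
      then have ne: "box u v \<noteq> {}" using D(2)[OF True] by simp
      obtain m where m: "\<And>i. i \<in> Basis \<Longrightarrow> v \<bullet> i - u \<bullet> i = 2 * c / 2^m"
        using D(5) True uv by metis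
      define l where "l = 2 * c / 2^m"
      obtain b :: 'm where "b \<in> Basis" using nonempty_Basis by blast
      then have l: "l > 0"
        using m[OF \<open>b \<in> Basis\<close>] ne unfolding box_ne_empty l_def by force
      obtain z where z: "z \<in> Q" "K i \<subseteq> ball z (R z)" using D(4)[OF True] by blast
      have small: "dist x y < 2 * \<rho>" if "x \<in> K i" "y \<in> K i" for x y
      proof -
        have "dist z x < \<rho>" "dist z y < \<rho>"
          using subsetD[OF R(2)[OF z(1)] subsetD[OF z(2) that(1)]]
            subsetD[OF R(2)[OF z(1)] subsetD[OF z(2) that(2)]] by auto
          moreover have "dist x y \<le> dist z x + dist z y" by (rule dist_triangle3)
          ultimately show ?thesis by linarith
      qed
      have near: "dist x y \<le> ?n * l" if "x \<in> K i" "y \<in> K i" for x y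
      proof -
        have "norm (x - y) \<le> (\<Sum>b\<in>Basis. \<bar>(x - y) \<bullet> b\<bar>)" by (rule norm_le_l1)
        also have "\<dots> \<le> (\<Sum>b\<in>(Basis :: 'm set). l)"
        proof (rule sum_mono)
          fix b :: 'm assume b: "b \<in> Basis"
          then have "u \<bullet> b \<le> x \<bullet> b" "x \<bullet> b \<le> v \<bullet> b" "u \<bullet> b \<le> y \<bullet> b" "y \<bullet> b \<le> v \<bullet> b"
            using that unfolding uv mem_box by auto
          then show "\<bar>(x - y) \<bullet> b\<bar> \<le> l"
            using m[OF b] unfolding l_def inner_diff_left by linarith
        qed
        finally show ?thesis by (simp add: dist_norm)
      qed
      have image: "bounded (g ` (Q \<inter> K i)) \<and> diameter (g ` (Q \<inter> K i)) \<le> C * a"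
        if a: "0 \<le> a" "\<And>x y. x \<in> K i \<Longrightarrow> y \<in> K i \<Longrightarrow> dist x y \<le> a" for a
      proof (rule diameter_leI)
        show "0 \<le> C * a" using C a(1) by simp
        fix p q assume "p \<in> g ` (Q \<inter> K i)" "q \<in> g ` (Q \<inter> K i)"
        then obtain x y where xy: "p = g x" "q = g y" "x \<in> Q" "y \<in> Q" "x \<in> K i" "y \<in> K i" by blast
        then have "dist p q \<le> C * dist x y"
          using g[of x y] small[of x y] \<rho> by auto
        also have "\<dots> \<le> C * a"
          using a(2) xy C by simp
        finally show "dist p q \<le> C * a" .
      qed
      have b1: "bounded (g ` (Q \<inter> K i)) \<and> diameter (g ` (Q \<inter> K i)) \<le> C * (?n * l)"
        using near l by (intro image) auto
      have b2: "bounded (g ` (Q \<inter> K i)) \<and> diameter (g ` (Q \<inter> K i)) \<le> C * (2 * \<rho>)"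
        using small \<rho>(1) by (intro image) (auto intro: less_imp_le)
      have "diameter (g ` (Q \<inter> K i)) powr ?n \<le> (C * (?n * l)) powr ?n"
        using b1 by (intro powr_mono2 diameter_ge_0) simp_all
      also have "\<dots> = k * l ^ ?n"
      proof -
        have "C * (?n * l) > 0" using C l by simp
        then have "(C * (?n * l)) powr ?n = (C * (?n * l)) ^ ?n" by (rule powr_realpow)
        then show ?thesis by (simp only: k_def power_mult_distrib mult.assoc)
      qed
      also have "ennreal \<dots> = ennreal k * emeasure lebesgue (interior (K i))"
      proof -
        have "emeasure lborel (box u v) = ennreal (\<Prod>b\<in>Basis. (v - u) \<bullet> b)"
          using ne by (intro emeasure_lborel_box) (simp add: box_ne_empty less_imp_le)
        also have "(\<Prod>b\<in>Basis. (v - u) \<bullet> b) = (\<Prod>b\<in>(Basis::'m set). l)"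
          using m by (intro prod.cong) (auto simp: l_def inner_diff_left)
        also have "\<dots> = l ^ ?n" by simp
        finally have "emeasure lebesgue (interior (K i)) = ennreal (l ^ ?n)" using uv by simp
        then show ?thesis using k l by (simp only: ennreal_mult[OF less_imp_le zero_le_power[OF less_imp_le]])
      qed
      finally show ?thesis
        using b2 \<rho>(3) by (metis ennreal_leI order.trans)
    next
      case False
      then have "K i = {}" using K_in by blast
      then show ?thesis using d by simp
    qed
    have "hausdorff_pre ?n d (g ` Q) \<le> (\<Sum>i. ennreal (diameter (g ` (Q \<inter> K i)) powr ?n))"
    proof (rule hausdorff_pre_le)
      show "g ` Q \<subseteq> (\<Union>i. g ` (Q \<inter> K i))"
      proof (rule image_subsetI)
        fix x assume "x \<in> Q"
        then obtain i where "x \<in> K i" using UK by auto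
        then show "g x \<in> (\<Union>i. g ` (Q \<inter> K i))" using \<open>x \<in> Q\<close> by auto
      qed
      show "bounded (g ` (Q \<inter> K i))" for i using diam by blast
      show "diameter (g ` (Q \<inter> K i)) \<le> d" for i using diam by blast
    qed
    also have "\<dots> \<le> (\<Sum>i. ennreal k * emeasure lebesgue (interior (K i)))"
      using diam by (intro suminf_le) auto
    also have "\<dots> = ennreal k * (\<Sum>i. emeasure lebesgue (interior (K i)))"
      by simp
    also have "(\<Sum>i. emeasure lebesgue (interior (K i))) = emeasure lebesgue (\<Union>i. interior (K i))"
      by (intro suminf_emeasure) (use disj in auto)
    also have "\<dots> \<le> emeasure lebesgue T"
    proof (rule emeasure_mono)
      show "(\<Union>i. interior (K i)) \<subseteq> T"
        using KT interior_subset by (meson UN_least order.trans)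
    qed (use T(1) in simp)
    also have "\<dots> \<le> emeasure lebesgue Q + emeasure lebesgue (T - Q)"
    proof -
      have "emeasure lebesgue (Q \<union> (T - Q)) \<le> emeasure lebesgue Q + emeasure lebesgue (T - Q)"
        by (rule emeasure_subadditive[OF Q(1) fmeasurableD[OF T(3)]])
      moreover have "Q \<union> (T - Q) = T" using T(2) by blast
      ultimately show ?thesis by simp
    qed
    also have "\<dots> \<le> emeasure lebesgue Q + ennreal (e / k)"
      using T(4) by (intro add_left_mono) auto
    finally have "hausdorff_pre ?n d (g ` Q) \<le> ennreal k * (emeasure lebesgue Q + ennreal (e / k))"
      by (simp add: mult_left_mono)
    also have "\<dots> = ennreal k * emeasure lebesgue Q + ennreal e"
    proof -
      have "ennreal k * ennreal (e / k) = ennreal (k * (e / k))"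
        using k e by (intro ennreal_mult[symmetric]) auto
      also have "k * (e / k) = e" using k by simp
      finally show ?thesis by (simp only: distrib_left)
    qed
    finally show "hausdorff_pre ?n d (g ` Q) \<le> ennreal k * emeasure lebesgue Q + ennreal e" .
  qed
qed

section \<open>Lebesgue density points\<close>

definition density_point :: "'m::euclidean_space set \<Rightarrow> 'm \<Rightarrow> bool" where
  "density_point A x \<longleftrightarrow> (\<forall>e>0. \<exists>r0>0. \<forall>r. 0 < r \<and> r < r0 \<longrightarrow>
     measure lebesgue (cball x r - A) \<le> e * measure lebesgue (cball x r))"

lemma cball_diff_lmeasurable [simp]:
  "A \<in> sets lebesgue \<Longrightarrow> cball x r - A \<in> lmeasurable"
  by (intro fmeasurable_Diff) auto

text \<open>If many points had small balls of which a fixed proportion lies outside \<open>A\<close>, then a disjoint Vitali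
family of such balls inside a tight open neighbourhood of \<open>A\<close> would have small total measure, because
the parts outside \<open>A\<close> all lie in the thin difference between the neighbourhood and \<open>A\<close>.\<close>

theorem negligible_not_density_point:
  fixes A :: "'m::euclidean_space set"
  assumes A: "A \<in> sets lebesgue"
  shows "negligible {x \<in> A. \<not> density_point A x}"
proof -
  define N where "N m k = {x \<in> A \<inter> ball 0 (real k). \<forall>r0>0. \<exists>r. 0 < r \<and> r < r0 \<and>
      measure lebesgue (cball x r - A) > (1 / Suc m) * measure lebesgue (cball x r)}" for m k
  have neg: "negligible (N m k)" for m k
  proof (subst negligible_outer_le, intro allI impI)
    fix e :: real assume e: "e > 0"
    define c where "c = 1 / real (Suc m)"
    have c: "c > 0" by (simp add: c_def)
    define A' where "A' = A \<inter> ball 0 (real k)"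
    have A': "A' \<in> sets lebesgue" unfolding A'_def using A by (intro sets.Int) auto
    obtain T where T: "open T" "A' \<subseteq> T" "T - A' \<in> lmeasurable" "emeasure lebesgue (T - A') < ennreal (c * e)"
      using sets_lebesgue_outer_open[OF A', of "c * e"] e c by auto
    define T' where "T' = T \<inter> ball 0 (real k)"
    have T': "open T'" "A' \<subseteq> T'" using T by (auto simp: T'_def A'_def)
    define I where "I = {(x, r). x \<in> N m k \<and> 0 < r \<and> cball x r \<subseteq> T' \<and>
        measure lebesgue (cball x r - A) > c * measure lebesgue (cball x r)}"
    have 1: "\<exists>i. i \<in> I \<and> x \<in> cball (fst i) (snd i) \<and> snd i < d" if x: "x \<in> N m k" and d: "d > 0" for x d
    proof -
      have "x \<in> T'" using x T' by (auto simp: N_def A'_def)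
      then obtain s where s: "s > 0" "cball x s \<subseteq> T'"
        using T' open_contains_cball by blast
      have "min s d > 0" using s d by simp
      then obtain r where r: "0 < r" "r < min s d" "measure lebesgue (cball x r - A) > c * measure lebesgue (cball x r)"
        using x unfolding N_def c_def by blast
      have "cball x r \<subseteq> cball x s" using r by auto
      then have "(x, r) \<in> I" using x r s by (auto simp: I_def)
      then show ?thesis using r by (intro exI[of _ "(x, r)"]) auto
    qed
    have I_pos: "0 < snd i" if "i \<in> I" for i
      using that by (auto simp: I_def)
    obtain C where C: "countable C" "C \<subseteq> I"
      "pairwise (\<lambda>i j. disjnt (cball (fst i) (snd i)) (cball (fst j) (snd j))) C"
      "negligible (N m k - (\<Union>i \<in> C. cball (fst i) (snd i)))"
      by (rule Vitali_covering_theorem_cballs[of I snd "N m k" fst, OF I_pos 1])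
    define B where "B i = cball (fst i) (snd i)" for i :: "'m \<times> real"
    have disj: "disjoint_family_on B C"
      using C(3) by (auto simp: disjoint_family_on_def pairwise_def disjnt_def B_def)
    then have disj': "disjoint_family_on (\<lambda>i. B i - A) C"
      unfolding disjoint_family_on_def by blast
    define W where "W = (\<Union>i\<in>C. B i)"
    have W: "W \<in> sets lebesgue"
      unfolding W_def using C(1) by (intro sets.countable_UN') (auto simp: B_def)
    have "ennreal c * emeasure lebesgue W = (\<integral>\<^sup>+i. ennreal c * emeasure lebesgue (B i) \<partial>count_space C)"
      unfolding W_def using C(1) disj
      by (subst emeasure_UN_countable) (auto simp: B_def nn_integral_cmult)
    also have "\<dots> \<le> (\<integral>\<^sup>+i. emeasure lebesgue (B i - A) \<partial>count_space C)"
    proof (rule nn_integral_mono)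
      fix i assume "i \<in> space (count_space C)"
      then have "i \<in> I" using C(2) by auto
      then have "c * measure lebesgue (B i) \<le> measure lebesgue (B i - A)"
        by (auto simp: I_def B_def)
      moreover have "B i \<in> lmeasurable" "B i - A \<in> lmeasurable"
        using A by (auto simp: B_def)
      ultimately show "ennreal c * emeasure lebesgue (B i) \<le> emeasure lebesgue (B i - A)"
        using c by (simp only: emeasure_eq_measure2) (simp add: ennreal_mult[symmetric] ennreal_leI)
    qed
    also have "\<dots> = emeasure lebesgue (\<Union>i\<in>C. B i - A)"
      using C(1) disj' A by (intro emeasure_UN_countable[symmetric]) (auto simp: B_def)
    also have "\<dots> \<le> emeasure lebesgue (T - A')"
    proof (rule emeasure_mono)
      show "(\<Union>i\<in>C. B i - A) \<subseteq> T - A'"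
        using C(2) by (fastforce simp: I_def B_def T'_def A'_def)
    qed (use T in auto)
    also have "\<dots> < ennreal (c * e)" by (rule T(4))
    finally have less: "ennreal c * emeasure lebesgue W < ennreal c * ennreal e"
      using c e by (simp add: ennreal_mult)
    have We: "emeasure lebesgue W \<le> ennreal e"
    proof (rule ccontr)
      assume "\<not> ?thesis"
      then have "ennreal c * ennreal e \<le> ennreal c * emeasure lebesgue W" by (intro mult_left_mono) auto
      then show False using less by simp
    qed
    have Wm: "W \<in> lmeasurable"
      using W We by (intro fmeasurableI) (auto simp: top_unique less_top[symmetric])
    have neg: "negligible (N m k - W)" using C(4) by (simp add: W_def B_def)
    show "\<exists>T. N m k \<subseteq> T \<and> T \<in> lmeasurable \<and> measure lebesgue T \<le> e"
    proof (intro exI conjI)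
      show "N m k \<subseteq> W \<union> (N m k - W)" by blast
      show "W \<union> (N m k - W) \<in> lmeasurable"
        using Wm neg by (intro fmeasurable.Un) (auto simp: negligible_imp_measurable)
      have "measure lebesgue (W \<union> (N m k - W)) = measure lebesgue W"
        using W neg by (intro measure_Un_null_set) (auto simp: negligible_iff_null_sets)
      also have "\<dots> \<le> e" using We e Wm by (simp add: emeasure_eq_measure2)
      finally show "measure lebesgue (W \<union> (N m k - W)) \<le> e" .
    qed
  qed
  have "{x \<in> A. \<not> density_point A x} \<subseteq> (\<Union>m. \<Union>k. N m k)"
  proof
    fix x assume "x \<in> {x \<in> A. \<not> density_point A x}"
    then obtain e where x: "x \<in> A" and e: "e > 0" "\<forall>r0>0. \<exists>r. 0 < r \<and> r < r0 \<and>
        measure lebesgue (cball x r - A) > e * measure lebesgue (cball x r)"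
      by (auto simp: density_point_def not_le)
    obtain m where m: "1 / real (Suc m) < e" using e(1) nat_approx_posE by blast
    obtain k where k: "norm x < real k" using reals_Archimedean2 by blast
    have "x \<in> N m k"
      unfolding N_def
    proof (intro CollectI conjI allI impI)
      fix r0 :: real assume "r0 > 0"
      then obtain r where r: "0 < r" "r < r0" "measure lebesgue (cball x r - A) > e * measure lebesgue (cball x r)"
        using e by blast
      moreover have "e * measure lebesgue (cball x r) \<ge> (1 / Suc m) * measure lebesgue (cball x r)"
        using m by (intro mult_right_mono) auto
      ultimately show "\<exists>r. 0 < r \<and> r < r0 \<and> (1 / Suc m) * measure lebesgue (cball x r) < measure lebesgue (cball x r - A)"
        by (intro exI[of _ r]) auto
    qed (use x k in auto)
    then show "x \<in> (\<Union>m. \<Union>k. N m k)" by blast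
  qed
  moreover have "negligible (\<Union>m. \<Union>k. N m k)"
    using neg by (intro negligible_countable_Union countable_image) (auto intro!: negligible_countable_Union)
  ultimately show ?thesis by (rule negligible_subset[rotated])
qed

text \<open>A ball of radius \<open>\<eta> * r\<close> that misses \<open>A\<close> would occupy a fixed proportion of the ball of radius \<open>2 * r\<close>.\<close>

lemma density_point_imp_dense:
  fixes A :: "'m::euclidean_space set"
  assumes A: "A \<in> sets lebesgue" and x: "density_point A x" and \<eta>: "\<eta> > 0"
  shows "\<exists>r0>0. \<forall>r y. 0 < r \<and> r < r0 \<and> y \<in> cball x r \<longrightarrow> (\<exists>p\<in>A. dist y p \<le> \<eta> * r)"
proof -
  let ?n = "DIM('m)" and ?v = "unit_ball_vol DIM('m)"
  define h where "h = min \<eta> 1"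
  have h: "0 < h" "h \<le> 1" "h \<le> \<eta>" using \<eta> by (auto simp: h_def)
  obtain r0 where r0: "r0 > 0" "\<And>r. 0 < r \<Longrightarrow> r < r0 \<Longrightarrow>
      measure lebesgue (cball x r - A) \<le> ((h / 2) ^ ?n / 2) * measure lebesgue (cball x r)"
    using x h unfolding density_point_def by (metis half_gt_zero zero_less_power)
  show ?thesis
  proof (intro exI[of _ "r0 / 2"] conjI allI impI)
    fix r y assume ry: "0 < r \<and> r < r0 / 2 \<and> y \<in> cball x r"
    show "\<exists>p\<in>A. dist y p \<le> \<eta> * r"
    proof (rule ccontr)
      assume no: "\<not> ?thesis"
      have hr: "h * r \<le> \<eta> * r" "h * r \<le> r" using h ry by (auto simp: mult_left_le_one_le)
      have "cball y (h * r) \<subseteq> cball x (2 * r) - A"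
      proof
        fix z assume "z \<in> cball y (h * r)"
        then have z: "dist y z \<le> h * r" by simp
        moreover have "dist x z \<le> dist x y + dist y z" by (rule dist_triangle)
        moreover have "dist x y \<le> r" using ry by simp
        ultimately have "dist x z \<le> 2 * r" using hr by linarith
        moreover have "z \<notin> A" using no z hr by (meson order.trans)
        ultimately show "z \<in> cball x (2 * r) - A" by simp
      qed
      then have "measure lebesgue (cball y (h * r)) \<le> measure lebesgue (cball x (2 * r) - A)"
        using A by (intro measure_mono_fmeasurable) auto
      also have "\<dots> \<le> ((h / 2) ^ ?n / 2) * measure lebesgue (cball x (2 * r))"
        using r0 ry by simp
      also have "\<dots> = ((h / 2) ^ ?n / 2) * (?v * (2 * r) ^ ?n)"
        using ry by (simp add: content_cball)
      also have "\<dots> = (?v * (h * r) ^ ?n) / 2"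
        by (simp add: power_mult_distrib power_divide)
      finally have "?v * (h * r) ^ ?n \<le> (?v * (h * r) ^ ?n) / 2"
        using ry h by (simp add: content_cball)
      moreover have "?v * (h * r) ^ ?n > 0" using ry h by simp
      ultimately show False by linarith
    qed
  qed (use r0 in auto)
qed

lemma density_point_interval:
  fixes A :: "real set"
  assumes A: "A \<in> sets lebesgue" and x: "density_point A x" and \<eta>: "\<eta> > 0"
  shows "\<exists>r0>0. \<forall>a b. a < b \<and> x \<in> {a..b} \<and> b - a < r0 \<longrightarrow> measure lebesgue ({a..b} - A) \<le> \<eta> * (b - a)"
proof -
  obtain r0 where r0: "r0 > 0" "\<And>r. 0 < r \<Longrightarrow> r < r0 \<Longrightarrow>
      measure lebesgue (cball x r - A) \<le> (\<eta> / 2) * measure lebesgue (cball x r)"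
    using x \<eta> unfolding density_point_def by (metis half_gt_zero)
  show ?thesis
  proof (intro exI[of _ r0] conjI allI impI)
    fix a b assume ab: "a < b \<and> x \<in> {a..b} \<and> b - a < r0"
    have "measure lebesgue ({a..b} - A) \<le> measure lebesgue (cball x (b - a) - A)"
    proof (rule measure_mono_fmeasurable)
      show "{a..b} - A \<subseteq> cball x (b - a) - A" using ab by (auto simp: dist_real_def)
      show "{a..b} - A \<in> sets lebesgue" using A by auto
    qed (use A in auto)
    also have "\<dots> \<le> (\<eta> / 2) * measure lebesgue (cball x (b - a))" using r0 ab by simp
    also have "\<dots> = \<eta> * (b - a)" using ab by (simp add: cball_eq_atLeastAtMost)
    finally show "measure lebesgue ({a..b} - A) \<le> \<eta> * (b - a)" .
  qed (use r0 in auto)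
qed

section \<open>Lipschitz functions\<close>

text \<open>This is McShane's extension: the infimum over \<open>a\<close> of the largest functions with constant \<open>M\<close> that agree
with \<open>f\<close> at \<open>a\<close>.\<close>

lemma lipschitz_real_extension:
  fixes f :: "'a::metric_space \<Rightarrow> real"
  assumes f: "M-lipschitz_on A f"
  shows "\<exists>g. M-lipschitz_on UNIV g \<and> (\<forall>x\<in>A. g x = f x)"
proof (cases "A = {}")
  case True
  then show ?thesis using lipschitz_on_nonneg[OF f]
    by (intro exI[of _ "\<lambda>_. 0"]) (auto intro: lipschitz_on_mono[OF lipschitz_on_constant])
next
  case False
  have M: "M \<ge> 0" by (rule lipschitz_on_nonneg[OF f])
  define g where "g x = (INF a\<in>A. f a + M * dist a x)" for x
  have lower: "f b - M * dist b x \<le> f a + M * dist a x" if "a \<in> A" "b \<in> A" for a b x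
  proof -
    have "f b - f a \<le> M * dist b a" using lipschitz_onD[OF f, of b a] that by (simp add: dist_real_def)
    also have "\<dots> \<le> M * (dist b x + dist a x)"
      using M by (intro mult_left_mono dist_triangle2)
    finally show ?thesis by (simp add: algebra_simps)
  qed
  have bdd: "bdd_below ((\<lambda>a. f a + M * dist a x) ` A)" for x
  proof -
    obtain b where "b \<in> A" using False by blast
    then show ?thesis using lower by (intro bdd_belowI2[of _ "f b - M * dist b x"]) blast
  qed
  have le: "g x \<le> f a + M * dist a x" if "a \<in> A" for a x
    unfolding g_def by (rule cINF_lower[OF bdd that])
  have ge: "g x \<ge> c" if "\<And>a. a \<in> A \<Longrightarrow> c \<le> f a + M * dist a x" for c x
    unfolding g_def using False that by (rule cINF_greatest)
  have diff: "g x \<le> g y + M * dist x y" for x y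
  proof -
    have "g x - M * dist x y \<le> g y"
    proof (rule ge)
      fix a assume a: "a \<in> A"
      have "g x \<le> f a + M * dist a x" using le[OF a] .
      also have "\<dots> \<le> f a + M * (dist a y + dist x y)"
        using M by (intro add_left_mono mult_left_mono dist_triangle2)
      finally show "g x - M * dist x y \<le> f a + M * dist a y" by (simp add: algebra_simps)
    qed
    then show ?thesis by simp
  qed
  show ?thesis
  proof (intro exI[of _ g] conjI ballI)
    show "M-lipschitz_on UNIV g"
    proof (rule lipschitz_onI)
      show "dist (g x) (g y) \<le> M * dist x y" for x y
        using diff[of x y] diff[of y x] by (simp add: dist_real_def dist_commute abs_le_iff)
    qed (rule M)
    fix x assume x: "x \<in> A"
    show "g x = f x"
    proof (rule antisym)
      show "g x \<le> f x" using le[OF x, of x] by simp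
      show "f x \<le> g x" using lower[OF _ x, of _ x] by (intro ge) simp
    qed
  qed
qed

lemma lipschitz_on_dist: "1-lipschitz_on S (\<lambda>x. dist p x)"
proof (rule lipschitz_onI)
  fix x y
  show "dist (dist p x) (dist p y) \<le> 1 * dist x y"
    using dist_triangle[of p x y] dist_triangle[of p y x] by (simp add: dist_real_def abs_le_iff dist_commute)
qed simp

lemma lipschitz_on_vec:
  fixes U :: "'a::metric_space \<Rightarrow> real^'n"
  assumes "\<And>j. M-lipschitz_on S (\<lambda>x. U x $ j)"
  shows "(real CARD('n) * M)-lipschitz_on S U"
proof (rule lipschitz_onI)
  fix x y assume "x \<in> S" "y \<in> S"
  have "dist (U x) (U y) \<le> (\<Sum>j\<in>UNIV. \<bar>(U x - U y) $ j\<bar>)"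
    unfolding dist_norm by (rule norm_le_l1_cart)
  also have "\<dots> \<le> (\<Sum>j\<in>(UNIV :: 'n set). M * dist x y)"
    using lipschitz_onD[OF assms \<open>x \<in> S\<close> \<open>y \<in> S\<close>] by (intro sum_mono) (simp add: dist_real_def)
  finally show "dist (U x) (U y) \<le> real CARD('n) * M * dist x y" by simp
qed (use lipschitz_on_nonneg[OF assms] in simp)

section \<open>Difference quotients on the real line\<close>

text \<open>Induction by the left end point: the interval with the largest one lies to the right of all others, so the
others are contained in the interval from \<open>a\<close> to its left end point.\<close>

lemma sum_increments_disjoint_intervals_le:
  fixes w :: "real \<Rightarrow> real"
  assumes w: "mono w" and D: "finite D"
    and I: "\<And>i. i \<in> D \<Longrightarrow> a \<le> fst i \<and> fst i < snd i \<and> snd i \<le> b"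
    and disj: "\<And>i j. i \<in> D \<Longrightarrow> j \<in> D \<Longrightarrow> i \<noteq> j \<Longrightarrow> {fst i..snd i} \<inter> {fst j..snd j} = {}"
    and ab: "a \<le> b"
  shows "(\<Sum>i\<in>D. w (snd i) - w (fst i)) \<le> w b - w a"
  using D I disj ab
proof (induction D arbitrary: b rule: finite_ranking_induct[where f = fst])
  case empty
  then show ?case using monoD[OF w] by simp
next
  case (insert x S)
  show ?case
  proof (cases "x \<in> S")
    case True
    then have "insert x S = S" by blast
    moreover have "(\<Sum>i\<in>S. w (snd i) - w (fst i)) \<le> w b - w a"
      by (rule insert.IH) (use insert in blast)+
    ultimately show ?thesis by simp
  next
    case False
    have x: "a \<le> fst x" "fst x < snd x" "snd x \<le> b" using insert by auto
    have "(\<Sum>i\<in>S. w (snd i) - w (fst i)) \<le> w (fst x) - w a"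
    proof (rule insert.IH)
      fix i assume i: "i \<in> S"
      have "{fst i..snd i} \<inter> {fst x..snd x} = {}" using insert.prems(2) i False by blast
      moreover have "fst i \<le> fst x" "a \<le> fst i" "fst i < snd i" using insert i by auto
      ultimately have "snd i < fst x" using x by (auto simp: disjoint_iff not_le)
      then show "a \<le> fst i \<and> fst i < snd i \<and> snd i \<le> fst x"
        using \<open>a \<le> fst i\<close> \<open>fst i < snd i\<close> by simp
    qed (use insert x in blast)+
    moreover have "w (snd x) \<le> w b" using x monoD[OF w] by blast
    ultimately show ?thesis using False insert.hyps by simp
  qed
qed

text \<open>The intervals on which the mean slope of \<open>w\<close> is at least \<open>c\<close> form a Vitali cover of \<open>F\<close>; a disjoint
subfamily exhausts \<open>F\<close> up to a null set, and the increments over disjoint intervals add up to at most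
\<open>w b - w a\<close>. This single estimate yields both the differentiability almost everywhere and the uniform
bounds for sequences of functions below.\<close>

lemma steep_set_growth:
  fixes w :: "real \<Rightarrow> real"
  assumes w: "mono w" and F: "F \<in> sets lebesgue" and c: "0 \<le> c" and ab: "a \<le> b"
    and steep: "\<And>x d. x \<in> F \<Longrightarrow> d > 0 \<Longrightarrow> \<exists>t. t \<noteq> 0 \<and> \<bar>t\<bar> < d \<and> c \<le> (w (x + t) - w x) / t"
  shows "c * measure lebesgue (F \<inter> {a..b}) \<le> w b - w a"
proof -
  define F' where "F' = F \<inter> {a<..<b}"
  define I where "I = {i. fst i < snd i \<and> {fst i..snd i} \<subseteq> {a<..<b} \<and> c * (snd i - fst i) \<le> w (snd i) - w (fst i)}"
  define m where "m i = (fst i + snd i) / 2" for i :: "real \<times> real"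
  define r where "r i = (snd i - fst i) / 2" for i :: "real \<times> real"
  have cb: "cball (m i) (r i) = {fst i..snd i}" for i
    by (simp add: m_def r_def cball_eq_atLeastAtMost field_simps)
  have r_pos: "0 < r i" if "i \<in> I" for i
    using that by (simp add: I_def r_def)
  have cover: "\<exists>i. i \<in> I \<and> x \<in> cball (m i) (r i) \<and> r i < d" if x: "x \<in> F'" and d: "d > 0" for x d
  proof -
    have x': "x \<in> F" "a < x" "x < b" using x by (auto simp: F'_def)
    define e where "e = min d (min (x - a) (b - x))"
    have e: "e > 0" "e \<le> d" "e \<le> x - a" "e \<le> b - x" using x' d by (auto simp: e_def)
    obtain t where t: "t \<noteq> 0" "\<bar>t\<bar> < e" "c \<le> (w (x + t) - w x) / t"
      using steep[OF x'(1) e(1)] by blast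
    define i where "i = (if t > 0 then (x, x + t) else (x + t, x))"
    have "i \<in> I"
    proof (cases "t > 0")
      case True
      then show ?thesis using t e by (auto simp: I_def i_def field_simps)
    next
      case False
      then have "t < 0" using t by simp
      then show ?thesis using t e by (auto simp: I_def i_def field_simps)
    qed
    moreover have "x \<in> cball (m i) (r i)" unfolding cb using t by (auto simp: i_def)
    moreover have "r i < d" using t e by (auto simp: r_def i_def)
    ultimately show ?thesis by blast
  qed
  obtain C where C: "countable C" "C \<subseteq> I"
    "pairwise (\<lambda>i j. disjnt (cball (m i) (r i)) (cball (m j) (r j))) C"
    "negligible (F' - (\<Union>i \<in> C. cball (m i) (r i)))"
    by (rule Vitali_covering_theorem_cballs[of I r F' m, OF r_pos cover])
  have disj: "{fst i..snd i} \<inter> {fst j..snd j} = {}" if "i \<in> C" "j \<in> C" "i \<noteq> j" for i j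
    using C(3) that unfolding pairwise_def cb disjnt_def by blast
  have fin: "c * measure lebesgue (\<Union>i\<in>D. {fst i..snd i}) \<le> w b - w a" if D: "D \<subseteq> C" "finite D" for D
  proof -
    have "measure lebesgue (\<Union>i\<in>D. {fst i..snd i}) \<le> (\<Sum>i\<in>D. measure lebesgue {fst i..snd i})"
      using D by (intro measure_UNION_le) auto
    also have "\<dots> = (\<Sum>i\<in>D. snd i - fst i)"
      using D C(2) by (intro sum.cong) (auto simp: I_def less_imp_le)
    finally have "c * measure lebesgue (\<Union>i\<in>D. {fst i..snd i}) \<le> c * (\<Sum>i\<in>D. snd i - fst i)"
      using c by (intro mult_left_mono)
    also have "\<dots> \<le> (\<Sum>i\<in>D. w (snd i) - w (fst i))"
      unfolding sum_distrib_left using D C(2) by (intro sum_mono) (auto simp: I_def)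
    also have "\<dots> \<le> w b - w a"
    proof (rule sum_increments_disjoint_intervals_le[OF w D(2) _ _ ab])
      fix i assume "i \<in> D"
      then have i: "fst i < snd i" "{fst i..snd i} \<subseteq> {a<..<b}" using D C(2) by (auto simp: I_def)
      then have "fst i \<in> {a<..<b}" "snd i \<in> {a<..<b}" by (auto simp: subset_iff less_imp_le)
      then show "a \<le> fst i \<and> fst i < snd i \<and> snd i \<le> b" using i by auto
    qed (use disj D in blast)
    finally show ?thesis .
  qed
  define W where "W = (\<Union>i\<in>C. {fst i..snd i})"
  have Wab: "W \<subseteq> {a..b}" using C(2) unfolding W_def I_def by force
  have Wm: "W \<in> lmeasurable"
  proof (rule bounded_set_imp_lmeasurable)
    show "bounded W" by (rule bounded_subset[OF compact_imp_bounded[OF compact_Icc] Wab])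
    show "W \<in> sets lebesgue" unfolding W_def using C(1) by (intro sets.countable_UN') auto
  qed
  have W_le: "c * measure lebesgue W \<le> w b - w a"
  proof (cases "C = {}")
    case True
    then show ?thesis using ab monoD[OF w] by (simp add: W_def)
  next
    case False
    define S where "S n = (\<Union>i\<in>from_nat_into C ` {..n}. {fst i..snd i})" for n
    have "(\<Union>n. S n) = (\<Union>i\<in>range (from_nat_into C). {fst i..snd i})"
      by (auto simp: S_def)
    also have "\<dots> = W" using range_from_nat_into[OF False C(1)] by (simp add: W_def)
    finally have S_W: "(\<Union>n. S n) = W" .
    have "(\<lambda>n. measure lebesgue (S n)) \<longlonglongrightarrow> measure lebesgue (\<Union>n. S n)"
    proof (rule Lim_measure_incseq)
      show "range S \<subseteq> sets lebesgue" by (auto simp: S_def)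
      show "incseq S" unfolding S_def by (intro incseq_SucI UN_mono image_mono) auto
      show "emeasure lebesgue (\<Union>n. S n) \<noteq> \<infinity>" unfolding S_W using fmeasurableD2[OF Wm] by auto
    qed
    then have "(\<lambda>n. c * measure lebesgue (S n)) \<longlonglongrightarrow> c * measure lebesgue W"
      unfolding S_W by (intro tendsto_mult_left)
    then show ?thesis
    proof (rule LIMSEQ_le_const2)
      show "\<exists>N. \<forall>n\<ge>N. c * measure lebesgue (S n) \<le> w b - w a"
        unfolding S_def using from_nat_into[OF False] by (intro exI allI impI fin) auto
    qed
  qed
  have "measure lebesgue (F \<inter> {a..b}) \<le> measure lebesgue (W \<union> ((F' - W) \<union> {a, b}))"
  proof (rule measure_mono_fmeasurable)
    have "negligible ((F' - W) \<union> {a, b})"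
      using C(4) by (auto simp: W_def cb)
    then show "W \<union> ((F' - W) \<union> {a, b}) \<in> lmeasurable"
      by (intro fmeasurable.Un[OF Wm] negligible_imp_measurable)
  qed (use F in \<open>auto simp: F'_def\<close>)
  also have "\<dots> = measure lebesgue W"
    using Wm C(4) by (intro measure_Un_null_set) (auto simp: W_def cb negligible_iff_null_sets[symmetric])
  finally have "c * measure lebesgue (F \<inter> {a..b}) \<le> c * measure lebesgue W"
    using c by (rule mult_left_mono)
  then show ?thesis using W_le by linarith
qed

text \<open>For \<open>p < q\<close> these points are obstacles to differentiability in the direction \<open>w\<close>: the difference quotients
fall below \<open>p\<close> and exceed \<open>q\<close> at every scale. Strict inequalities make the set a countable intersection of
open sets when \<open>u\<close> is continuous.\<close>

definition dir_osc :: "('m::real_vector \<Rightarrow> real) \<Rightarrow> 'm \<Rightarrow> real \<Rightarrow> real \<Rightarrow> 'm set" where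
  "dir_osc u w p q = {x. \<forall>k::nat.
     (\<exists>t. t \<noteq> 0 \<and> \<bar>t\<bar> < 1 / Suc k \<and> (u (x + t *\<^sub>R w) - u x) / t < p) \<and>
     (\<exists>t. t \<noteq> 0 \<and> \<bar>t\<bar> < 1 / Suc k \<and> (u (x + t *\<^sub>R w) - u x) / t > q)}"

lemma borel_dir_osc:
  fixes u :: "'m::euclidean_space \<Rightarrow> real"
  assumes u: "continuous_on UNIV u"
  shows "dir_osc u w p q \<in> sets borel"
proof -
  have 1: "open {x. (u (x + t *\<^sub>R w) - u x) / t < p}" "open {x. q < (u (x + t *\<^sub>R w) - u x) / t}" if "t \<noteq> 0" for t
    using that by (intro open_Collect_less continuous_intros continuous_on_compose2[OF u]; simp)+
  have "dir_osc u w p q =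
     (\<Inter>k::nat. (\<Union>t\<in>{t. t \<noteq> 0 \<and> \<bar>t\<bar> < 1 / Suc k}. {x. (u (x + t *\<^sub>R w) - u x) / t < p}) \<inter>
          (\<Union>t\<in>{t. t \<noteq> 0 \<and> \<bar>t\<bar> < 1 / Suc k}. {x. q < (u (x + t *\<^sub>R w) - u x) / t}))"
    unfolding dir_osc_def by blast
  also have "\<dots> \<in> sets borel"
    using 1 by (intro sets.countable_INT'' sets.Int borel_open open_UN ballI) auto
  finally show ?thesis .
qed

lemma measure_Int_interval:
  fixes S :: "real set"
  assumes S: "S \<in> sets lebesgue" and ab: "a \<le> b"
  shows "measure lebesgue (S \<inter> {a..b}) = (b - a) - measure lebesgue ({a..b} - S)"
proof -
  have "measure lebesgue ({a..b} - S \<inter> {a..b}) = measure lebesgue {a..b} - measure lebesgue (S \<inter> {a..b})"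
    using S by (intro measurable_measure_Diff) auto
  moreover have "{a..b} - S \<inter> {a..b} = {a..b} - S" by blast
  ultimately show ?thesis using ab by simp
qed

text \<open>Let \<open>S\<close> be the set in question and let \<open>x\<close> be a density point of \<open>S\<close>. Some short interval at \<open>x\<close> has mean
slope below \<open>p\<close>. But almost all of this interval belongs to \<open>S\<close>, where slopes above \<open>q\<close> occur at
every scale, so by the growth estimate its mean slope is almost \<open>q\<close>. Adding \<open>M * y\<close> makes the function
monotone.\<close>

lemma negligible_dir_osc_real:
  fixes u :: "real \<Rightarrow> real"
  assumes u: "M-lipschitz_on UNIV u" and pq: "p < q"
  shows "negligible (dir_osc u 1 p q)"
proof -
  define S where "S = dir_osc u 1 p q"
  have S: "S \<in> sets lebesgue"
    using borel_dir_osc[OF lipschitz_on_continuous_on[OF u]] by (simp add: S_def)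
  have "\<not> density_point S x" if x: "x \<in> S" for x
  proof
    assume dens: "density_point S x"
    have slope: "\<bar>u b - u a\<bar> \<le> M * \<bar>b - a\<bar>" for a b
      using lipschitz_onD[OF u, of b a] by (simp add: dist_real_def)
    define v where "v y = u y + M * y" for y
    have "mono v"
    proof (rule monoI)
      fix a b :: real assume "a \<le> b"
      then show "v a \<le> v b" using slope[of b a] by (simp add: v_def algebra_simps)
    qed
    have dv: "(v (y + t) - v y) / t = (u (y + t) - u y) / t + M" if "t \<noteq> 0" for y t
      using that by (simp add: v_def field_simps)
    define c where "c = q + M"
    obtain t0 where "t0 \<noteq> 0" "(u (x + t0) - u x) / t0 < p"
      using x unfolding S_def dir_osc_def by auto
    moreover have "\<bar>(u (x + t0) - u x) / t0\<bar> \<le> M"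
      using slope[of "x + t0" x] \<open>t0 \<noteq> 0\<close> by (simp add: abs_divide field_simps)
    ultimately have pM: "p + M > 0" by linarith
    then have c: "c > 0" "c > p + M" using pq by (auto simp: c_def)
    \<comment> \<open>if \<open>S\<close> misses only this proportion of an interval, the growth estimate gives mean slope at least \<open>p\<close>\<close>
    define \<eta> where "\<eta> = (c - (p + M)) / c"
    have \<eta>: "\<eta> > 0" using c by (simp add: \<eta>_def)
    obtain r0 where r0: "r0 > 0" "\<And>a b. a < b \<Longrightarrow> x \<in> {a..b} \<Longrightarrow> b - a < r0 \<Longrightarrow>
        measure lebesgue ({a..b} - S) \<le> \<eta> * (b - a)"
      using density_point_interval[OF S dens \<eta>] by blast
    obtain k :: nat where k: "1 / Suc k < r0" using r0(1) nat_approx_posE by blast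
    obtain t where t: "t \<noteq> 0" "\<bar>t\<bar> < 1 / Suc k" "(u (x + t) - u x) / t < p"
      using x unfolding S_def dir_osc_def by auto
    define a b where "a = min x (x + t)" and "b = max x (x + t)"
    have ab: "a < b" "x \<in> {a..b}" "b - a < r0" "b - a = \<bar>t\<bar>" using t k by (auto simp: a_def b_def)
    have "(v b - v a) / (b - a) = (v (x + t) - v x) / t"
    proof (cases "t > 0")
      case False
      then have "a = x + t" "b = x" using t(1) by (auto simp: a_def b_def)
      moreover have "(v x - v (x + t)) / (x - (x + t)) = (v (x + t) - v x) / t"
        using minus_divide_divide[of "v (x + t) - v x" t] by simp
      ultimately show ?thesis by simp
    qed (simp add: a_def b_def)
    then have "(v b - v a) / (b - a) < p + M"
      using dv[OF t(1), of x] t(3) by simp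
    then have less: "v b - v a < (p + M) * (b - a)" using ab(1) by (simp add: field_simps)
    have "c * measure lebesgue (S \<inter> {a..b}) \<le> v b - v a"
    proof (rule steep_set_growth[OF \<open>mono v\<close> S])
      fix y d :: real assume y: "y \<in> S" and d: "d > 0"
      obtain k :: nat where k: "1 / Suc k < d" using d nat_approx_posE by blast
      obtain t where t: "t \<noteq> 0" "\<bar>t\<bar> < 1 / Suc k" "q < (u (y + t) - u y) / t"
        using y unfolding S_def dir_osc_def by auto
      then show "\<exists>t. t \<noteq> 0 \<and> \<bar>t\<bar> < d \<and> c \<le> (v (y + t) - v y) / t"
        using k by (intro exI[of _ t]) (auto simp: dv c_def)
    qed (use c ab in auto)
    moreover have "measure lebesgue (S \<inter> {a..b}) = (b - a) - measure lebesgue ({a..b} - S)"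
      using measure_Int_interval[OF S] ab(1) by simp
    moreover have "measure lebesgue ({a..b} - S) \<le> \<eta> * (b - a)" using r0(2) ab by blast
    ultimately have "c * ((b - a) - \<eta> * (b - a)) \<le> v b - v a"
      using c by (smt (verit) mult_left_mono)
    moreover have "c * ((b - a) - \<eta> * (b - a)) = (p + M) * (b - a)"
      using c by (simp add: \<eta>_def field_simps)
    ultimately show False using less by simp
  qed
  then have "S = {x \<in> S. \<not> density_point S x}" by blast
  then show ?thesis using negligible_not_density_point[OF S] by (simp add: S_def)
qed

text \<open>The points at which the difference quotients of all \<open>u i\<close> in the direction \<open>w\<close> are asymptotically bounded
by \<open>q\<close>, uniformly in \<open>i\<close>. A single function is treated as a constant sequence.\<close>

definition dir_lip :: "(nat \<Rightarrow> 'm::real_vector \<Rightarrow> real) \<Rightarrow> 'm \<Rightarrow> real \<Rightarrow> 'm set" where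
  "dir_lip u w q = {x. \<forall>e>0. \<exists>d>0. \<forall>i t. \<bar>t\<bar> \<le> d \<longrightarrow> \<bar>u i (x + t *\<^sub>R w) - u i x\<bar> \<le> (q + e) * \<bar>t\<bar>}"

lemma borel_dir_lip:
  fixes u :: "nat \<Rightarrow> 'm::euclidean_space \<Rightarrow> real"
  assumes u: "\<And>i. continuous_on UNIV (u i)"
  shows "dir_lip u w q \<in> sets borel"
proof -
  define B where "B m k = (\<Inter>i. \<Inter>t\<in>{t. \<bar>t\<bar> \<le> 1 / Suc k}.
      {x. \<bar>u i (x + t *\<^sub>R w) - u i x\<bar> \<le> (q + 1 / Suc m) * \<bar>t\<bar>})" for m k :: nat
  have B: "closed (B m k)" for m k
    unfolding B_def
    by (intro closed_INT ballI closed_Collect_le continuous_intros continuous_on_compose2[OF u]) auto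
  have "dir_lip u w q = (\<Inter>m. \<Union>k. B m k)"
  proof (intro set_eqI iffI)
    fix x assume x: "x \<in> dir_lip u w q"
    have "\<exists>k. x \<in> B m k" for m
    proof -
      obtain d where d: "d > 0" "\<And>i t. \<bar>t\<bar> \<le> d \<Longrightarrow> \<bar>u i (x + t *\<^sub>R w) - u i x\<bar> \<le> (q + 1 / Suc m) * \<bar>t\<bar>"
        using x unfolding dir_lip_def by (auto dest: spec[of _ "1 / Suc m"])
      obtain k :: nat where "1 / Suc k < d" using d(1) nat_approx_posE by blast
      then have "x \<in> B m k" using d(2) by (auto simp: B_def)
      then show ?thesis ..
    qed
    then show "x \<in> (\<Inter>m. \<Union>k. B m k)" by blast
  next
    fix x assume x: "x \<in> (\<Inter>m. \<Union>k. B m k)"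
    show "x \<in> dir_lip u w q"
      unfolding dir_lip_def
    proof (intro CollectI allI impI)
      fix e :: real assume "e > 0"
      then obtain m :: nat where m: "1 / Suc m < e" using nat_approx_posE by blast
      obtain k where k: "x \<in> B m k" using x by blast
      show "\<exists>d>0. \<forall>i t. \<bar>t\<bar> \<le> d \<longrightarrow> \<bar>u i (x + t *\<^sub>R w) - u i x\<bar> \<le> (q + e) * \<bar>t\<bar>"
      proof (intro exI[of _ "1 / real (Suc k)"] conjI allI impI)
        fix i t assume t: "\<bar>t\<bar> \<le> 1 / real (Suc k)"
        have "\<bar>u i (x + t *\<^sub>R w) - u i x\<bar> \<le> (q + 1 / Suc m) * \<bar>t\<bar>"
          using k t by (auto simp: B_def)
        also have "\<dots> \<le> (q + e) * \<bar>t\<bar>" using m by (intro mult_right_mono) auto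
        finally show "\<bar>u i (x + t *\<^sub>R w) - u i x\<bar> \<le> (q + e) * \<bar>t\<bar>" .
      qed simp
    qed
  qed
  also have "\<dots> \<in> sets borel"
    using B by (intro sets.countable_INT' sets.countable_UN' borel_closed) auto
  finally show ?thesis .
qed

text \<open>A bound on the slopes of each \<open>u i\<close> separately, with no uniformity in \<open>i\<close>, already controls increments:
over an interval they are at most \<open>q\<close> times its length plus \<open>M\<close> times the measure of its part outside
the set \<open>E\<close> of good points. This bound does not depend on \<open>i\<close>, and at a density point of \<open>E\<close> the second
term is of smaller order.\<close>

lemma negligible_dir_lip_diff_real:
  fixes u :: "nat \<Rightarrow> real \<Rightarrow> real"
  assumes u: "\<And>i. M-lipschitz_on UNIV (u i)" and q: "q \<ge> 0"
  shows "negligible ((\<Inter>i. dir_lip (\<lambda>_. u i) 1 q) - dir_lip u 1 q)"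
proof -
  define E where "E = (\<Inter>i. dir_lip (\<lambda>_::nat. u i) 1 q)"
  have cont: "continuous_on UNIV (u i)" for i using u lipschitz_on_continuous_on by blast
  have E: "E \<in> sets lebesgue"
    using borel_dir_lip[OF cont] unfolding E_def by (intro sets.countable_INT') auto
  have M: "M \<ge> 0" using lipschitz_on_nonneg[OF u] .
  have growth: "u i b - u i a \<le> (q + e) * (b - a) + M * measure lebesgue ({a..b} - E)"
    "u i a - u i b \<le> (q + e) * (b - a) + M * measure lebesgue ({a..b} - E)"
    if ab: "a \<le> b" and e: "e > 0" for i a b e
  proof -
    have slope: "\<bar>u i b - u i a\<bar> \<le> M * \<bar>b - a\<bar>" for a b
      using lipschitz_onD[OF u, of b a i] by (simp add: dist_real_def)
    have meas: "measure lebesgue (E \<inter> {a..b}) = (b - a) - measure lebesgue ({a..b} - E)"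
      by (rule measure_Int_interval[OF E ab])
    \<comment> \<open>the sign \<open>s\<close> treats \<open>u i\<close> and \<open>- u i\<close> at once\<close>
    have main: "s * (u i b - u i a) \<le> (q + e) * (b - a) + M * measure lebesgue ({a..b} - E)"
      if s: "\<bar>s\<bar> = 1" for s
    proof (cases "M \<le> q + e")
      case True
      have "s * (u i b - u i a) \<le> \<bar>u i b - u i a\<bar>" using s by (auto simp: abs_if split: if_splits)
      also have "\<dots> \<le> M * (b - a)" using slope[of b a] ab by simp
      also have "\<dots> \<le> (q + e) * (b - a)" using True ab by (intro mult_right_mono) auto
      finally show ?thesis using M by (simp add: add_increasing2)
    next
      case False
      \<comment> \<open>a bound on the slope of \<open>s * u i\<close> from above is a bound on that of \<open>v\<close> from below\<close>
      define v where "v y = M * y - s * u i y" for y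
      have "mono v"
      proof (rule monoI)
        fix a b :: real assume "a \<le> b"
        moreover have "s * (u i b - u i a) \<le> \<bar>u i b - u i a\<bar>" using s by (auto simp: abs_if split: if_splits)
        ultimately show "v a \<le> v b" using slope[of b a] by (simp add: v_def algebra_simps)
      qed
      have "(M - (q + e)) * measure lebesgue (E \<inter> {a..b}) \<le> v b - v a"
      proof (rule steep_set_growth[OF \<open>mono v\<close> E])
        fix y d :: real assume y: "y \<in> E" and d: "d > 0"
        have "y \<in> dir_lip (\<lambda>_. u i) 1 q" using y by (simp add: E_def)
        then have "\<exists>d>0. \<forall>j::nat. \<forall>t. \<bar>t\<bar> \<le> d \<longrightarrow> \<bar>u i (y + t *\<^sub>R 1) - u i y\<bar> \<le> (q + e) * \<bar>t\<bar>"
          using e unfolding dir_lip_def by blast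
        then obtain d' where d': "d' > 0" "\<And>t. \<bar>t\<bar> \<le> d' \<Longrightarrow> \<bar>u i (y + t) - u i y\<bar> \<le> (q + e) * \<bar>t\<bar>"
          by auto
        define t where "t = min d' (d / 2)"
        have t: "t > 0" "t < d" "t \<le> d'" using d d' by (auto simp: t_def)
        have "s * (u i (y + t) - u i y) \<le> \<bar>u i (y + t) - u i y\<bar>" using s by (auto simp: abs_if split: if_splits)
        also have "\<dots> \<le> (q + e) * t" using d'(2)[of t] t by simp
        finally have "(M - (q + e)) * t \<le> v (y + t) - v y" by (simp add: v_def algebra_simps)
        then have "M - (q + e) \<le> (v (y + t) - v y) / t" using t by (simp add: field_simps)
        then show "\<exists>t. t \<noteq> 0 \<and> \<bar>t\<bar> < d \<and> M - (q + e) \<le> (v (y + t) - v y) / t"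
          using t by (intro exI[of _ t]) auto
      qed (use False ab in auto)
      then have "s * (u i b - u i a) \<le> M * (b - a) - (M - (q + e)) * measure lebesgue (E \<inter> {a..b})"
        by (simp add: v_def algebra_simps)
      also have "\<dots> = (q + e) * (b - a) + (M - (q + e)) * measure lebesgue ({a..b} - E)"
        unfolding meas by (simp add: algebra_simps)
      also have "\<dots> \<le> (q + e) * (b - a) + M * measure lebesgue ({a..b} - E)"
        using q e by (intro add_left_mono mult_right_mono) auto
      finally show ?thesis .
    qed
    show "u i b - u i a \<le> (q + e) * (b - a) + M * measure lebesgue ({a..b} - E)"
      using main[of 1] by simp
    show "u i a - u i b \<le> (q + e) * (b - a) + M * measure lebesgue ({a..b} - E)"
      using main[of "-1"] by simp
  qed
  have "x \<in> dir_lip u 1 q" if x: "density_point E x" for x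
    unfolding dir_lip_def
  proof (intro CollectI allI impI)
    fix e :: real assume e: "e > 0"
    define \<eta> where "\<eta> = (e / 2) / (M + 1)"
    have \<eta>: "\<eta> > 0" "M * \<eta> \<le> e / 2" using e M by (auto simp: \<eta>_def field_simps)
    obtain r0 where r0: "r0 > 0" "\<And>a b. a < b \<Longrightarrow> x \<in> {a..b} \<Longrightarrow> b - a < r0 \<Longrightarrow>
        measure lebesgue ({a..b} - E) \<le> \<eta> * (b - a)"
      using density_point_interval[OF E x \<eta>(1)] by blast
    show "\<exists>d>0. \<forall>i t. \<bar>t\<bar> \<le> d \<longrightarrow> \<bar>u i (x + t *\<^sub>R 1) - u i x\<bar> \<le> (q + e) * \<bar>t\<bar>"
    proof (intro exI[of _ "r0 / 2"] conjI allI impI)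
      fix i t assume t: "\<bar>t\<bar> \<le> r0 / 2"
      show "\<bar>u i (x + t *\<^sub>R 1) - u i x\<bar> \<le> (q + e) * \<bar>t\<bar>"
      proof (cases "t = 0")
        case False
        define a b where "a = min x (x + t)" and "b = max x (x + t)"
        have ab: "a < b" "x \<in> {a..b}" "b - a < r0" "b - a = \<bar>t\<bar>"
          using t False r0(1) by (auto simp: a_def b_def)
        have "M * measure lebesgue ({a..b} - E) \<le> M * (\<eta> * (b - a))"
          using r0(2)[OF ab(1-3)] M by (rule mult_left_mono)
        also have "\<dots> \<le> (e / 2) * (b - a)"
          using \<eta>(2) ab(1) by (simp add: mult.assoc[symmetric] mult_right_mono)
        finally have 1: "M * measure lebesgue ({a..b} - E) \<le> (e / 2) * (b - a)" .
        have 2: "(q + e / 2) * (b - a) + (e / 2) * (b - a) = (q + e) * \<bar>t\<bar>"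
          unfolding ab(4)[symmetric] by (simp add: field_simps)
        have "\<bar>u i (x + t) - u i x\<bar> = \<bar>u i b - u i a\<bar>" by (auto simp: a_def b_def min_def max_def)
        moreover have "e / 2 > 0" using e by simp
        ultimately show ?thesis using growth[of a b "e / 2" i] 1 2 ab(1) by (simp add: abs_le_iff)
      qed simp
    qed (use r0 in auto)
  qed
  then have "E - dir_lip u 1 q \<subseteq> {x \<in> E. \<not> density_point E x}" by blast
  then show ?thesis
    using negligible_not_density_point[OF E] negligible_subset unfolding E_def by blast
qed

section \<open>Directional difference quotients and the theorem of Rademacher\<close>

text \<open>Translations preserve Lebesgue measure, so the measure of \<open>N\<close> is also the average over \<open>t\<close> in the unit
interval of the measures of the translates of \<open>N\<close> by \<open>- t *\<^sub>R w\<close>; by Tonelli this average vanishes. The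
argument works for every direction and avoids a choice of coordinates.\<close>

lemma negligible_along_lines:
  fixes N :: "'m::euclidean_space set"
  assumes N: "N \<in> sets borel" and lines: "\<And>x. negligible {t. x + t *\<^sub>R w \<in> N}"
  shows "negligible N"
proof -
  have meas: "(\<lambda>(t, x). indicator N (x + t *\<^sub>R w) * indicator {0..1} t :: ennreal) \<in> borel_measurable (lborel \<Otimes>\<^sub>M lborel)"
  proof -
    have "(\<lambda>p. snd p + fst p *\<^sub>R w) \<in> borel_measurable (lborel \<Otimes>\<^sub>M (lborel :: 'm measure))"
      by measurable
    then have "(\<lambda>p. indicator N (snd p + fst p *\<^sub>R w) :: ennreal) \<in> borel_measurable (lborel \<Otimes>\<^sub>M lborel)"
      by (rule measurable_compose) (rule borel_measurable_indicator[OF N])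
    moreover have "(\<lambda>p. indicator {0..1::real} (fst p) :: ennreal) \<in> borel_measurable (lborel \<Otimes>\<^sub>M (lborel :: 'm measure))"
      by (rule measurable_compose[OF measurable_fst]) (simp add: borel_measurable_indicator)
    ultimately show ?thesis
      unfolding case_prod_beta by (rule borel_measurable_times_ennreal)
  qed
  have shift: "(\<integral>\<^sup>+x. indicator N (x + t *\<^sub>R w) \<partial>lborel) = emeasure lborel N" for t
  proof -
    have "emeasure lborel N = (\<integral>\<^sup>+x. indicator N x \<partial>distr lborel borel ((+) (t *\<^sub>R w)))"
      unfolding lborel_distr_plus using N by simp
    also have "\<dots> = (\<integral>\<^sup>+x. indicator N (t *\<^sub>R w + x) \<partial>lborel)"
      using N by (intro nn_integral_distr) auto
    finally show ?thesis by (simp add: add.commute)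
  qed
  have "emeasure lborel N = (\<integral>\<^sup>+t. emeasure lborel N * indicator {0..1::real} t \<partial>lborel)"
    by (simp add: nn_integral_cmult)
  also have "\<dots> = (\<integral>\<^sup>+t. \<integral>\<^sup>+x. indicator N (x + t *\<^sub>R w) * indicator {0..1} t \<partial>lborel \<partial>lborel)"
    using N by (subst nn_integral_multc) (auto simp: shift)
  also have "\<dots> = (\<integral>\<^sup>+x. \<integral>\<^sup>+t. indicator N (x + t *\<^sub>R w) * indicator {0..1} t \<partial>lborel \<partial>lborel)"
    using lborel_pair.Fubini[OF meas] by simp
  also have "\<dots> = (\<integral>\<^sup>+x. 0 \<partial>(lborel :: 'm measure))"
  proof (intro nn_integral_cong)
    fix x :: 'm
    define L where "L = {t. x + t *\<^sub>R w \<in> N}"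
    have "(\<lambda>t. x + t *\<^sub>R w) -` N \<inter> space borel \<in> sets borel"
      by (intro measurable_sets[OF _ N]) auto
    then have L: "L \<in> sets borel" by (simp add: L_def vimage_def)
    then have "L \<in> null_sets lborel"
      using lines[of x] by (simp add: L_def negligible_iff_null_sets null_sets_completion_iff)
    then have "AE t in lborel. t \<notin> L" by (rule AE_not_in)
    then have "AE t in lborel. indicator N (x + t *\<^sub>R w) * indicator {0..1} t = (0 :: ennreal)"
      by eventually_elim (auto simp: L_def)
    then have "(\<integral>\<^sup>+t. indicator N (x + t *\<^sub>R w) * indicator {0..1} t \<partial>lborel) = (\<integral>\<^sup>+t. (0::ennreal) \<partial>(lborel :: real measure))"
      by (rule nn_integral_cong_AE)
    then show "(\<integral>\<^sup>+t. indicator N (x + t *\<^sub>R w) * indicator {0..1} t \<partial>lborel) = 0"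
      by simp
  qed
  finally have "emeasure lborel N = 0" by simp
  then show ?thesis using N by (simp add: negligible_iff_null_sets null_sets_completion_iff null_sets_def)
qed

lemma lipschitz_on_line:
  fixes u :: "'m::real_normed_vector \<Rightarrow> 'y::metric_space"
  assumes "M-lipschitz_on UNIV u"
  shows "(M * norm w)-lipschitz_on UNIV (\<lambda>t. u (x + t *\<^sub>R w))"
proof (rule lipschitz_onI)
  show "dist (u (x + s *\<^sub>R w)) (u (x + t *\<^sub>R w)) \<le> M * norm w * dist s t" for s t
  proof -
    have "dist (x + s *\<^sub>R w) (x + t *\<^sub>R w) = norm w * dist s t"
      by (simp add: dist_norm flip: scaleR_diff_left)
    then show ?thesis using lipschitz_onD[OF assms, of "x + s *\<^sub>R w" "x + t *\<^sub>R w"]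
      by (simp add: mult_ac dist_real_def)
  qed
qed (simp add: lipschitz_on_nonneg[OF assms])

lemma negligible_dir_osc:
  fixes u :: "'m::euclidean_space \<Rightarrow> real"
  assumes u: "M-lipschitz_on UNIV u" and pq: "p < q"
  shows "negligible (dir_osc u w p q)"
proof (rule negligible_along_lines)
  show "dir_osc u w p q \<in> sets borel"
    using u by (intro borel_dir_osc lipschitz_on_continuous_on)
  fix x
  have "{t. x + t *\<^sub>R w \<in> dir_osc u w p q} = dir_osc (\<lambda>t. u (x + t *\<^sub>R w)) 1 p q"
    by (simp add: dir_osc_def scaleR_add_left add.assoc)
  then show "negligible {t. x + t *\<^sub>R w \<in> dir_osc u w p q}"
    using negligible_dir_osc_real[OF lipschitz_on_line[OF u] pq] by simp
qed

lemma negligible_dir_lip_diff: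
  fixes u :: "nat \<Rightarrow> 'm::euclidean_space \<Rightarrow> real"
  assumes u: "\<And>i. M-lipschitz_on UNIV (u i)" and q: "q \<ge> 0"
  shows "negligible ((\<Inter>i. dir_lip (\<lambda>_. u i) w q) - dir_lip u w q)"
proof (rule negligible_along_lines[where w = w])
  have cont: "continuous_on UNIV (u i)" for i using u lipschitz_on_continuous_on by blast
  show "(\<Inter>i. dir_lip (\<lambda>_. u i) w q) - dir_lip u w q \<in> sets borel"
    using cont by (intro sets.Diff sets.countable_INT'' borel_dir_lip) auto
  fix x
  have "{t. x + t *\<^sub>R w \<in> (\<Inter>i. dir_lip (\<lambda>_. u i) w q) - dir_lip u w q}
      = (\<Inter>i. dir_lip (\<lambda>_. (\<lambda>t. u i (x + t *\<^sub>R w))) 1 q) - dir_lip (\<lambda>i t. u i (x + t *\<^sub>R w)) 1 q"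
    by (simp add: dir_lip_def scaleR_add_left add.assoc set_eq_iff)
  then show "negligible {t. x + t *\<^sub>R w \<in> (\<Inter>i. dir_lip (\<lambda>_. u i) w q) - dir_lip u w q}"
    using negligible_dir_lip_diff_real[OF lipschitz_on_line[OF u] q] by simp
qed

text \<open>The derivative is the upper limit of the bounded difference quotients. If the lower limit were different,
two rational numbers would fit in between.\<close>

lemma directional_derivative_exists:
  fixes u :: "'m::real_normed_vector \<Rightarrow> real"
  assumes u: "M-lipschitz_on UNIV u"
    and x: "\<And>p q. p \<in> \<rat> \<Longrightarrow> q \<in> \<rat> \<Longrightarrow> p < q \<Longrightarrow> x \<notin> dir_osc u w p q"
  shows "\<exists>D. \<forall>e>0. \<exists>d>0. \<forall>t. \<bar>t\<bar> < d \<longrightarrow> \<bar>u (x + t *\<^sub>R w) - u x - D * t\<bar> \<le> e * \<bar>t\<bar>"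
proof -
  define Q where "Q t = (u (x + t *\<^sub>R w) - u x) / t" for t
  define K where "K = M * norm w"
  have Q: "\<bar>Q t\<bar> \<le> K" if "t \<noteq> 0" for t
    using lipschitz_onD[OF lipschitz_on_line[OF u, of w x], of t 0] that
    by (simp add: Q_def K_def dist_real_def abs_divide field_simps)
  define A where "A = {q. \<forall>k::nat. \<exists>t. t \<noteq> 0 \<and> \<bar>t\<bar> < 1 / Suc k \<and> q < Q t}"
  have "- K - 1 \<in> A"
    unfolding A_def
  proof (intro CollectI allI)
    fix k :: nat
    have "\<bar>Q (1 / (2 * real (Suc k)))\<bar> \<le> K" by (rule Q) simp
    then show "\<exists>t. t \<noteq> 0 \<and> \<bar>t\<bar> < 1 / Suc k \<and> - K - 1 < Q t"
      by (intro exI[of _ "1 / (2 * real (Suc k))"]) (auto simp: field_simps)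
  qed
  have bdd: "bdd_above A"
  proof (rule bdd_aboveI)
    fix q assume "q \<in> A"
    then obtain t where "t \<noteq> 0" "q < Q t" unfolding A_def by blast
    then show "q \<le> K" using Q[of t] by linarith
  qed
  define D where "D = Sup A"
  show ?thesis
  proof (rule exI[of _ D], intro allI impI)
    fix e :: real assume e: "e > 0"
    have "\<not> D + e \<le> Sup A" using e by (simp add: D_def)
    then have "D + e \<notin> A" using cSup_upper[OF _ bdd] by blast
    then obtain k1 :: nat where k1: "\<And>t. t \<noteq> 0 \<Longrightarrow> \<bar>t\<bar> < 1 / Suc k1 \<Longrightarrow> Q t \<le> D + e"
      unfolding A_def by (force simp: not_less)
    have "\<exists>k2::nat. \<forall>t. t \<noteq> 0 \<and> \<bar>t\<bar> < 1 / Suc k2 \<longrightarrow> D - e \<le> Q t"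
    proof (rule ccontr)
      assume "\<not> ?thesis"
      then have low: "\<And>k. \<exists>t. t \<noteq> 0 \<and> \<bar>t\<bar> < 1 / Suc k \<and> Q t < D - e" by (auto simp: not_le)
      obtain p where p: "p \<in> \<rat>" "D - e < p" "p < D" using Rats_dense_in_real[of "D - e" D] e by auto
      obtain q where q: "q \<in> \<rat>" "p < q" "q < D" using Rats_dense_in_real[of p D] p by auto
      obtain a where a: "a \<in> A" "q < a" using q(3) less_cSup_iff[OF _ bdd, of q] \<open>- K - 1 \<in> A\<close> unfolding D_def by blast
      have "x \<in> dir_osc u w p q"
      proof -
        have "\<exists>t. t \<noteq> 0 \<and> \<bar>t\<bar> < 1 / Suc k \<and> Q t < p" for k using low[of k] p(2) by (meson less_trans)
        moreover have "\<exists>t. t \<noteq> 0 \<and> \<bar>t\<bar> < 1 / Suc k \<and> Q t > q" for k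
          using a unfolding A_def by (blast intro: less_trans)
        ultimately show ?thesis unfolding dir_osc_def Q_def by blast
      qed
      then show False using x[OF p(1) q(1,2)] by blast
    qed
    then obtain k2 :: nat where k2: "\<And>t. t \<noteq> 0 \<Longrightarrow> \<bar>t\<bar> < 1 / Suc k2 \<Longrightarrow> D - e \<le> Q t" by blast
    show "\<exists>d>0. \<forall>t. \<bar>t\<bar> < d \<longrightarrow> \<bar>u (x + t *\<^sub>R w) - u x - D * t\<bar> \<le> e * \<bar>t\<bar>"
    proof (intro exI[of _ "min (1 / real (Suc k1)) (1 / real (Suc k2))"] conjI allI impI)
      fix t assume t: "\<bar>t\<bar> < min (1 / real (Suc k1)) (1 / real (Suc k2))"
      show "\<bar>u (x + t *\<^sub>R w) - u x - D * t\<bar> \<le> e * \<bar>t\<bar>"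
      proof (cases "t = 0")
        case False
        have "u (x + t *\<^sub>R w) - u x - D * t = (Q t - D) * t" using False by (simp add: Q_def field_simps)
        moreover have "\<bar>Q t - D\<bar> \<le> e" using k1[of t] k2[of t] False t by (auto simp: abs_le_iff)
        ultimately show ?thesis by (simp add: abs_mult mult_right_mono)
      qed simp
    qed simp
  qed
qed

text \<open>The partial derivatives exist almost everywhere. So, for each \<open>m\<close>, almost all of the space is
covered by countably many closed sets \<open>F m k c\<close> on which the difference quotients along the axes, up to the
scale \<open>1 / (k + 1)\<close>, equal the coordinates of \<open>c\<close> up to an error \<open>1 / (m + 1)\<close>. At a density point of such a set, walk from \<open>x\<close> to
\<open>x + v\<close> along the coordinate axes: every corner of the path is close, relative to \<open>norm v\<close>, to a
point of \<open>F m k c\<close>, where the increment along the next axis is known, and the Lipschitz property bounds the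
error of moving to that point.\<close>

theorem rademacher:
  fixes u :: "'m::euclidean_space \<Rightarrow> real"
  assumes u: "M-lipschitz_on UNIV u"
  shows "negligible {x. \<not> u differentiable (at x)}"
proof -
  have M: "M \<ge> 0" by (rule lipschitz_on_nonneg[OF u])
  have slope: "\<bar>u y - u z\<bar> \<le> M * dist y z" for y z
    using lipschitz_onD[OF u, of y z] by (simp add: dist_real_def)
  have cont: "continuous_on UNIV u" using u by (rule lipschitz_on_continuous_on)
  obtain Z :: "'m set" where Z: "countable Z" "\<And>U. open U \<Longrightarrow> U \<noteq> {} \<Longrightarrow> \<exists>z\<in>Z. z \<in> U"
    using countable_dense_setE by metis
  define F where "F m k c = (\<Inter>b\<in>Basis. \<Inter>t\<in>{t. \<bar>t\<bar> \<le> 1 / real (Suc k)}.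
     {y. \<bar>u (y + t *\<^sub>R b) - u y - (c \<bullet> b) * t\<bar> \<le> (1 / real (Suc m)) * \<bar>t\<bar>})" for m k :: nat and c
  have F: "closed (F m k c)" for m k c
    unfolding F_def
    by (intro closed_INT ballI closed_Collect_le continuous_intros continuous_on_compose2[OF cont]) auto
  define N where "N = (\<Union>b\<in>(Basis::'m set). \<Union>p\<in>\<rat>. \<Union>q\<in>\<rat> \<inter> {p<..}. dir_osc u b p q)"
  define N' where "N' = (\<Union>m. \<Union>k. \<Union>c\<in>Z. {x \<in> F m k c. \<not> density_point (F m k c) x})"
  have "negligible N"
    unfolding N_def using u
    by (intro negligible_countable_Union countable_image)
      (auto intro!: negligible_countable_Union negligible_dir_osc countable_image countable_rat
        countable_Int1 countable_finite[OF finite_Basis])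
  moreover have "negligible N'"
    unfolding N'_def using F Z(1)
    by (intro negligible_countable_Union countable_image)
      (auto intro!: negligible_countable_Union negligible_not_density_point)
  moreover have "u differentiable (at x)" if x: "x \<notin> N \<union> N'" for x
  proof -
    have "\<exists>D. \<forall>e>0. \<exists>d>0. \<forall>t. \<bar>t\<bar> < d \<longrightarrow> \<bar>u (x + t *\<^sub>R b) - u x - D * t\<bar> \<le> e * \<bar>t\<bar>" if "b \<in> Basis" for b
      using that x by (intro directional_derivative_exists[OF u]) (auto simp: N_def)
    then obtain D' where D': "\<And>b e. b \<in> Basis \<Longrightarrow> e > 0 \<Longrightarrow>
        \<exists>d>0. \<forall>t. \<bar>t\<bar> < d \<longrightarrow> \<bar>u (x + t *\<^sub>R b) - u x - D' b * t\<bar> \<le> e * \<bar>t\<bar>"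
      by metis
    define D where "D = (\<Sum>b\<in>Basis. D' b *\<^sub>R b)"
    have D: "D \<bullet> b = D' b" if "b \<in> Basis" for b
      using that by (simp add: D_def)
    have "\<exists>d>0. \<forall>y. norm (y - x) < d \<longrightarrow> norm (u y - u x - D \<bullet> (y - x)) \<le> e * norm (y - x)" if e: "e > 0" for e
    proof -
      define n where "n = real DIM('m)"
      define K where "K = n * (1 + 2 * M) + 1"
      have K: "K > 0" unfolding K_def n_def using M by (intro add_nonneg_pos mult_nonneg_nonneg) auto
      obtain m :: nat where m: "1 / real (Suc m) < e / K" using nat_approx_posE[of "e / K"] e K by auto
      define \<epsilon> where "\<epsilon> = 1 / real (Suc m)"
      have \<epsilon>: "\<epsilon> > 0" "K * \<epsilon> < e" using m K by (auto simp: \<epsilon>_def field_simps)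
      \<comment> \<open>one scale for all coordinates\<close>
      have "\<exists>d>0. \<forall>b\<in>Basis. \<forall>t. \<bar>t\<bar> < d \<longrightarrow> \<bar>u (x + t *\<^sub>R b) - u x - D' b * t\<bar> \<le> (\<epsilon> / 2) * \<bar>t\<bar>"
      proof -
        have "\<exists>d. \<forall>b\<in>Basis. d b > 0 \<and> (\<forall>t. \<bar>t\<bar> < d b \<longrightarrow> \<bar>u (x + t *\<^sub>R b) - u x - D' b * t\<bar> \<le> (\<epsilon> / 2) * \<bar>t\<bar>)"
          using D'[of _ "\<epsilon> / 2"] \<epsilon>(1) by (intro bchoice) auto
        then obtain d where d: "\<And>b. b \<in> Basis \<Longrightarrow> d b > 0"
          "\<And>b t. b \<in> Basis \<Longrightarrow> \<bar>t\<bar> < d b \<Longrightarrow> \<bar>u (x + t *\<^sub>R b) - u x - D' b * t\<bar> \<le> (\<epsilon> / 2) * \<bar>t\<bar>"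
          by blast
        show ?thesis
        proof (intro exI[of _ "Min (d ` Basis)"] conjI ballI allI impI)
          show "Min (d ` Basis) > 0" using d(1) by (subst Min_gr_iff) auto
          fix b :: 'm and t assume b: "b \<in> Basis" and t: "\<bar>t\<bar> < Min (d ` Basis)"
          then have "Min (d ` Basis) \<le> d b" using b by (intro Min_le) auto
          then show "\<bar>u (x + t *\<^sub>R b) - u x - D' b * t\<bar> \<le> (\<epsilon> / 2) * \<bar>t\<bar>" using d(2)[OF b, of t] t by linarith
        qed
      qed
      then obtain d where d: "d > 0"
        "\<And>b t. b \<in> Basis \<Longrightarrow> \<bar>t\<bar> < d \<Longrightarrow> \<bar>u (x + t *\<^sub>R b) - u x - D' b * t\<bar> \<le> (\<epsilon> / 2) * \<bar>t\<bar>" by blast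
      obtain k :: nat where k: "1 / real (Suc k) < d" using d(1) nat_approx_posE by blast
      obtain c where c: "c \<in> Z" "dist D c < \<epsilon> / 2"
        using Z(2)[of "ball D (\<epsilon> / 2)"] \<epsilon>(1) by auto
      have "x \<in> F m k c"
        unfolding F_def
      proof (intro INT_I CollectI)
        fix b :: 'm and t assume b: "b \<in> Basis" and t: "t \<in> {t. \<bar>t\<bar> \<le> 1 / real (Suc k)}"
        have "\<bar>(D - c) \<bullet> b\<bar> \<le> \<epsilon> / 2" using Basis_le_norm[OF b, of "D - c"] c(2) by (simp add: dist_norm)
        then have "\<bar>(D - c) \<bullet> b * t\<bar> \<le> (\<epsilon> / 2) * \<bar>t\<bar>" unfolding abs_mult by (intro mult_right_mono) auto
        moreover have "\<bar>u (x + t *\<^sub>R b) - u x - D' b * t\<bar> \<le> (\<epsilon> / 2) * \<bar>t\<bar>" using d(2)[OF b] t k by auto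
        moreover have "u (x + t *\<^sub>R b) - u x - (c \<bullet> b) * t = (u (x + t *\<^sub>R b) - u x - D' b * t) + (D - c) \<bullet> b * t"
          using D[OF b] by (simp add: inner_diff_left algebra_simps)
        ultimately have "\<bar>u (x + t *\<^sub>R b) - u x - (c \<bullet> b) * t\<bar> \<le> (\<epsilon> / 2) * \<bar>t\<bar> + (\<epsilon> / 2) * \<bar>t\<bar>" by linarith
        then show "\<bar>u (x + t *\<^sub>R b) - u x - (c \<bullet> b) * t\<bar> \<le> (1 / real (Suc m)) * \<bar>t\<bar>"
          unfolding \<epsilon>_def[symmetric] by (simp add: algebra_simps)
      qed
      then have dens: "density_point (F m k c) x" using x c(1) by (auto simp: N'_def)
      have "F m k c \<in> sets lebesgue" using F by auto
      from density_point_imp_dense[OF this dens \<epsilon>(1)]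
      obtain r0 where r0: "r0 > 0" "\<And>r y. 0 < r \<Longrightarrow> r < r0 \<Longrightarrow> y \<in> cball x r \<Longrightarrow> \<exists>p\<in>F m k c. dist y p \<le> \<epsilon> * r"
        by blast
      show ?thesis
      proof (intro exI[of _ "min r0 (1 / real (Suc k))"] conjI allI impI)
        fix y assume y: "norm (y - x) < min r0 (1 / real (Suc k))"
        define v where "v = y - x"
        define r where "r = norm v"
        show "norm (u y - u x - D \<bullet> (y - x)) \<le> e * norm (y - x)"
        proof (cases "v = 0")
          case False
          then have r: "0 < r" "r < r0" "r < 1 / real (Suc k)" using y by (auto simp: r_def v_def)
          define s where "s J = (\<Sum>b\<in>J. (v \<bullet> b) *\<^sub>R b)" for J :: "'m set"
          have step: "\<bar>u (x + s J) - u x - (\<Sum>b\<in>J. (c \<bullet> b) * (v \<bullet> b))\<bar> \<le> real (card J) * ((1 + 2 * M) * \<epsilon> * r)"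
            if "J \<subseteq> Basis" for J
            using finite_subset[OF that finite_Basis] that
          proof (induction J rule: finite_induct)
            case (insert b J)
            then have b: "b \<in> Basis" and J: "J \<subseteq> Basis" by auto
            define t where "t = v \<bullet> b"
            define z where "z = x + s J"
            have "norm (s J) \<le> r"
              unfolding r_def
            proof (rule norm_le_componentwise)
              fix b' :: 'm assume b': "b' \<in> Basis"
              have "s J \<bullet> b' = (\<Sum>b\<in>J. if b = b' then v \<bullet> b' else 0)"
                unfolding s_def inner_sum_left using J b'
                by (intro sum.cong) (auto simp: inner_Basis subset_iff)
              also have "\<dots> = (if b' \<in> J then v \<bullet> b' else 0)" using insert by (simp add: sum.delta)
              finally show "\<bar>s J \<bullet> b'\<bar> \<le> \<bar>v \<bullet> b'\<bar>" by simp
            qed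
            then have "z \<in> cball x r" by (simp add: z_def dist_norm)
            then obtain p where p: "p \<in> F m k c" "dist z p \<le> \<epsilon> * r" using r0(2) r by blast
            have t: "\<bar>t\<bar> \<le> r" using Basis_le_norm[OF b, of v] by (simp add: t_def r_def)
            have "\<bar>u (p + t *\<^sub>R b) - u p - (c \<bullet> b) * t\<bar> \<le> \<epsilon> * \<bar>t\<bar>"
              using p(1) b t r unfolding F_def \<epsilon>_def by auto
            also have "\<dots> \<le> \<epsilon> * r" using t \<epsilon> by simp
            finally have 1: "\<bar>u (p + t *\<^sub>R b) - u p - (c \<bullet> b) * t\<bar> \<le> \<epsilon> * r" .
            have Mp: "M * dist z p \<le> M * (\<epsilon> * r)" using p(2) M by (rule mult_left_mono)
            have 2: "\<bar>u z - u p\<bar> \<le> M * (\<epsilon> * r)" using slope[of z p] Mp by linarith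
            have 3: "\<bar>u (z + t *\<^sub>R b) - u (p + t *\<^sub>R b)\<bar> \<le> M * (\<epsilon> * r)"
              using slope[of "z + t *\<^sub>R b" "p + t *\<^sub>R b"] Mp by (simp add: dist_norm)
            have "s (insert b J) = s J + t *\<^sub>R b" using insert by (simp add: s_def t_def)
            then have eq: "x + s (insert b J) = z + t *\<^sub>R b" by (simp add: z_def)
            have "\<bar>u (z + t *\<^sub>R b) - u z - (c \<bullet> b) * t\<bar> \<le> (1 + 2 * M) * \<epsilon> * r"
              using 1 2 3 by (simp add: algebra_simps)
            moreover have "\<bar>u z - u x - (\<Sum>b\<in>J. (c \<bullet> b) * (v \<bullet> b))\<bar> \<le> real (card J) * ((1 + 2 * M) * \<epsilon> * r)"
              using insert.IH[OF J] by (simp add: z_def)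
            moreover have "(\<Sum>b\<in>insert b J. (c \<bullet> b) * (v \<bullet> b)) = (c \<bullet> b) * t + (\<Sum>b\<in>J. (c \<bullet> b) * (v \<bullet> b))"
              using insert by (simp add: t_def)
            moreover have "real (card (insert b J)) = real (card J) + 1" using insert by simp
            ultimately show ?case unfolding eq by (simp add: distrib_right)
          qed (simp add: s_def)
          have "s Basis = v" unfolding s_def by (rule euclidean_representation)
          moreover have "(\<Sum>b\<in>Basis. (c \<bullet> b) * (v \<bullet> b)) = c \<bullet> v" by (rule euclidean_inner[symmetric])
          ultimately have "\<bar>u (x + v) - u x - c \<bullet> v\<bar> \<le> n * ((1 + 2 * M) * \<epsilon> * r)"
            using step[OF order_refl] by (simp add: n_def)
          moreover have "\<bar>(D - c) \<bullet> v\<bar> \<le> \<epsilon> * r"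
          proof -
            have "\<bar>(D - c) \<bullet> v\<bar> \<le> norm (D - c) * norm v" by (rule Cauchy_Schwarz_ineq2)
            also have "\<dots> \<le> \<epsilon> * r" using c(2) \<epsilon> unfolding r_def dist_norm by (intro mult_right_mono) auto
            finally show ?thesis .
          qed
          ultimately have "\<bar>u (x + v) - u x - D \<bullet> v\<bar> \<le> n * ((1 + 2 * M) * \<epsilon> * r) + \<epsilon> * r"
            by (simp add: inner_diff_left)
          also have "\<dots> = (K * \<epsilon>) * r" by (simp add: K_def algebra_simps)
          also have "\<dots> \<le> e * r" using \<epsilon>(2) r(1) by (intro mult_right_mono) auto
          finally show ?thesis by (simp add: v_def r_def)
        qed (simp add: v_def)
      qed (use r0 in auto)
    qed
    then have "(u has_derivative (\<lambda>v. D \<bullet> v)) (at x)"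
      unfolding has_derivative_at_alt by (auto intro: bounded_linear_inner_right)
    then show ?thesis by (auto simp: differentiable_def)
  qed
  ultimately show ?thesis
    using negligible_subset[OF negligible_Un, of N N' "{x. \<not> u differentiable (at x)}"] by blast
qed

section \<open>Images of sets on which a map collapses a direction\<close>

text \<open>Compress space by the factor \<open>\<epsilon>\<close> in the direction \<open>w\<close>. In the new coordinates \<open>h\<close> is Lipschitz at small
scales with a constant that does not depend on \<open>\<epsilon>\<close>: a step along \<open>w\<close> is longer by \<open>1 / \<epsilon>\<close> in the old
coordinates, but \<open>h\<close> moves only at speed \<open>\<epsilon>\<close> along it. The compressed set has measure of order \<open>\<epsilon>\<close> times the
measure of \<open>P\<close>. The compression is a shear that maps \<open>w\<close> to the basis vector \<open>b\<close> followed by a stretch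
along \<open>b\<close>; for the shear a crude Lipschitz bound on the measure suffices, so no determinant occurs.\<close>

lemma hausdorff_measure_collapsed_image_le:
  fixes h :: "'m::euclidean_space \<Rightarrow> 'y::metric_space" and u :: "nat \<Rightarrow> 'm \<Rightarrow> real"
  assumes b: "b \<in> Basis" and w: "w \<bullet> b = 1" "norm w \<le> K"
    and u: "\<And>i. M-lipschitz_on UNIV (u i)"
    and P: "P \<in> sets borel" "bounded P" and \<epsilon>: "\<epsilon> > 0" and d: "d > 0"
    and collapse: "\<And>x i t. x \<in> P \<Longrightarrow> \<bar>t\<bar> \<le> d \<Longrightarrow> \<bar>u i (x + t *\<^sub>R w) - u i x\<bar> \<le> \<epsilon> * \<bar>t\<bar>"
    and h: "\<And>x y c. x \<in> P \<Longrightarrow> y \<in> P \<Longrightarrow> (\<And>i. \<bar>u i x - u i y\<bar> \<le> c) \<Longrightarrow> dist (h x) (h y) \<le> c"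
  shows "hausdorff_measure DIM('m) (h ` P) \<le>
    ennreal (((1 + 2 * M) * DIM('m)) ^ DIM('m)) *
      (ennreal \<epsilon> * (ennreal (unit_ball_vol DIM('m)) *
        (ennreal (((2 + K) * DIM('m)) ^ DIM('m)) * emeasure lborel P)))"
proof -
  let ?n = "DIM('m)"
  have M: "M \<ge> 0" using lipschitz_on_nonneg[OF u] .
  have K: "K \<ge> 0" using w(2) norm_ge_zero order.trans by blast
  have bb: "b \<bullet> b = 1" "norm b = 1" using b by auto
  \<comment> \<open>\<open>A\<close> is the shear that maps \<open>b\<close> to \<open>w\<close>, \<open>A'\<close> its inverse, \<open>D\<close> the compression along \<open>b\<close>, and \<open>G\<close> undoes \<open>D\<close> before applying \<open>A\<close>\<close>
  define A where "A z = z + (z \<bullet> b) *\<^sub>R (w - b)" for z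
  define A' where "A' x = x - (x \<bullet> b) *\<^sub>R (w - b)" for x
  define D where "D z = z + ((\<epsilon> - 1) * (z \<bullet> b)) *\<^sub>R b" for z
  define G where "G z = z - (z \<bullet> b) *\<^sub>R b + ((z \<bullet> b) / \<epsilon>) *\<^sub>R w" for z
  have A'_b: "A' x \<bullet> b = x \<bullet> b" and A_b: "A x \<bullet> b = x \<bullet> b" and D_b: "D x \<bullet> b = \<epsilon> * (x \<bullet> b)" for x
    using w(1) bb by (simp_all add: A_def A'_def D_def inner_simps algebra_simps)
  have inv: "A (A' x) = x" "A' (A x) = x" "G (D x) = A x" for x
  proof -
    show "A (A' x) = x" unfolding A_def A'_b by (simp add: A'_def)
    show "A' (A x) = x" unfolding A'_def A_b by (simp add: A_def)
    have "G (D x) = D x - (\<epsilon> * (x \<bullet> b)) *\<^sub>R b + (x \<bullet> b) *\<^sub>R w"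
      unfolding G_def D_b using \<epsilon> by simp
    then show "G (D x) = A x" by (simp add: A_def D_def algebra_simps)
  qed
  have cont: "continuous_on UNIV A" "continuous_on UNIV G" "continuous_on UNIV D"
    unfolding A_def G_def D_def by (intro continuous_intros; use \<epsilon> in simp)+
  define S where "S = A -` P"
  define Q where "Q = G -` P"
  have S: "S \<in> sets borel" "Q \<in> sets borel"
    using measurable_sets[OF borel_measurable_continuous_onI[OF cont(1)] P(1)]
      measurable_sets[OF borel_measurable_continuous_onI[OF cont(2)] P(1)] by (simp_all add: S_def Q_def)
  have S_eq: "S = A' ` P" using inv by (auto simp: S_def image_iff) metis+
  have lin: "linear A'" "linear D"
    unfolding A'_def D_def by (auto intro!: linearI simp: inner_simps algebra_simps)
  have Q_eq: "Q = D ` S"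
  proof (intro equalityI subsetI)
    fix z assume z: "z \<in> Q"
    define y where "y = z + ((1 / \<epsilon> - 1) * (z \<bullet> b)) *\<^sub>R b"
    have y_b: "y \<bullet> b = (z \<bullet> b) / \<epsilon>" using bb by (simp add: y_def inner_simps algebra_simps)
    have "D y = z + ((1 / \<epsilon> - 1) * (z \<bullet> b) + (\<epsilon> - 1) * ((z \<bullet> b) / \<epsilon>)) *\<^sub>R b"
      unfolding D_def y_b by (simp only: y_def scaleR_left_distrib add.assoc)
    moreover have "(1 / \<epsilon> - 1) * (z \<bullet> b) + (\<epsilon> - 1) * ((z \<bullet> b) / \<epsilon>) = 0"
      using \<epsilon> by (simp add: field_simps)
    ultimately have "D y = z" by simp
    moreover have "A y \<in> P" using z inv(3)[of y] \<open>D y = z\<close> by (simp add: Q_def)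
    ultimately show "z \<in> D ` S" by (auto simp: S_def)
  qed (auto simp: Q_def S_def inv)
  have bounded: "bounded S" "bounded Q"
    unfolding Q_eq S_eq using lin P(2) by (auto intro!: bounded_linear_image simp: linear_conv_bounded_linear[symmetric])
  have "emeasure lborel Q = ennreal \<epsilon> * emeasure lborel S"
  proof -
    define c where "c j = (if j = b then \<epsilon> else 1)" for j
    have D_eq: "D = (\<lambda>x. 0 + (\<Sum>j\<in>Basis. (c j * (x \<bullet> j)) *\<^sub>R j))"
    proof (rule ext, rule euclidean_eqI)
      fix x j :: 'm assume j: "j \<in> Basis"
      show "D x \<bullet> j = (0 + (\<Sum>j\<in>Basis. (c j * (x \<bullet> j)) *\<^sub>R j)) \<bullet> j"
        using j b by (auto simp: D_def c_def inner_simps inner_Basis algebra_simps)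
    qed
    have "(\<Prod>j\<in>Basis. \<bar>c j\<bar>) = \<epsilon>"
      using b \<epsilon> by (simp add: c_def if_distrib[of abs] prod.delta cong: if_cong)
    then have "lborel = density (distr lborel borel D) (\<lambda>_. ennreal \<epsilon>)"
      using lborel_affine_euclidean[of c 0] \<epsilon> unfolding D_eq by (simp add: c_def)
    then have "emeasure lborel Q = emeasure (density (distr lborel borel D) (\<lambda>_. ennreal \<epsilon>)) Q" by simp
    also have "\<dots> = ennreal \<epsilon> * emeasure (distr lborel borel D) Q"
      using S(2) by (subst emeasure_density_const) auto
    also have "emeasure (distr lborel borel D) Q = emeasure lborel (D -` Q)"
      using S(2) borel_measurable_continuous_onI[OF cont(3)] by (subst emeasure_distr) auto
    also have "D -` Q = S" by (auto simp: Q_def S_def inv)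
    finally show ?thesis .
  qed
  also have "emeasure lborel S \<le> ennreal (unit_ball_vol ?n) * (ennreal (((2 + K) * ?n) ^ ?n) * emeasure lborel P)"
  proof -
    have "hausdorff_measure ?n (A' ` P) \<le> ennreal (((2 + K) * ?n) ^ ?n) * emeasure lebesgue P"
    proof (rule hausdorff_measure_image_le)
      fix x y assume "x \<in> P" "y \<in> P"
      have "A' x - A' y = (x - y) - ((x - y) \<bullet> b) *\<^sub>R (w - b)" by (simp add: A'_def algebra_simps inner_simps)
      then have "norm (A' x - A' y) \<le> norm (x - y) + \<bar>(x - y) \<bullet> b\<bar> * norm (w - b)"
        by (metis norm_scaleR norm_triangle_ineq4)
      also have "\<dots> \<le> norm (x - y) + norm (x - y) * (K + 1)"
        using Basis_le_norm[OF b, of "x - y"] norm_triangle_ineq4[of w b] w(2) bb(2)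
        by (intro add_left_mono mult_mono) auto
      finally show "dist (A' x) (A' y) \<le> (2 + K) * dist x y"
        by (simp add: dist_norm algebra_simps)
    qed (use P K in \<open>auto intro: zero_less_one\<close>)
    then have "emeasure lebesgue S \<le> ennreal (unit_ball_vol ?n) * (ennreal (((2 + K) * ?n) ^ ?n) * emeasure lebesgue P)"
      unfolding S_eq[symmetric]
      by (intro order.trans[OF lebesgue_le_hausdorff_measure] mult_left_mono) (use S(1) in auto)
    then show ?thesis using S P by simp
  qed
  finally have Q_le: "emeasure lborel Q \<le> ennreal \<epsilon> * (ennreal (unit_ball_vol ?n) * (ennreal (((2 + K) * ?n) ^ ?n) * emeasure lborel P))"
    by (simp add: mult_left_mono)
  have "hausdorff_measure ?n ((h \<circ> G) ` Q) \<le> ennreal (((1 + 2 * M) * ?n) ^ ?n) * emeasure lebesgue Q"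
  proof (rule hausdorff_measure_image_le)
    fix x y assume xy: "x \<in> Q" "y \<in> Q" "dist x y < d * \<epsilon>"
    \<comment> \<open>split \<open>G y - G x\<close> into a long step \<open>s *\<^sub>R w\<close> in the collapsed direction and a short step \<open>z\<close>\<close>
    define s where "s = ((y - x) \<bullet> b) / \<epsilon>"
    define z where "z = (y - x) - ((y - x) \<bullet> b) *\<^sub>R b"
    have s: "\<epsilon> * \<bar>s\<bar> \<le> dist x y" "\<bar>s\<bar> \<le> d"
    proof -
      show 1: "\<epsilon> * \<bar>s\<bar> \<le> dist x y"
        using Basis_le_norm[OF b, of "y - x"] \<epsilon> by (simp add: s_def dist_norm norm_minus_commute abs_divide)
      have "\<epsilon> * \<bar>s\<bar> \<le> \<epsilon> * d" using 1 xy(3) by (simp add: mult.commute)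
      then show "\<bar>s\<bar> \<le> d" using \<epsilon> by simp
    qed
    have z: "norm z \<le> 2 * dist x y"
    proof -
      have "norm z \<le> norm (y - x) + \<bar>(y - x) \<bullet> b\<bar> * norm b"
        unfolding z_def by (metis norm_scaleR norm_triangle_ineq4)
      then show ?thesis using Basis_le_norm[OF b, of "y - x"] bb(2) by (simp add: dist_norm norm_minus_commute)
    qed
    have Gy: "G y = (G x + s *\<^sub>R w) + z"
      by (simp add: G_def s_def z_def inner_simps algebra_simps diff_divide_distrib)
    show "dist ((h \<circ> G) x) ((h \<circ> G) y) \<le> (1 + 2 * M) * dist x y"
      unfolding comp_def
    proof (rule h)
      show "G x \<in> P" "G y \<in> P" using xy by (auto simp: Q_def)
      fix i
      have "\<bar>u i (G x + s *\<^sub>R w) - u i (G x)\<bar> \<le> \<epsilon> * \<bar>s\<bar>"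
        using collapse[OF \<open>G x \<in> P\<close> s(2)] .
      moreover have "\<bar>u i (G y) - u i (G x + s *\<^sub>R w)\<bar> \<le> M * norm z"
        using lipschitz_onD[OF u, of "G y" "G x + s *\<^sub>R w" i] unfolding Gy by (simp add: dist_norm)
      moreover have "M * norm z \<le> M * (2 * dist x y)" using z M by (rule mult_left_mono)
      ultimately show "\<bar>u i (G x) - u i (G y)\<bar> \<le> (1 + 2 * M) * dist x y"
        using s(1) by (simp add: algebra_simps)
    qed
  qed (use S bounded M \<epsilon> d in auto)
  also have "(h \<circ> G) ` Q = h ` P"
  proof -
    have "G ` Q = P"
    proof (intro equalityI subsetI)
      fix x assume "x \<in> P"
      then have "G (D (A' x)) \<in> P" "x = G (D (A' x))" by (simp_all add: inv)
      then show "x \<in> G ` Q" unfolding Q_def by blast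
    qed (auto simp: Q_def)
    then show ?thesis by (metis image_comp)
  qed
  also have "ennreal (((1 + 2 * M) * ?n) ^ ?n) * emeasure lebesgue Q
     \<le> ennreal (((1 + 2 * M) * ?n) ^ ?n) * (ennreal \<epsilon> * (ennreal (unit_ball_vol ?n) * (ennreal (((2 + K) * ?n) ^ ?n) * emeasure lborel P)))"
    using Q_le S by (intro mult_left_mono) auto
  finally show ?thesis .
qed

section \<open>Regular charts made of distance functions\<close>

text \<open>A nonzero vector has a coordinate of size at least \<open>norm v / DIM('m)\<close>. After division by it, the vector is
approximated by an element of a countable dense subset of a hyperplane. This replaces the uncountably many
directions by countably many, with norms bounded and one coordinate equal to 1.\<close>

lemma slope_directions:
  "\<exists>W :: 'm::euclidean_space \<Rightarrow> 'm set. (\<forall>b. countable (W b)) \<and> (\<forall>b. \<forall>w\<in>W b. w \<bullet> b = 1) \<and>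
     (\<forall>v e. v \<noteq> 0 \<longrightarrow> e > 0 \<longrightarrow>
       (\<exists>b\<in>Basis. \<exists>w\<in>W b. norm w \<le> real DIM('m) + e \<and> norm (w - (1 / (v \<bullet> b)) *\<^sub>R v) < e))"
proof -
  have "\<exists>T. countable T \<and> T \<subseteq> {w. w \<bullet> b = 1} \<and> {w. w \<bullet> b = 1} \<subseteq> closure T" for b :: 'm
    using separable[of "{w. w \<bullet> b = 1}"] by metis
  then obtain W where W: "\<And>b::'m. countable (W b)" "\<And>b. W b \<subseteq> {w. w \<bullet> b = 1}"
    "\<And>b. {w. w \<bullet> b = 1} \<subseteq> closure (W b)"
    by metis
  show ?thesis
  proof (intro exI[of _ W] conjI allI impI)
    fix v :: 'm and e :: real assume v: "v \<noteq> 0" and e: "e > 0"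
    have "\<exists>b\<in>Basis. norm v \<le> DIM('m) * \<bar>v \<bullet> b\<bar>"
    proof (rule ccontr)
      assume "\<not> ?thesis"
      then have less: "\<bar>v \<bullet> b\<bar> < norm v / DIM('m)" if "b \<in> Basis" for b
        using that by (auto simp: field_simps not_le)
      have "norm v \<le> (\<Sum>b\<in>Basis. \<bar>v \<bullet> b\<bar>)" by (rule norm_le_l1)
      also have "\<dots> < (\<Sum>b\<in>(Basis::'m set). norm v / DIM('m))"
        using less by (intro sum_strict_mono) auto
      finally show False by simp
    qed
    then obtain b where b: "b \<in> Basis" "norm v \<le> DIM('m) * \<bar>v \<bullet> b\<bar>" by blast
    have vb: "v \<bullet> b \<noteq> 0" using b(2) v by auto
    define v' where "v' = (1 / (v \<bullet> b)) *\<^sub>R v"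
    have "v' \<bullet> b = 1" using vb by (simp add: v'_def)
    then have "v' \<in> closure (W b)" using W(3) by blast
    then obtain w where w: "w \<in> W b" "dist w v' < e" using e closure_approachable by blast
    have "norm v' \<le> DIM('m)" using b(2) vb by (simp add: v'_def field_simps)
    then have "norm w \<le> real DIM('m) + e"
      using w(2) norm_triangle_ineq[of v' "w - v'"] by (simp add: dist_norm)
    then show "\<exists>b\<in>Basis. \<exists>w\<in>W b. norm w \<le> real DIM('m) + e \<and> norm (w - (1 / (v \<bullet> b)) *\<^sub>R v) < e"
      using b(1) w by (auto simp: v'_def dist_norm)
  qed (use W in auto)
qed

text \<open>If no nonzero vector is orthogonal to all \<open>g i\<close>, they span the space and contain a basis.\<close>

lemma injective_tuple_of_functionals:
  fixes g :: "nat \<Rightarrow> real^'n"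
  assumes "\<And>v. v \<noteq> 0 \<Longrightarrow> \<exists>i. g i \<bullet> v \<noteq> 0"
  shows "\<exists>\<sigma>::'n \<Rightarrow> nat. inj (\<lambda>v. \<chi> j. g (\<sigma> j) \<bullet> v)"
proof -
  have span: "span (range g) = UNIV"
  proof (rule ccontr)
    assume "span (range g) \<noteq> UNIV"
    from span_not_UNIV_orthogonal[OF this] obtain a where "a \<noteq> 0" "\<forall>x\<in>span (range g). a \<bullet> x = 0" by blast
    then show False using assms[of a] by (metis inner_commute rangeI span_base)
  qed
  obtain B where B: "B \<subseteq> range g" "independent B" "range g \<subseteq> span B"
    using maximal_independent_subset by blast
  have spanB: "span B = UNIV" using B(3) span span_mono[OF B(3)] by (metis span_span top.extremum_uniqueI)
  have "card B = dim (UNIV :: (real^'n) set)"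
    using B(2) spanB by (metis dim_span_eq_card_independent)
  then have "card B = CARD('n)" by simp
  moreover have "finite B" using B(2) by (rule finiteI_independent)
  ultimately obtain \<beta> where \<beta>: "bij_betw \<beta> (UNIV :: 'n set) B"
    by (metis finite_same_card_bij finite)
  define \<sigma> where "\<sigma> j = (SOME i. g i = \<beta> j)" for j
  have \<sigma>: "g (\<sigma> j) = \<beta> j" for j
  proof -
    have "\<beta> j \<in> range g" using \<beta> B(1) by (auto simp: bij_betw_def)
    then show ?thesis unfolding \<sigma>_def by (metis (mono_tags, lifting) image_iff someI_ex)
  qed
  have "inj (\<lambda>v. \<chi> j. g (\<sigma> j) \<bullet> v)"
  proof (rule injI)
    fix x y assume eq: "(\<chi> j. g (\<sigma> j) \<bullet> x) = (\<chi> j. g (\<sigma> j) \<bullet> y)"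
    have hb: "b \<bullet> (x - y) = 0" if bB: "b \<in> B" for b
    proof -
      obtain j where "b = \<beta> j" using bB \<beta> by (auto simp: bij_betw_def)
      then have "b = g (\<sigma> j)" using \<sigma> by simp
      moreover have "g (\<sigma> j) \<bullet> x = g (\<sigma> j) \<bullet> y"
        using arg_cong[OF eq, of "\<lambda>z. z $ j"] by simp
      ultimately show ?thesis by (simp add: inner_diff_right)
    qed
    have "orthogonal (x - y) z" if z: "z \<in> span B" for z
      by (rule orthogonal_to_span[OF z]) (metis hb inner_commute orthogonal_def)
    then have "orthogonal (x - y) (x - y)" using spanB by blast
    then show "x = y" by (simp add: orthogonal_def)
  qed
  then show ?thesis by (rule exI[of _ \<sigma>])
qed

text \<open>Otherwise, almost everywhere on \<open>A\<close>, the derivatives of the distance functions \<open>u i\<close> have a common nonzero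
kernel vector. Approximating it by one of the countably many directions, we get for each \<open>m\<close> a countable
cover of almost all of \<open>A\<close> by closed sets \<open>C m w k\<close> on which \<open>h\<close> moves with speed at most
\<open>2 / (m + 1)\<close> along \<open>w\<close>. So \<open>H (h ` A)\<close> is at most a constant times \<open>1 / (m + 1)\<close> for every \<open>m\<close>.\<close>

theorem regular_distance_chart:
  fixes A :: "(real^'n) set" and h :: "real^'n \<Rightarrow> 'y::metric_space"
  assumes A: "A \<in> sets lebesgue" "bounded A" and h: "M-lipschitz_on A h"
    and pos: "hausdorff_measure CARD('n) (h ` A) > 0"
  shows "\<exists>(p::'n \<Rightarrow> 'y) U. (\<forall>j. M-lipschitz_on UNIV (\<lambda>x. U x $ j)) \<and>
     (\<forall>x\<in>A. \<forall>j. U x $ j = dist (p j) (h x)) \<and>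
     \<not> negligible {x \<in> A. \<exists>D. (U has_derivative D) (at x) \<and> inj D}"
proof (rule ccontr)
  assume contra: "\<not> ?thesis"
  let ?n = "CARD('n)"
  have M: "M \<ge> 0" by (rule lipschitz_on_nonneg[OF h])
  have "A \<noteq> {}" using pos by auto
  obtain T where T: "countable T" "T \<subseteq> A" "A \<subseteq> closure T" using separable by metis
  have "T \<noteq> {}" using T(3) \<open>A \<noteq> {}\<close> by auto
  define a where "a = from_nat_into T"
  have a: "a i \<in> A" for i using from_nat_into[OF \<open>T \<noteq> {}\<close>] T(2) by (auto simp: a_def)
  have ran_a: "range a = T" unfolding a_def using range_from_nat_into[OF \<open>T \<noteq> {}\<close> T(1)] .
  have "\<exists>u. M-lipschitz_on UNIV u \<and> (\<forall>x\<in>A. u x = dist (h (a i)) (h x))" for i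
  proof (rule lipschitz_real_extension, rule lipschitz_onI)
    fix x y assume "x \<in> A" "y \<in> A"
    then have "dist (h x) (h y) \<le> M * dist x y" by (rule lipschitz_onD[OF h])
    moreover have "\<bar>dist (h (a i)) (h x) - dist (h (a i)) (h y)\<bar> \<le> dist (h x) (h y)"
      using dist_triangle[of "h (a i)" "h x" "h y"] dist_triangle[of "h (a i)" "h y" "h x"]
      by (simp add: abs_le_iff dist_commute)
    ultimately show "dist (dist (h (a i)) (h x)) (dist (h (a i)) (h y)) \<le> M * dist x y"
      by (simp add: dist_real_def)
  qed (rule M)
  then obtain u where u: "\<And>i. M-lipschitz_on UNIV (u i)" "\<And>i x. x \<in> A \<Longrightarrow> u i x = dist (h (a i)) (h x)"
    by metis
  \<comment> \<open>the distance functions determine the distances in \<open>h ` A\<close>: use one whose centre is close to \<open>h x\<close>\<close>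
  have recover: "dist (h x) (h y) \<le> c" if xy: "x \<in> A" "y \<in> A" and c: "\<And>i. \<bar>u i x - u i y\<bar> \<le> c" for x y c
  proof (rule field_le_epsilon)
    fix e :: real assume e: "e > 0"
    define e' where "e' = e / (2 * (M + 1))"
    have "e' > 0" using e M by (simp add: e'_def)
    moreover have "x \<in> closure (range a)" using xy(1) T(3) ran_a by blast
    ultimately obtain i where i: "dist (a i) x < e'" using closure_approachable by blast
    have "dist (h (a i)) (h x) \<le> M * dist (a i) x" using a xy(1) by (intro lipschitz_onD[OF h])
    also have "\<dots> \<le> (M + 1) * e'" using i M by (intro mult_mono) auto
    also have "\<dots> = e / 2"
    proof -
      have "M + 1 \<noteq> 0" using M by simp
      then show ?thesis unfolding e'_def by (metis mult.commute nonzero_mult_div_cancel_left times_divide_eq_right divide_divide_eq_left)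
    qed
    finally have 1: "dist (h (a i)) (h x) \<le> e / 2" .
    have "dist (h x) (h y) \<le> dist (h (a i)) (h x) + dist (h (a i)) (h y)" by (rule dist_triangle3)
    moreover have "dist (h (a i)) (h y) \<le> c + dist (h (a i)) (h x)"
      using c[of i] xy by (simp add: u(2) abs_le_iff)
    ultimately show "dist (h x) (h y) \<le> c + e" using 1 by simp
  qed
  define U where "U \<sigma> x = (\<chi> j. u (\<sigma> j) x)" for \<sigma> :: "'n \<Rightarrow> nat" and x
  define R where "R \<sigma> = {x \<in> A. \<exists>D. (U \<sigma> has_derivative D) (at x) \<and> inj D}" for \<sigma>
  have R: "negligible (R \<sigma>)" for \<sigma>
  proof (rule ccontr)
    assume "\<not> negligible (R \<sigma>)"
    moreover have "\<forall>j. M-lipschitz_on UNIV (\<lambda>x. U \<sigma> x $ j)" using u(1) by (simp add: U_def)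
    moreover have "\<forall>x\<in>A. \<forall>j. U \<sigma> x $ j = dist (h (a (\<sigma> j))) (h x)" using u(2) by (simp add: U_def)
    ultimately have "\<exists>(p::'n \<Rightarrow> 'y) U. (\<forall>j. M-lipschitz_on UNIV (\<lambda>x. U x $ j)) \<and>
     (\<forall>x\<in>A. \<forall>j. U x $ j = dist (p j) (h x)) \<and>
     \<not> negligible {x \<in> A. \<exists>D. (U has_derivative D) (at x) \<and> inj D}"
      unfolding R_def by (intro exI[of _ "\<lambda>j. h (a (\<sigma> j))"] exI[of _ "U \<sigma>"] conjI)
    then show False using contra by contradiction
  qed
  have cont: "continuous_on UNIV (u i)" for i using u(1) lipschitz_on_continuous_on by blast
  obtain W :: "real^'n \<Rightarrow> (real^'n) set" where W: "\<And>b. countable (W b)" "\<And>b w. w \<in> W b \<Longrightarrow> w \<bullet> b = 1"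
    "\<And>v e. v \<noteq> 0 \<Longrightarrow> e > 0 \<Longrightarrow> \<exists>b\<in>Basis. \<exists>w\<in>W b. norm w \<le> real DIM(real^'n) + e \<and> norm (w - (1 / (v \<bullet> b)) *\<^sub>R v) < e"
    using slope_directions[where 'm = "real^'n"] by (elim exE conjE) metis
  define K where "K = real ?n + 1"
  define N1 where "N1 = (\<Union>i. {x. \<not> u i differentiable (at x)})"
  define N2 where "N2 = (\<Union>\<sigma>. R \<sigma>)"
  define N3 where "N3 = (\<Union>b\<in>Basis. \<Union>w\<in>W b. \<Union>m::nat.
     (\<Inter>i. dir_lip (\<lambda>_. u i) w (1 / real (Suc m))) - dir_lip u w (1 / real (Suc m)))"
  define N where "N = N1 \<union> N2 \<union> N3"
  have "negligible N1"
    unfolding N1_def using rademacher[OF u(1)] by (intro negligible_countable_Union countable_image) auto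
  moreover have "negligible N2"
    unfolding N2_def using R by (intro negligible_countable_Union countable_image) auto
  moreover have "negligible N3"
    unfolding N3_def using W(1) negligible_dir_lip_diff[OF u(1)]
    by (intro negligible_countable_Union countable_image)
      (auto intro!: negligible_countable_Union countable_image countable_finite[OF finite_Basis])
  ultimately have N: "negligible N" unfolding N_def by (intro negligible_Un)
  define C where "C m w k = (\<Inter>i. \<Inter>t\<in>{t. \<bar>t\<bar> \<le> 1 / real (Suc k)}.
     {x. \<bar>u i (x + t *\<^sub>R w) - u i x\<bar> \<le> (2 / real (Suc m)) * \<bar>t\<bar>})" for m k :: nat and w
  have C: "closed (C m w k)" for m w k
    unfolding C_def
    by (intro closed_INT ballI closed_Collect_le continuous_intros continuous_on_compose2[OF cont]) auto
  have cover: "\<exists>b\<in>Basis. \<exists>w\<in>W b. norm w \<le> K \<and> (\<exists>k. x \<in> C m w k)" if x: "x \<in> A - N" for x m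
  proof -
    have "u i differentiable (at x)" for i using x by (auto simp: N_def N1_def)
    then obtain D where D: "\<And>i. (u i has_derivative D i) (at x)" unfolding differentiable_def by metis
    define g where "g i = (\<Sum>b\<in>Basis. D i b *\<^sub>R b)" for i
    have g: "D i v = g i \<bullet> v" for i v
    proof -
      have "linear (D i)" using D has_derivative_linear by blast
      then have "D i v = (\<Sum>b\<in>Basis. (v \<bullet> b) * D i b)"
        by (subst euclidean_representation[symmetric, of v]) (simp add: linear_sum linear_cmul)
      also have "\<dots> = g i \<bullet> v"
        unfolding g_def inner_sum_left by (intro sum.cong) (simp_all add: inner_commute mult.commute)
      finally show ?thesis .
    qed
    have "\<exists>v. v \<noteq> 0 \<and> (\<forall>i. D i v = 0)"
    proof (rule ccontr)
      assume "\<not> ?thesis"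
      then obtain \<sigma> :: "'n \<Rightarrow> nat" where \<sigma>: "inj (\<lambda>v. \<chi> j. g (\<sigma> j) \<bullet> v)"
        using injective_tuple_of_functionals[of g] unfolding g by blast
      have "(U \<sigma> has_derivative (\<lambda>v. \<chi> j. D (\<sigma> j) v)) (at x)"
      proof (rule has_derivative_componentwise_within[THEN iffD2, rule_format])
        fix b :: "real^'n" assume "b \<in> Basis"
        then obtain j where b: "b = axis j 1" by (auto simp: Basis_vec_def)
        show "((\<lambda>x. U \<sigma> x \<bullet> b) has_derivative (\<lambda>v. (\<chi> j. D (\<sigma> j) v) \<bullet> b)) (at x)"
          using D[of "\<sigma> j"] by (simp add: b U_def inner_axis)
      qed
      then have "x \<in> R \<sigma>" using x \<sigma> unfolding R_def g by blast
      then show False using x by (auto simp: N_def N2_def)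
    qed
    then obtain v where v: "v \<noteq> 0" "\<And>i. D i v = 0" by blast
    \<comment> \<open>replacing \<open>v'\<close> by a direction \<open>w\<close> at distance \<open>e\<close> costs at most \<open>1 / (m + 1)\<close> in the slopes\<close>
    define e where "e = 1 / ((M + 1) * real (Suc m))"
    have Me: "M * e \<le> 1 / real (Suc m)" 
    proof -
      have "M * e = (M / (M + 1)) * (1 / real (Suc m))" by (simp add: e_def)
      also have "\<dots> \<le> 1 * (1 / real (Suc m))" using M by (intro mult_right_mono) auto
      finally show ?thesis by simp
    qed
    have "(M + 1) * real (Suc m) \<ge> 1 * 1" using M by (intro mult_mono) auto
    then have e: "e > 0" "e \<le> 1" by (auto simp: e_def)
    obtain b w where bw: "b \<in> Basis" "w \<in> W b" "norm w \<le> real DIM(real^'n) + e"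
      "norm (w - (1 / (v \<bullet> b)) *\<^sub>R v) < e"
      using W(3)[OF v(1) e(1)] by blast
    define v' where "v' = (1 / (v \<bullet> b)) *\<^sub>R v"
    have Dv': "D i v' = 0" for i using v(2)[of i] g[of i v] g[of i v'] by (simp add: v'_def)
    have "x \<in> dir_lip (\<lambda>_. u i) w (1 / real (Suc m))" for i
      unfolding dir_lip_def
    proof (intro CollectI allI impI)
      fix e' :: real assume e': "e' > 0"
      define \<eta> where "\<eta> = e' / (norm v' + 1)"
      have \<eta>: "\<eta> > 0" "\<eta> * norm v' \<le> e'"
      proof -
        have pos: "norm v' + 1 > 0" by (simp add: add_nonneg_pos)
        then show "\<eta> > 0" using e' by (simp add: \<eta>_def)
        have "\<eta> * norm v' \<le> \<eta> * (norm v' + 1)" using \<open>\<eta> > 0\<close> by simp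
        also have "\<dots> = e'" using pos by (simp add: \<eta>_def)
        finally show "\<eta> * norm v' \<le> e'" .
      qed
      obtain d where d: "d > 0" "\<And>y. norm (y - x) < d \<Longrightarrow> norm (u i y - u i x - D i (y - x)) \<le> \<eta> * norm (y - x)"
        using D[of i] \<eta>(1) unfolding has_derivative_at_alt by blast
      define \<delta> where "\<delta> = d / (norm v' + 1) / 2"
      have \<delta>: "\<delta> > 0" using d(1) by (simp add: \<delta>_def add_nonneg_pos)
      have \<delta>v: "\<delta> * norm v' < d"
      proof -
        have "\<delta> * norm v' \<le> \<delta> * (norm v' + 1)" using \<delta> by simp
        also have "\<dots> = d / 2"
        proof -
          have "norm v' + 1 \<noteq> 0" using norm_ge_zero[of v'] by linarith
          then show ?thesis unfolding \<delta>_def by (metis nonzero_eq_divide_eq times_divide_eq_left)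
        qed
        finally show ?thesis using d(1) by simp
      qed
      show "\<exists>d>0. \<forall>j t. \<bar>t\<bar> \<le> d \<longrightarrow> \<bar>u i (x + t *\<^sub>R w) - u i x\<bar> \<le> (1 / real (Suc m) + e') * \<bar>t\<bar>"
      proof (intro exI[of _ \<delta>] conjI allI impI)
        fix t assume t: "\<bar>t\<bar> \<le> \<delta>"
        have "\<bar>t\<bar> * norm v' \<le> \<delta> * norm v'" using t by (intro mult_right_mono) auto
        then have "norm ((x + t *\<^sub>R v') - x) < d" using \<delta>v by simp
        then have "norm (u i (x + t *\<^sub>R v') - u i x - D i (t *\<^sub>R v')) \<le> \<eta> * norm (t *\<^sub>R v')"
          using d(2)[of "x + t *\<^sub>R v'"] by simp
        moreover have "D i (t *\<^sub>R v') = 0" using Dv'[of i] g[of i] by simp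
        moreover have "\<eta> * norm (t *\<^sub>R v') \<le> e' * \<bar>t\<bar>"
          using mult_right_mono[OF \<eta>(2), of "\<bar>t\<bar>"] by (simp add: mult_ac)
        ultimately have 1: "\<bar>u i (x + t *\<^sub>R v') - u i x\<bar> \<le> e' * \<bar>t\<bar>" by simp
        have "\<bar>u i (x + t *\<^sub>R w) - u i (x + t *\<^sub>R v')\<bar> \<le> M * (\<bar>t\<bar> * norm (w - v'))"
          using lipschitz_onD[OF u(1), of "x + t *\<^sub>R w" "x + t *\<^sub>R v'" i]
          by (simp add: dist_norm scaleR_diff_right[symmetric])
        also have "\<dots> \<le> M * (\<bar>t\<bar> * e)" using bw(4) M unfolding v'_def by (intro mult_left_mono) auto
        also have "\<dots> \<le> (1 / real (Suc m)) * \<bar>t\<bar>" using mult_right_mono[OF Me, of "\<bar>t\<bar>"] by (simp add: mult_ac)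
        finally show "\<bar>u i (x + t *\<^sub>R w) - u i x\<bar> \<le> (1 / real (Suc m) + e') * \<bar>t\<bar>"
          using 1 by (simp add: distrib_right)
      qed (rule \<delta>)
    qed
    then have "x \<in> (\<Inter>i. dir_lip (\<lambda>_. u i) w (1 / real (Suc m)))" by blast
    moreover have "x \<notin> (\<Inter>i. dir_lip (\<lambda>_. u i) w (1 / real (Suc m))) - dir_lip u w (1 / real (Suc m))"
      using x bw(1,2) unfolding N_def N3_def by blast
    ultimately have "x \<in> dir_lip u w (1 / real (Suc m))" by blast
    then obtain d where d: "d > 0"
      "\<And>i t. \<bar>t\<bar> \<le> d \<Longrightarrow> \<bar>u i (x + t *\<^sub>R w) - u i x\<bar> \<le> (1 / real (Suc m) + 1 / real (Suc m)) * \<bar>t\<bar>"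
      unfolding dir_lip_def by (auto dest!: spec[of _ "1 / real (Suc m)"])
    obtain k :: nat where "1 / real (Suc k) < d" using d(1) nat_approx_posE by blast
    then have "x \<in> C m w k" unfolding C_def using d(2) by auto
    moreover have "norm w \<le> K" using bw(3) e by (simp add: K_def)
    ultimately show ?thesis using bw(1,2) by blast
  qed
  obtain B Nb where B: "B \<in> sets borel" "negligible Nb" "B \<union> Nb = A"
    using sets_lebesgue_almost_borel[OF A(1)] .
  define \<kappa> where "\<kappa> = ((1 + 2 * M) * real ?n) ^ ?n * (unit_ball_vol (real ?n) * (((2 + K) * real ?n) ^ ?n * measure lebesgue A))"
  have Am: "A \<in> lmeasurable" using A by (simp add: bounded_set_imp_lmeasurable)
  have bound: "hausdorff_measure ?n (h ` A) \<le> ennreal (\<kappa> * (2 / real (Suc m)))" for m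
  proof -
    define I where "I = (SIGMA b:Basis. {w \<in> W b. norm w \<le> K}) \<times> (UNIV :: nat set)"
    have I: "countable I" unfolding I_def using W(1)
      by (intro countable_SIGMA countable_finite[OF finite_Basis]) (auto intro: countable_subset[OF _ W(1)])
    define P where "P j = (if j \<in> to_nat_on I ` I then C m (snd (fst (from_nat_into I j))) (snd (from_nat_into I j)) else {})" for j
    \<comment> \<open>disjoint Borel pieces, so that their measures add up to at most that of \<open>A\<close>\<close>
    define Q where "Q j = B \<inter> disjointed P j" for j
    have P_borel: "P j \<in> sets borel" for j using C by (simp add: P_def borel_closed)
    have Q_borel: "Q j \<in> sets borel" for j
      unfolding Q_def using B(1) sets.range_disjointed_sets[of P borel] P_borel by auto
    have QB: "Q j \<subseteq> B" for j by (auto simp: Q_def)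
    let ?c1 = "ennreal (((1 + 2 * M) * real ?n) ^ ?n)" and ?c2 = "ennreal (2 / real (Suc m))"
      and ?c3 = "ennreal (unit_ball_vol (real ?n))" and ?c4 = "ennreal (((2 + K) * real ?n) ^ ?n)"
    have Q_le: "hausdorff_measure ?n (h ` Q j) \<le>
      ?c1 * (?c2 * (?c3 * (?c4 * emeasure lborel (Q j))))" for j
    proof (cases "j \<in> to_nat_on I ` I")
      case True
      then obtain i where i: "i \<in> I" "j = to_nat_on I i" by blast
      obtain b w k where "i = ((b, w), k)" by (cases i) auto
      then have bwk: "from_nat_into I j = ((b, w), k)" "((b, w), k) \<in> I"
        using i from_nat_into_to_nat_on[OF I i(1)] by simp_all
      have "Q j \<subseteq> P j" using disjointed_subset[of P j] by (auto simp: Q_def)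
      then have QC: "Q j \<subseteq> C m w k" using True bwk(1) by (simp add: P_def)
      have "b \<in> Basis" "w \<in> W b" "norm w \<le> K" using bwk(2) by (auto simp: I_def)
      moreover have "Q j \<subseteq> A" using QB B(3) by blast
      ultimately show ?thesis
        using hausdorff_measure_collapsed_image_le[of b w K M u "Q j" "2 / real (Suc m)" "1 / real (Suc k)" h]
          W(2) u(1) Q_borel bounded_subset[OF A(2)] QC recover
        by (simp add: C_def subset_iff)
    next
      case False
      then have "Q j = {}" using disjointed_subset[of P j] by (auto simp: Q_def P_def)
      then show ?thesis by simp
    qed
    have UQ: "B - N \<subseteq> (\<Union>j. Q j)"
    proof
      fix x assume x: "x \<in> B - N"
      then have "x \<in> A - N" using B(3) by blast
      from cover[OF this, of m] obtain b w k where bwk: "b \<in> Basis" "w \<in> W b" "norm w \<le> K" "x \<in> C m w k" by blast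
      then have "((b, w), k) \<in> I" by (simp add: I_def)
      then have "x \<in> P (to_nat_on I ((b, w), k))" using bwk(4) I by (simp add: P_def)
      then have "x \<in> (\<Union>j. disjointed P j)" unfolding UN_disjointed_eq by blast
      then show "x \<in> (\<Union>j. Q j)" using x by (auto simp: Q_def)
    qed
    have "h ` A \<subseteq> h ` (A \<inter> (N \<union> Nb)) \<union> (\<Union>j. h ` Q j)"
      using UQ B(3) by blast
    then have "hausdorff_measure ?n (h ` A) \<le> hausdorff_measure ?n (h ` (A \<inter> (N \<union> Nb)) \<union> (\<Union>j. h ` Q j))"
      by (rule hausdorff_measure_mono)
    also have "\<dots> \<le> hausdorff_measure ?n (h ` (A \<inter> (N \<union> Nb))) + hausdorff_measure ?n (\<Union>j. h ` Q j)"
      by (rule hausdorff_measure_Un_le)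
    also have "hausdorff_measure ?n (h ` (A \<inter> (N \<union> Nb))) = 0"
    proof -
      have neg: "negligible (A \<inter> (N \<union> Nb))" using N B(2) by (intro negligible_Int) auto
      have "hausdorff_measure DIM(real^'n) (h ` (A \<inter> (N \<union> Nb)))
          \<le> ennreal (((M + 1) * DIM(real^'n)) ^ DIM(real^'n)) * emeasure lebesgue (A \<inter> (N \<union> Nb))"
      proof (rule hausdorff_measure_image_le[of _ "M + 1" 1])
        show "A \<inter> (N \<union> Nb) \<in> sets lebesgue" using neg by (rule negligible_imp_sets)
        show "bounded (A \<inter> (N \<union> Nb))" using A(2) by (rule bounded_subset) blast
        fix x y assume "x \<in> A \<inter> (N \<union> Nb)" "y \<in> A \<inter> (N \<union> Nb)"
        then have "dist (h x) (h y) \<le> M * dist x y" by (intro lipschitz_onD[OF h]) auto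
        then show "dist (h x) (h y) \<le> (M + 1) * dist x y" by (simp add: distrib_right add_increasing2)
      qed (use M in auto)
      also have "emeasure lebesgue (A \<inter> (N \<union> Nb)) = 0"
        using neg by (simp add: negligible_iff_null_sets null_sets_def)
      finally show ?thesis by simp
    qed
    also have "hausdorff_measure ?n (\<Union>j. h ` Q j) \<le> (\<Sum>j. hausdorff_measure ?n (h ` Q j))"
      by (rule hausdorff_measure_countably_subadditive)
    also have "\<dots> \<le> (\<Sum>j. ?c1 * (?c2 * (?c3 * (?c4 * emeasure lborel (Q j)))))"
      by (intro suminf_le Q_le) auto
    also have "\<dots> = ?c1 * (?c2 * (?c3 * (?c4 * (\<Sum>j. emeasure lborel (Q j)))))"
      by (simp only: ennreal_suminf_cmult)
    also have "(\<Sum>j. emeasure lborel (Q j)) = emeasure lborel (\<Union>j. Q j)"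
    proof (rule suminf_emeasure)
      show "disjoint_family Q"
        using disjoint_family_disjointed[of P] unfolding disjoint_family_on_def Q_def by blast
    qed (use Q_borel in auto)
    also have "\<dots> = emeasure lebesgue (\<Union>j. Q j)"
      using Q_borel by simp
    also have "\<dots> \<le> emeasure lebesgue A"
      using QB B(3) A(1) by (intro emeasure_mono) auto
    also have "\<dots> = ennreal (measure lebesgue A)" using Am by (simp add: emeasure_eq_measure2)
    finally have "hausdorff_measure ?n (h ` A) \<le> ?c1 * (?c2 * (?c3 * (?c4 * ennreal (measure lebesgue A))))"
      by (simp add: mult_left_mono)
    also have "\<dots> = ennreal (((1 + 2 * M) * real ?n) ^ ?n * (2 / real (Suc m) * (unit_ball_vol (real ?n) *
        (((2 + K) * real ?n) ^ ?n * measure lebesgue A))))"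
    proof -
      have "((1 + 2 * M) * real ?n) ^ ?n \<ge> 0" "2 / real (Suc m) \<ge> 0" "unit_ball_vol (real ?n) \<ge> 0" "((2 + K) * real ?n) ^ ?n \<ge> 0"
        using M by (auto simp: K_def)
      then show ?thesis by (simp only: ennreal_mult' )
    qed
    also have "\<dots> = ennreal (\<kappa> * (2 / real (Suc m)))"
      by (simp add: \<kappa>_def mult_ac)
    finally show ?thesis .
  qed
  have "hausdorff_measure ?n (h ` A) \<le> 0"
  proof (rule ennreal_le_epsilon)
    fix e :: real assume e: "e > 0"
    have \<kappa>: "\<kappa> \<ge> 0" using M by (simp add: \<kappa>_def K_def)
    obtain m :: nat where m: "1 / real (Suc m) < e / (2 * (\<kappa> + 1))"
      using nat_approx_posE[of "e / (2 * (\<kappa> + 1))"] e \<kappa> by auto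
    have "\<kappa> * (2 / real (Suc m)) \<le> (\<kappa> + 1) * (2 * (e / (2 * (\<kappa> + 1))))"
      using m \<kappa> by (intro mult_mono) auto
    also have "\<dots> = e" using \<kappa> by (simp add: divide_simps)
    finally show "hausdorff_measure ?n (h ` A) \<le> 0 + ennreal e"
      using order.trans[OF bound[of m]] by (simp add: ennreal_leI)
  qed
  then show False using pos by simp
qed

section \<open>Stability of images of positive measure\<close>

text \<open>Let \<open>T\<close> be the inverse of \<open>D\<close>. On a small ball of radius \<open>r\<close> about \<open>x\<close> the map \<open>T \<circ> \<Psi>\<close> differs from
a translation by at most \<open>r / 2\<close>: this holds on \<open>A\<close> by differentiability and closeness, and on the whole
ball because \<open>A\<close> is dense there at a scale that is small compared with \<open>r\<close>. By Brouwer's theorem the image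
of the ball contains a ball of radius \<open>r / 2\<close>. The points outside \<open>A\<close> contribute at most a constant times
\<open>\<eta> * r ^ n\<close>, less than the measure of the smaller ball. The radius \<open>r\<close> depends only on \<open>\<Phi>\<close>, \<open>A\<close>
and the constants, hence so does \<open>\<delta>\<close>.\<close>

theorem stable_positive_image:
  fixes A :: "'m::euclidean_space set" and \<Phi> :: "'m \<Rightarrow> 'm"
  assumes A: "A \<in> sets lebesgue" and x: "density_point A x"
    and \<Phi>: "L-lipschitz_on UNIV \<Phi>" and D: "(\<Phi> has_derivative D) (at x)" "inj D" and M: "M \<ge> 0"
  shows "\<exists>\<delta>>0. \<forall>\<Psi>. M-lipschitz_on UNIV \<Psi> \<longrightarrow> (\<forall>y\<in>A. norm (\<Psi> y - \<Phi> y) \<le> \<delta>) \<longrightarrow>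
      hausdorff_measure DIM('m) (\<Psi> ` A) > 0"
proof -
  let ?n = "DIM('m)"
  define v where "v = unit_ball_vol ?n"
  have v: "v > 0" unfolding v_def by simp
  have L: "L \<ge> 0" using lipschitz_on_nonneg[OF \<Phi>] .
  have "linear D" using D(1) by (rule has_derivative_linear)
  from linear_injective_left_inverse[OF this D(2)] obtain T where T: "linear T" "T \<circ> D = id" by blast
  obtain \<kappa> where \<kappa>: "\<kappa> > 0" "\<And>z. norm (T z) \<le> \<kappa> * norm z"
    using linear_bounded_pos[OF T(1)] by blast
  have TD: "T (D z) = z" for z using T(2) by (metis comp_apply id_apply)
  define c where "c = (\<kappa> * (M + 1) * ?n) ^ ?n"
  have c: "c \<ge> 0" using \<kappa> M by (simp add: c_def)
  define \<eta> where "\<eta> = (1 / 2) ^ ?n / (v * c + 1)"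
  have vc: "v * c \<ge> 0" using v c by simp
  have \<eta>: "\<eta> > 0" "v * c * \<eta> < (1 / 2) ^ ?n"
  proof -
    show "\<eta> > 0" unfolding \<eta>_def using vc by (intro divide_pos_pos) auto
    have "v * c * \<eta> = (v * c / (v * c + 1)) * (1 / 2) ^ ?n" by (simp add: \<eta>_def)
    also have "\<dots> < 1 * (1 / 2) ^ ?n" using vc by (intro mult_strict_right_mono) auto
    finally show "v * c * \<eta> < (1 / 2) ^ ?n" by simp
  qed
  define \<epsilon> where "\<epsilon> = 1 / (4 * \<kappa> * (1 + M + L))"
  have MLpos: "1 + M + L > 0" using M L by simp
  have \<epsilon>: "\<epsilon> > 0" "\<kappa> * ((1 + M + L) * \<epsilon>) = 1 / 4"
    using \<kappa> MLpos by (auto simp: \<epsilon>_def)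
  obtain d where d: "d > 0" "\<And>y. norm (y - x) < d \<Longrightarrow> norm (\<Phi> y - \<Phi> x - D (y - x)) \<le> \<epsilon> * norm (y - x)"
    using D(1) \<epsilon>(1) unfolding has_derivative_at_alt by blast
  obtain r1 where r1: "r1 > 0" "\<And>r. 0 < r \<Longrightarrow> r < r1 \<Longrightarrow> measure lebesgue (cball x r - A) \<le> \<eta> * measure lebesgue (cball x r)"
    using x \<eta>(1) unfolding density_point_def by blast
  obtain r2 where r2: "r2 > 0" "\<And>r y. 0 < r \<Longrightarrow> r < r2 \<Longrightarrow> y \<in> cball x r \<Longrightarrow> \<exists>p\<in>A. dist y p \<le> \<epsilon> * r"
    using density_point_imp_dense[OF A x \<epsilon>(1)] by blast
  define r where "r = min d (min r1 r2) / 2"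
  have r: "0 < r" "r < d" "r < r1" "r < r2" using d(1) r1(1) r2(1) by (auto simp: r_def)
  define \<delta> where "\<delta> = r / (4 * \<kappa>)"
  have \<delta>: "\<delta> > 0" "\<kappa> * \<delta> = r / 4" using r \<kappa> by (auto simp: \<delta>_def)
  have "hausdorff_measure ?n (\<Psi> ` A) > 0"
    if \<Psi>: "M-lipschitz_on UNIV \<Psi>" and close: "\<And>y. y \<in> A \<Longrightarrow> norm (\<Psi> y - \<Phi> y) \<le> \<delta>" for \<Psi>
  proof (rule ccontr)
    assume "\<not> ?thesis"
    then have null: "hausdorff_measure ?n (\<Psi> ` A) = 0" by simp
    \<comment> \<open>\<open>f = g \<circ> \<Psi>\<close> is normalized to be close to the identity near \<open>x\<close>\<close>
    define g where "g z = T z - T (\<Phi> x) + x" for z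
    define f where "f y = g (\<Psi> y)" for y
    have g_lip: "\<kappa>-lipschitz_on UNIV g"
    proof (rule lipschitz_onI)
      fix y z
      have "g y - g z = T (y - z)" by (simp add: g_def linear_diff[OF T(1)])
      then show "dist (g y) (g z) \<le> \<kappa> * dist y z" using \<kappa>(2) by (simp add: dist_norm)
    qed (use \<kappa> in simp)
    have f_lip: "dist (f y) (f z) \<le> (\<kappa> * (M + 1)) * dist y z" for y z
    proof -
      have "dist (f y) (f z) \<le> \<kappa> * dist (\<Psi> y) (\<Psi> z)"
        unfolding f_def by (rule lipschitz_onD[OF g_lip]) auto
      also have "\<dots> \<le> \<kappa> * ((M + 1) * dist y z)"
        using lipschitz_onD[OF \<Psi>, of y z] \<kappa>(1)
        by (intro mult_left_mono) (auto simp: distrib_right intro: order.trans)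
      finally show ?thesis by (simp add: mult.assoc)
    qed
    have near: "norm (f y - y) \<le> r / 2" if y: "y \<in> cball x r" for y
    proof -
      obtain p where p: "p \<in> A" "dist y p \<le> \<epsilon> * r" using r2(2)[OF r(1) r(4) y] by blast
      have 1: "norm (\<Psi> y - \<Psi> p) \<le> M * (\<epsilon> * r)"
        using lipschitz_onD[OF \<Psi>, of y p] mult_left_mono[OF p(2) M] by (simp add: dist_norm)
      have 2: "norm (\<Phi> p - \<Phi> y) \<le> L * (\<epsilon> * r)"
        using lipschitz_onD[OF \<Phi>, of y p] mult_left_mono[OF p(2) L] by (simp add: dist_norm norm_minus_commute)
      have yx: "norm (y - x) \<le> r" using y by (simp add: dist_norm norm_minus_commute)
      have 3: "norm (\<Phi> y - \<Phi> x - D (y - x)) \<le> \<epsilon> * r"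
      proof (rule order.trans[OF d(2)])
        show "norm (y - x) < d" using yx r(2) by simp
        show "\<epsilon> * norm (y - x) \<le> \<epsilon> * r" using yx \<epsilon>(1) by simp
      qed
      have 4: "norm (\<Psi> p - \<Phi> p) \<le> \<delta>" using close p(1) by blast
      define e where "e = (\<Psi> y - \<Psi> p) + (\<Psi> p - \<Phi> p) + (\<Phi> p - \<Phi> y) + (\<Phi> y - \<Phi> x - D (y - x))"
      have "norm e \<le> norm (\<Psi> y - \<Psi> p) + norm (\<Psi> p - \<Phi> p) + norm (\<Phi> p - \<Phi> y) + norm (\<Phi> y - \<Phi> x - D (y - x))"
        unfolding e_def by (intro order.trans[OF norm_triangle_ineq] add_mono order.refl)
      also have "\<dots> \<le> M * (\<epsilon> * r) + \<delta> + L * (\<epsilon> * r) + \<epsilon> * r" using 1 2 3 4 by linarith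
      also have "\<dots> = (1 + M + L) * \<epsilon> * r + \<delta>" by (simp add: algebra_simps)
      finally have "norm e \<le> (1 + M + L) * \<epsilon> * r + \<delta>" .
      moreover have "f y - y = T e"
      proof -
        have e_eq: "e = \<Psi> y - \<Phi> x - D (y - x)" unfolding e_def by (simp only: add_diff_eq diff_add_cancel)
        have "T e = T (\<Psi> y) - T (\<Phi> x) - (y - x)" unfolding e_eq linear_diff[OF T(1)] TD ..
        then show ?thesis by (simp add: f_def g_def)
      qed
      ultimately have "norm (f y - y) \<le> \<kappa> * ((1 + M + L) * \<epsilon> * r + \<delta>)"
        using \<kappa>(2)[of e] \<kappa>(1) by (simp add: order.trans mult_left_mono)
      also have "\<dots> = (\<kappa> * ((1 + M + L) * \<epsilon>)) * r + \<kappa> * \<delta>" by (simp add: algebra_simps)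
      also have "\<dots> = r / 2" unfolding \<epsilon>(2) \<delta>(2) by simp
      finally show ?thesis .
    qed
    have surj: "cball x (r / 2) \<subseteq> f ` cball x r"
    proof
      fix z assume z: "z \<in> cball x (r / 2)"
      have "\<exists>y\<in>cball x r. f y = z"
      proof (rule brouwer_surjective_cball[OF _ r(1) z])
        have "(\<kappa> * (M + 1))-lipschitz_on (cball x r) f"
          using f_lip \<kappa> M by (intro lipschitz_onI) auto
        then show "continuous_on (cball x r) f" by (rule lipschitz_on_continuous_on)
        fix z y assume z: "z \<in> cball x (r / 2)" and y: "y \<in> cball x r"
        have "norm (z + (y - f y) - x) \<le> norm (z - x) + norm (f y - y)"
          using norm_triangle_ineq4[of "z - x" "f y - y"] by (simp add: algebra_simps)
        also have "\<dots> \<le> r / 2 + r / 2" using z near[OF y] by (intro add_mono) (auto simp: dist_norm norm_minus_commute)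
        finally show "z + (y - f y) \<in> cball x r" by (simp add: dist_norm norm_minus_commute)
      qed
      then show "z \<in> f ` cball x r" by blast
    qed
    have "emeasure lebesgue (cball x (r / 2)) \<le> ennreal v * hausdorff_measure ?n (cball x (r / 2))"
      unfolding v_def by (rule lebesgue_le_hausdorff_measure) simp
    also have "hausdorff_measure ?n (cball x (r / 2)) \<le> hausdorff_measure ?n (g ` (\<Psi> ` A) \<union> f ` (cball x r - A))"
    proof (rule hausdorff_measure_mono)
      have "f ` cball x r \<subseteq> f ` A \<union> f ` (cball x r - A)" by (auto simp only: image_Un[symmetric])
      moreover have "f ` A = g ` (\<Psi> ` A)" by (simp add: f_def image_image)
      ultimately show "cball x (r / 2) \<subseteq> g ` (\<Psi> ` A) \<union> f ` (cball x r - A)"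
        using surj by (metis order.trans)
    qed
    also have "\<dots> \<le> hausdorff_measure ?n (g ` (\<Psi> ` A)) + hausdorff_measure ?n (f ` (cball x r - A))"
      by (rule hausdorff_measure_Un_le)
    also have "hausdorff_measure ?n (g ` (\<Psi> ` A)) = 0"
      by (rule hausdorff_measure_lipschitz_image_null[OF lipschitz_on_subset[OF g_lip] _ null]) auto
    also have "hausdorff_measure ?n (f ` (cball x r - A)) \<le> ennreal c * emeasure lebesgue (cball x r - A)"
      unfolding c_def using A \<kappa>(1) M f_lip
      by (intro hausdorff_measure_image_le[of _ _ 1]) (auto simp: bounded_diff add_nonneg_pos)
    also have "emeasure lebesgue (cball x r - A) = ennreal (measure lebesgue (cball x r - A))"
      using A by (intro emeasure_eq_measure2) simp
    also have "measure lebesgue (cball x r - A) \<le> \<eta> * (v * r ^ ?n)"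
      using r1(2)[OF r(1) r(3)] r(1) by (simp add: content_cball v_def)
    finally have "emeasure lebesgue (cball x (r / 2)) \<le> ennreal v * (0 + ennreal c * ennreal (\<eta> * (v * r ^ ?n)))"
      by (simp add: mult_left_mono ennreal_leI)
    also have "\<dots> = ennreal (v * (c * (\<eta> * (v * r ^ ?n))))"
      using v c \<eta>(1) r(1) by (simp add: ennreal_mult')
    finally have "v * (r / 2) ^ ?n \<le> v * (c * (\<eta> * (v * r ^ ?n)))"
      using emeasure_cball[of "r / 2" x] r(1) v c \<eta>(1) by (simp add: v_def)
    also have "\<dots> = (v * c * \<eta>) * (v * r ^ ?n)" by simp
    also have "\<dots> < (1 / 2) ^ ?n * (v * r ^ ?n)"
      using \<eta>(2) v r(1) by (intro mult_strict_right_mono) auto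
    also have "\<dots> = v * (r / 2) ^ ?n" by (simp add: power_divide)
    finally show False by simp
  qed
  then show ?thesis using \<delta>(1) by blast
qed

section \<open>Parametrized pieces of rectifiable sets\<close>

text \<open>Let \<open>G\<close> be a Borel hull of \<open>K - S\<close>, where \<open>K\<close> is the compact image of \<open>Q\<close>. The measurability of \<open>S\<close>,
tested with \<open>G\<close>, shows that \<open>S \<inter> G\<close> is null, since \<open>H (K - S)\<close> is finite. The preimage of \<open>K - G\<close> is
then a Borel set that parametrizes almost all of \<open>S \<inter> K\<close>.\<close>

lemma borel_parametrization_of_measurable_part:
  fixes \<phi> :: "'m::euclidean_space \<Rightarrow> 'a::metric_space"
  assumes S: "hausdorff_measurable DIM('m) S" and Q: "closed Q" "bounded Q" and \<phi>: "C-lipschitz_on Q \<phi>"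
  shows "\<exists>A \<in> sets borel. A \<subseteq> Q \<and> \<phi> ` A \<subseteq> S \<and> hausdorff_measure DIM('m) (S \<inter> \<phi> ` Q - \<phi> ` A) = 0"
proof -
  let ?H = "hausdorff_measure DIM('m) :: 'a set \<Rightarrow> ennreal"
  define K where "K = \<phi> ` Q"
  have cont: "continuous_on Q \<phi>" using \<phi> by (rule lipschitz_on_continuous_on)
  have "compact K" unfolding K_def using cont Q by (intro compact_continuous_image) (auto simp: compact_eq_bounded_closed)
  then have K: "K \<in> sets borel" by (intro borel_closed compact_imp_closed)
  have "?H K \<le> ennreal (((C + 1) * DIM('m)) ^ DIM('m)) * emeasure lebesgue Q"
    unfolding K_def
  proof (rule hausdorff_measure_image_le[of _ "C + 1" 1])
    fix x y assume "x \<in> Q" "y \<in> Q"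
    then have "dist (\<phi> x) (\<phi> y) \<le> C * dist x y" by (intro lipschitz_onD[OF \<phi>])
    then show "dist (\<phi> x) (\<phi> y) \<le> (C + 1) * dist x y" by (simp add: distrib_right add_increasing2)
  qed (use Q lipschitz_on_nonneg[OF \<phi>] in auto)
  also have "\<dots> < top"
  proof -
    have "Q \<in> lmeasurable" using Q by (simp add: lmeasurable_compact compact_eq_bounded_closed)
    then show ?thesis by (auto simp: ennreal_mult_less_top fmeasurable_def)
  qed
  finally have K_fin: "?H K < top" .
  have "?H (K - S) < top" using hausdorff_measure_mono[of "K - S" K] K_fin by (meson Diff_subset le_less_trans)
  then obtain G0 where G0: "G0 \<in> sets borel" "K - S \<subseteq> G0" "?H G0 \<le> ?H (K - S)"
    by (rule hausdorff_borel_hull)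
  define G where "G = G0 \<inter> K"
  have G: "G \<in> sets borel" "K - S \<subseteq> G" "G \<subseteq> K" using G0 K by (auto simp: G_def)
  have G_le: "?H G \<le> ?H (K - S)"
    using hausdorff_measure_mono[of G G0] G0(3) unfolding G_def by (meson Int_lower1 order.trans)
  have "?H (S \<inter> G) + ?H ((UNIV - S) \<inter> G) = ?H G"
    using S unfolding hausdorff_measurable_def lambda_system_def by auto
  moreover have "(UNIV - S) \<inter> G = K - S" using G by blast
  ultimately have "?H (K - S) + ?H (S \<inter> G) \<le> ?H (K - S) + 0" using G_le by (simp add: add.commute)
  then have "?H (S \<inter> G) \<le> 0"
    using \<open>?H (K - S) < top\<close> unfolding ennreal_add_left_cancel_le by auto
  then have null: "?H (S \<inter> G) = 0" by simp
  define A where "A = {x \<in> Q. \<phi> x \<notin> G}"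
  have "A \<in> sets borel"
  proof -
    have "\<phi> -` (- G) \<inter> space (restrict_space borel Q) \<in> sets (restrict_space borel Q)"
      using borel_measurable_continuous_on_restrict[OF cont] by (rule measurable_sets) (use G in simp)
    moreover have "\<phi> -` (- G) \<inter> space (restrict_space borel Q) = A"
      by (auto simp: A_def space_restrict_space)
    ultimately show ?thesis
      using Q(1) by (subst (asm) sets_restrict_space_iff) auto
  qed
  moreover have "A \<subseteq> Q" "\<phi> ` A \<subseteq> S" using G(2) by (auto simp: A_def K_def)
  moreover have "S \<inter> \<phi> ` Q - \<phi> ` A \<subseteq> S \<inter> G" by (auto simp: A_def)
  then have "?H (S \<inter> \<phi> ` Q - \<phi> ` A) = 0" using null hausdorff_measure_mono by (metis le_zero_eq)
  ultimately show ?thesis by blast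
qed

text \<open>The domains in the definition of rectifiability are arbitrary sets. Completeness of the space allows
extending the Lipschitz maps to their closures, which are then cut into bounded closed sets; countably many
Borel parametrizations cover \<open>S\<close> up to a null set, and null sets stay null under \<open>f\<close>.\<close>

theorem rectifiable_parametrized_piece:
  fixes S :: "'a::complete_space set" and f :: "'a \<Rightarrow> 'y::metric_space"
  assumes S: "rectifiable TYPE('n::finite) S" and f: "L-lipschitz_on UNIV f"
    and pos: "hausdorff_measure CARD('n) (f ` S) > 0"
  shows "\<exists>(A :: (real^'n) set) \<phi> C. A \<in> sets borel \<and> bounded A \<and> C-lipschitz_on A \<phi> \<and> \<phi> ` A \<subseteq> S \<and>
     hausdorff_measure CARD('n) (f ` \<phi> ` A) > 0"
proof (rule ccontr)
  assume contra: "\<not> ?thesis"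
  let ?n = "real CARD('n)"
  have n: "?n > 0" by simp
  have null_f: "hausdorff_measure ?n (f ` E) = 0" if "hausdorff_measure ?n E = 0" for E
    using hausdorff_measure_lipschitz_image_null[OF lipschitz_on_subset[OF f] n that] by auto
  obtain A :: "nat \<Rightarrow> (real^'n) set" and \<phi>0 where A: "\<And>i. \<exists>C. C-lipschitz_on (A i) (\<phi>0 i)"
    "hausdorff_measure ?n (S - (\<Union>i. \<phi>0 i ` A i)) = 0" and meas: "hausdorff_measurable ?n S"
    using S unfolding rectifiable_def by blast
  obtain C :: "nat \<Rightarrow> real" where C: "\<And>i. (C i)-lipschitz_on (A i) (\<phi>0 i)" using A(1) by metis
  have "\<exists>g. (C i)-lipschitz_on (closure (A i)) g \<and> (\<forall>x\<in>A i. g x = \<phi>0 i x)" for i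
    by (rule lipschitz_extend_closure[OF C])
  then obtain \<phi> where \<phi>: "\<And>i. (C i)-lipschitz_on (closure (A i)) (\<phi> i)" "\<And>i x. x \<in> A i \<Longrightarrow> \<phi> i x = \<phi>0 i x"
    by metis
  define Q where "Q i k = closure (A i) \<inter> cball 0 (real k)" for i k :: nat
  have Q: "closed (Q i k)" "bounded (Q i k)" "(C i)-lipschitz_on (Q i k) (\<phi> i)" for i k
    using lipschitz_on_subset[OF \<phi>(1)] by (auto simp: Q_def bounded_Int)
  have piece: "hausdorff_measure ?n (f ` (S \<inter> \<phi> i ` Q i k)) = 0" for i k
  proof -
    have meas': "hausdorff_measurable DIM(real^'n) S" using meas by simp
    obtain B where B: "B \<in> sets borel" "B \<subseteq> Q i k" "\<phi> i ` B \<subseteq> S"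
      "hausdorff_measure ?n (S \<inter> \<phi> i ` Q i k - \<phi> i ` B) = 0"
      using borel_parametrization_of_measurable_part[OF meas' Q(1,2,3)[of i k]] by auto
    have "bounded B" "(C i)-lipschitz_on B (\<phi> i)"
      using bounded_subset[OF Q(2) B(2)] lipschitz_on_subset[OF Q(3) B(2)] .
    then have "hausdorff_measure ?n (f ` \<phi> i ` B) = 0"
      using contra B by (meson not_gr_zero)
    moreover have "hausdorff_measure ?n (f ` (S \<inter> \<phi> i ` Q i k - \<phi> i ` B)) = 0"
      by (rule null_f[OF B(4)])
    moreover have "f ` (S \<inter> \<phi> i ` Q i k) \<subseteq> f ` \<phi> i ` B \<union> f ` (S \<inter> \<phi> i ` Q i k - \<phi> i ` B)" by blast
    ultimately show ?thesis
      by - (rule hausdorff_measure_null_subset_Un, assumption+)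
  qed
  have "S \<subseteq> (S - (\<Union>i. \<phi>0 i ` A i)) \<union> (\<Union>i. \<Union>k. S \<inter> \<phi> i ` Q i k)"
  proof
    fix x assume x: "x \<in> S"
    show "x \<in> (S - (\<Union>i. \<phi>0 i ` A i)) \<union> (\<Union>i. \<Union>k. S \<inter> \<phi> i ` Q i k)"
    proof (cases "x \<in> (\<Union>i. \<phi>0 i ` A i)")
      case True
      then obtain i y where y: "y \<in> A i" "x = \<phi>0 i y" by blast
      obtain k where "norm y \<le> real k" using real_arch_simple by blast
      then have "y \<in> Q i k" using y(1) closure_subset by (auto simp: Q_def)
      moreover have "x = \<phi> i y" using y \<phi>(2) by simp
      ultimately have "x \<in> S \<inter> \<phi> i ` Q i k" using x by blast
      then show ?thesis by blast
    qed (use x in blast)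
  qed
  from image_mono[OF this, of f]
  have "f ` S \<subseteq> f ` (S - (\<Union>i. \<phi>0 i ` A i)) \<union> (\<Union>i. \<Union>k. f ` (S \<inter> \<phi> i ` Q i k))"
    by (simp only: image_Un image_UN)
  moreover have "hausdorff_measure ?n (\<Union>i. \<Union>k. f ` (S \<inter> \<phi> i ` Q i k)) = 0"
    by (intro hausdorff_measure_UN_null piece)
  moreover have "hausdorff_measure ?n (f ` (S - (\<Union>i. \<phi>0 i ` A i))) = 0"
    by (rule null_f[OF A(2)])
  ultimately have "hausdorff_measure ?n (f ` S) = 0"
    by - (rule hausdorff_measure_null_subset_Un, assumption+)
  then show False using pos by simp
qed

section \<open>Linear algebra in finite dimension\<close>

text \<open>The determinant is a polynomial in \<open>s\<close> that does not vanish at 0.\<close>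

lemma finite_singular_pencil:
  fixes A T :: "real^'n^'n"
  assumes T: "det T \<noteq> 0"
  shows "finite {s. det (s *\<^sub>R A + T) = 0}"
proof -
  define p :: "real poly" where
    "p = (\<Sum>\<sigma> | \<sigma> permutes (UNIV :: 'n set). [:of_int (sign \<sigma>):] * (\<Prod>i\<in>UNIV. [: T $ i $ \<sigma> i, A $ i $ \<sigma> i :]))"
  have p: "poly p s = det (s *\<^sub>R A + T)" for s
    by (simp add: p_def det_def poly_sum poly_prod algebra_simps)
  have "poly p 0 \<noteq> 0" using T by (simp add: p)
  then have "p \<noteq> 0" by auto
  then have "finite {s. poly p s = 0}" by (rule poly_roots_finite)
  then show ?thesis by (simp add: p)
qed

text \<open>Compactness of the coefficient vectors of \<open>l1\<close>-norm 1. As the cardinality of \<open>B\<close> is not that of a fixed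
type, these vectors live in the product topology on all functions, supported on \<open>B\<close>.\<close>

lemma finite_dim_coordinates_bounded:
  fixes B :: "'v::real_normed_vector set"
  assumes B: "finite B" "independent B"
  shows "\<exists>\<kappa>>0. \<forall>c. \<kappa> * (\<Sum>b\<in>B. \<bar>c b\<bar>) \<le> norm (\<Sum>b\<in>B. c b *\<^sub>R b)"
proof (cases "B = {}")
  case False
  define X where "X = (\<Pi>\<^sub>E b\<in>UNIV. if b \<in> B then {-1..1::real} else {0})"
  have "compactin (product_topology (\<lambda>_::'v. euclideanreal) UNIV) X"
    unfolding X_def compactin_PiE by (auto simp: compact_Icc)
  then have X: "compact X" by (simp add: euclidean_product_topology)
  have co: "continuous_on UNIV (\<lambda>c::'v \<Rightarrow> real. c b)" for b by (rule continuous_on_product_coordinates)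
  have "closed {c::'v \<Rightarrow> real. (\<Sum>b\<in>B. \<bar>c b\<bar>) = 1}"
    by (intro closed_Collect_eq continuous_intros co)
  then have Y: "compact (X \<inter> {c. (\<Sum>b\<in>B. \<bar>c b\<bar>) = 1})" using X by (rule compact_Int_closed[rotated])
  define Y where "Y = X \<inter> {c. (\<Sum>b\<in>B. \<bar>c b\<bar>) = 1}"
  obtain b0 where b0: "b0 \<in> B" using False by blast
  have "(\<lambda>b. if b = b0 then 1 else 0) \<in> Y"
    using b0 B(1) by (auto simp: Y_def X_def if_distrib[of abs] cong: if_cong)
  then have "Y \<noteq> {}" by blast
  have "continuous_on Y (\<lambda>c. norm (\<Sum>b\<in>B. c b *\<^sub>R b))"
    by (intro continuous_intros continuous_on_subset[OF co]) auto
  then obtain c0 where c0: "c0 \<in> Y" "\<And>c. c \<in> Y \<Longrightarrow> norm (\<Sum>b\<in>B. c0 b *\<^sub>R b) \<le> norm (\<Sum>b\<in>B. c b *\<^sub>R b)"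
    using continuous_attains_inf[OF _ \<open>Y \<noteq> {}\<close>] Y unfolding Y_def by blast
  define \<kappa> where "\<kappa> = norm (\<Sum>b\<in>B. c0 b *\<^sub>R b)"
  have "\<kappa> > 0"
  proof -
    have "\<kappa> \<noteq> 0"
    proof
      assume "\<kappa> = 0"
      then have "\<forall>b\<in>B. c0 b = 0"
        using independentD[OF B(2,1) order_refl, of c0] by (simp add: \<kappa>_def)
      then show False using c0(1) by (simp add: Y_def)
    qed
    then show ?thesis by (simp add: \<kappa>_def)
  qed
  moreover have "\<kappa> * (\<Sum>b\<in>B. \<bar>c b\<bar>) \<le> norm (\<Sum>b\<in>B. c b *\<^sub>R b)" for c
  proof (cases "(\<Sum>b\<in>B. \<bar>c b\<bar>) = 0")
    case False
    define \<sigma> where "\<sigma> = (\<Sum>b\<in>B. \<bar>c b\<bar>)"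
    have \<sigma>: "\<sigma> > 0" using False sum_nonneg[of B "\<lambda>b. \<bar>c b\<bar>"] by (simp add: \<sigma>_def less_le)
    define c' where "c' b = (if b \<in> B then c b / \<sigma> else 0)" for b
    have le: "\<bar>c b\<bar> \<le> \<sigma>" if "b \<in> B" for b
      unfolding \<sigma>_def using B(1) that by (intro member_le_sum) auto
    have "(\<Sum>b\<in>B. \<bar>c' b\<bar>) = (\<Sum>b\<in>B. \<bar>c b\<bar> / \<sigma>)" using \<sigma> by (intro sum.cong) (auto simp: c'_def)
    also have "\<dots> = 1" using \<sigma> by (simp add: sum_divide_distrib[symmetric] \<sigma>_def)
    finally have sum1: "(\<Sum>b\<in>B. \<bar>c' b\<bar>) = 1" .
    have "c' b \<in> (if b \<in> B then {-1..1} else {0})" for b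
    proof (cases "b \<in> B")
      case True
      then have "\<bar>c b / \<sigma>\<bar> \<le> 1" using le[of b] \<sigma> by (simp add: abs_divide)
      then show ?thesis using True unfolding abs_le_iff by (simp add: c'_def)
    qed (simp add: c'_def)
    then have "c' \<in> Y" using sum1 by (simp add: Y_def X_def PiE_UNIV_domain Pi_iff)
    then have "\<kappa> \<le> norm (\<Sum>b\<in>B. c' b *\<^sub>R b)" using c0(2) by (simp add: \<kappa>_def)
    also have "(\<Sum>b\<in>B. c' b *\<^sub>R b) = (1 / \<sigma>) *\<^sub>R (\<Sum>b\<in>B. c b *\<^sub>R b)"
      unfolding scaleR_sum_right by (intro sum.cong) (auto simp: c'_def)
    also have "norm \<dots> = norm (\<Sum>b\<in>B. c b *\<^sub>R b) / \<sigma>" using \<sigma> by simp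
    finally show ?thesis using \<sigma> by (simp add: \<sigma>_def[symmetric] field_simps)
  qed simp
  ultimately show ?thesis by blast
qed (auto intro: exI[of _ 1])

lemma linear_finite_dim_bounded:
  fixes F :: "'v::real_normed_vector \<Rightarrow> 'w::real_normed_vector" and B :: "'v set"
  assumes B: "finite B" "independent B" "span B = UNIV" and F: "linear F"
  shows "\<exists>K\<ge>0. K-lipschitz_on UNIV F"
proof -
  obtain \<kappa> where \<kappa>: "\<kappa> > 0" "\<And>c. \<kappa> * (\<Sum>b\<in>B. \<bar>c b\<bar>) \<le> norm (\<Sum>b\<in>B. c b *\<^sub>R b)"
    using finite_dim_coordinates_bounded[OF B(1,2)] by blast
  define m where "m = (\<Sum>b\<in>B. norm (F b))"
  have m: "m \<ge> 0" by (simp add: m_def sum_nonneg)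
  have bound: "norm (F v) \<le> (m / \<kappa>) * norm v" for v
  proof -
    have "v \<in> span B" using B(3) by simp
    then obtain c where c: "v = (\<Sum>b\<in>B. c b *\<^sub>R b)" using span_finite[OF B(1)] by auto
    have "norm (F v) = norm (\<Sum>b\<in>B. c b *\<^sub>R F b)" unfolding c by (simp add: linear_sum[OF F] linear_cmul[OF F])
    also have "\<dots> \<le> (\<Sum>b\<in>B. norm (c b *\<^sub>R F b))" by (rule norm_sum)
    also have "\<dots> \<le> (\<Sum>b\<in>B. \<bar>c b\<bar> * m)"
    proof (rule sum_mono)
      fix b assume "b \<in> B"
      then have "norm (F b) \<le> m" unfolding m_def using B(1) by (intro member_le_sum) auto
      then show "norm (c b *\<^sub>R F b) \<le> \<bar>c b\<bar> * m" by (simp add: mult_left_mono)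
    qed
    also have "\<dots> = (m / \<kappa>) * (\<kappa> * (\<Sum>b\<in>B. \<bar>c b\<bar>))" using \<kappa>(1) by (simp add: sum_distrib_right[symmetric])
    also have "\<dots> \<le> (m / \<kappa>) * norm v" using \<kappa> m unfolding c by (intro mult_left_mono) auto
    finally show ?thesis .
  qed
  have "(m / \<kappa>)-lipschitz_on UNIV F"
  proof (rule lipschitz_onI)
    fix x y show "dist (F x) (F y) \<le> (m / \<kappa>) * dist x y"
      using bound[of "x - y"] by (simp add: dist_norm linear_diff[OF F])
  qed (use m \<kappa> in simp)
  then show ?thesis using m \<kappa>(1) by (intro exI[of _ "m / \<kappa>"]) simp
qed

text \<open>A linear projection onto an \<open>n\<close>-dimensional coordinate space, as a substitute for an inner product on \<open>V\<close>.\<close>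

lemma finite_dim_biorthogonal:
  assumes fin: "\<exists>B :: 'v::real_normed_vector set. finite B \<and> span B = UNIV"
    and dim: "dim (UNIV :: 'v set) \<ge> CARD('n::finite)"
  shows "\<exists>(\<beta> :: 'n \<Rightarrow> 'v) (\<pi> :: 'v \<Rightarrow> real^'n) K.
    linear \<pi> \<and> K-lipschitz_on UNIV \<pi> \<and> (\<forall>j. \<pi> (\<beta> j) = axis j 1)"
proof -
  obtain B0 :: "'v set" where B0: "finite B0" "span B0 = UNIV" using fin by blast
  obtain B where B: "B \<subseteq> B0" "independent B" "B0 \<subseteq> span B"
    using maximal_independent_subset by blast
  have finB: "finite B" using B(1) B0(1) by (rule finite_subset)
  have spanB: "span B = UNIV"
    using span_minimal[OF B(3) subspace_span] B0(2) by blast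
  have "card B = dim (UNIV :: 'v set)" using dim_span_eq_card_independent[OF B(2)] spanB by simp
  then have "CARD('n) \<le> card B" using dim by simp
  then obtain \<beta> :: "'n \<Rightarrow> 'v" where \<beta>: "inj \<beta>" "range \<beta> \<subseteq> B"
    using card_le_inj[of "UNIV :: 'n set" B] finB by auto
  obtain \<pi> :: "'v \<Rightarrow> real^'n" where \<pi>: "linear \<pi>" "\<forall>b\<in>B. \<pi> b = axis (inv \<beta> b) 1"
    using linear_independent_extend[OF B(2), of "\<lambda>b. axis (inv \<beta> b) 1"] by blast
  have "\<pi> (\<beta> j) = axis j 1" for j
  proof -
    have "\<beta> j \<in> B" using \<beta>(2) by blast
    then show ?thesis using \<pi>(2) inv_f_f[OF \<beta>(1)] by metis
  qed
  moreover obtain K where "K-lipschitz_on UNIV \<pi>"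
    using linear_finite_dim_bounded[OF finB B(2) spanB \<pi>(1)] by blast
  ultimately show ?thesis using \<pi>(1) by blast
qed

section \<open>Openness and density\<close>

lemma exists_outside_negligible:
  assumes "\<not> negligible W" "negligible N"
  shows "\<exists>x\<in>W. x \<notin> N"
  using assms negligible_subset by blast

text \<open>The chart \<open>U\<close> of \<open>f \<circ> \<phi>\<close> consists of distance functions in the target space, so the same functions applied
to \<open>g \<circ> \<phi>\<close> give a map that differs from \<open>U\<close> by at most the uniform distance of \<open>f\<close> and \<open>g\<close> in each
coordinate, with the same Lipschitz constant.\<close>

theorem openin_positive_image:
  fixes S :: "'a::complete_space set" and L :: real
  assumes S: "rectifiable TYPE('n::finite) S"
  shows "openin (top_of_set (Lip L))
           {f \<in> (Lip L :: ('a \<Rightarrow>\<^sub>C 'v::metric_space) set).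
              hausdorff_measure (real CARD('n)) (apply_bcontfun f ` S) > 0}"
  unfolding openin_euclidean_subtopology_iff
proof (intro conjI ballI)
  fix f assume "f \<in> {f \<in> (Lip L :: ('a \<Rightarrow>\<^sub>C 'v) set). hausdorff_measure (real CARD('n)) (apply_bcontfun f ` S) > 0}"
  then have f: "L-lipschitz_on UNIV (apply_bcontfun f)" and pos: "hausdorff_measure (real CARD('n)) (apply_bcontfun f ` S) > 0"
    by (auto simp: Lip_def)
  obtain A :: "(real^'n) set" and \<phi> C where A: "A \<in> sets borel" "bounded A" "C-lipschitz_on A \<phi>" "\<phi> ` A \<subseteq> S"
    "hausdorff_measure CARD('n) (apply_bcontfun f ` \<phi> ` A) > 0"
    using rectifiable_parametrized_piece[OF S f pos] by blast
  have Aleb: "A \<in> sets lebesgue" using A(1) by simp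
  define M where "M = L * C"
  have comp: "M-lipschitz_on A (\<lambda>y. apply_bcontfun g (\<phi> y))" if "L-lipschitz_on UNIV (apply_bcontfun g)" for g :: "'a \<Rightarrow>\<^sub>C 'v"
    unfolding M_def by (rule lipschitz_on_compose2[OF A(3) lipschitz_on_subset[OF that]]) simp
  have M: "M \<ge> 0" by (rule lipschitz_on_nonneg[OF comp[OF f]])
  have pos': "hausdorff_measure CARD('n) ((\<lambda>y. apply_bcontfun f (\<phi> y)) ` A) > 0"
    using A(5) by (simp add: image_image)
  obtain p :: "'n \<Rightarrow> 'v" and U where U: "\<And>j. M-lipschitz_on UNIV (\<lambda>x. U x $ j)"
    "\<And>x j. x \<in> A \<Longrightarrow> U x $ j = dist (p j) (apply_bcontfun f (\<phi> x))"
    "\<not> negligible {x \<in> A. \<exists>D. (U has_derivative D) (at x) \<and> inj D}"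
    using regular_distance_chart[OF Aleb A(2) comp[OF f] pos'] by blast
  obtain x D where x: "x \<in> A" "(U has_derivative D) (at x)" "inj D" "density_point A x"
    using exists_outside_negligible[OF U(3) negligible_not_density_point[OF Aleb]] by blast
  define M' where "M' = real CARD('n) * M"
  have M': "M' \<ge> 0" using M by (simp add: M'_def)
  have U_lip: "M'-lipschitz_on UNIV U" unfolding M'_def using U(1) by (rule lipschitz_on_vec)
  obtain \<delta> where \<delta>: "\<delta> > 0" "\<And>\<Psi>. M'-lipschitz_on UNIV \<Psi> \<Longrightarrow> (\<And>y. y \<in> A \<Longrightarrow> norm (\<Psi> y - U y) \<le> \<delta>) \<Longrightarrow>
      hausdorff_measure DIM(real^'n) (\<Psi> ` A) > 0"
    using stable_positive_image[OF Aleb x(4) U_lip x(2,3) M'] by blast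
  define e where "e = \<delta> / real CARD('n)"
  show "\<exists>e>0. \<forall>g\<in>Lip L. dist g f < e \<longrightarrow> g \<in> {f \<in> Lip L. hausdorff_measure (real CARD('n)) (apply_bcontfun f ` S) > 0}"
  proof (intro exI[of _ e] conjI ballI impI)
    show "e > 0" using \<delta>(1) by (simp add: e_def)
    fix g :: "'a \<Rightarrow>\<^sub>C 'v" assume "g \<in> Lip L" and near: "dist g f < e"
    then have g: "L-lipschitz_on UNIV (apply_bcontfun g)" by (simp add: Lip_def)
    have "\<exists>u. M-lipschitz_on UNIV u \<and> (\<forall>y\<in>A. u y = dist (p j) (apply_bcontfun g (\<phi> y)))" for j
    proof (rule lipschitz_real_extension)
      have "(1 * M)-lipschitz_on A (\<lambda>y. dist (p j) (apply_bcontfun g (\<phi> y)))"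
        by (rule lipschitz_on_compose2[OF comp[OF g] lipschitz_on_dist])
      then show "M-lipschitz_on A (\<lambda>y. dist (p j) (apply_bcontfun g (\<phi> y)))" by simp
    qed
    then obtain u where u: "\<And>j. M-lipschitz_on UNIV (u j)" "\<And>j y. y \<in> A \<Longrightarrow> u j y = dist (p j) (apply_bcontfun g (\<phi> y))"
      by metis
    define \<Psi> where "\<Psi> y = (\<chi> j. u j y)" for y
    define \<psi> where "\<psi> v = (\<chi> j. dist (p j) v)" for v
    have "hausdorff_measure DIM(real^'n) (\<Psi> ` A) > 0"
    proof (rule \<delta>(2))
      show "M'-lipschitz_on UNIV \<Psi>"
        unfolding M'_def by (rule lipschitz_on_vec) (simp add: \<Psi>_def u(1))
      fix y assume y: "y \<in> A"
      have "norm (\<Psi> y - U y) \<le> (\<Sum>j\<in>UNIV. \<bar>(\<Psi> y - U y) $ j\<bar>)" by (rule norm_le_l1_cart)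
      also have "\<dots> \<le> (\<Sum>j\<in>(UNIV :: 'n set). e)"
      proof (rule sum_mono)
        fix j
        have "\<bar>(\<Psi> y - U y) $ j\<bar> = dist (dist (p j) (apply_bcontfun g (\<phi> y))) (dist (p j) (apply_bcontfun f (\<phi> y)))"
          using y u(2) U(2) by (simp add: \<Psi>_def dist_real_def)
        also have "\<dots> \<le> 1 * dist (apply_bcontfun g (\<phi> y)) (apply_bcontfun f (\<phi> y))"
          by (rule lipschitz_onD[OF lipschitz_on_dist[of UNIV]]) auto
        also have "\<dots> \<le> e" using dist_bounded[of g "\<phi> y" f] near by linarith
        finally show "\<bar>(\<Psi> y - U y) $ j\<bar> \<le> e" .
      qed
      also have "\<dots> = \<delta>" by (simp add: e_def)
      finally show "norm (\<Psi> y - U y) \<le> \<delta>" .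
    qed
    moreover have "\<Psi> ` A = \<psi> ` (apply_bcontfun g ` \<phi> ` A)"
    proof -
      have "\<Psi> y = \<psi> (apply_bcontfun g (\<phi> y))" if "y \<in> A" for y
        using u(2)[OF that] by (simp add: \<Psi>_def \<psi>_def)
      then show ?thesis by (auto simp: image_image)
    qed
    ultimately have \<psi>_pos: "hausdorff_measure CARD('n) (\<psi> ` (apply_bcontfun g ` \<phi> ` A)) > 0" by simp
    have \<psi>: "(real CARD('n) * 1)-lipschitz_on T \<psi>" for T
      by (rule lipschitz_on_vec) (simp add: \<psi>_def lipschitz_on_dist)
    have "hausdorff_measure CARD('n) (apply_bcontfun g ` \<phi> ` A) \<noteq> 0"
      using \<psi>_pos hausdorff_measure_lipschitz_image_null[OF \<psi>, of "real CARD('n)"] by auto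
    moreover have "hausdorff_measure CARD('n) (apply_bcontfun g ` \<phi> ` A) \<le> hausdorff_measure CARD('n) (apply_bcontfun g ` S)"
      using A(4) by (intro hausdorff_measure_mono image_mono)
    ultimately have "hausdorff_measure CARD('n) (apply_bcontfun g ` S) > 0"
      by (metis le_zero_eq not_gr_zero)
    then show "g \<in> {f \<in> Lip L. hausdorff_measure (real CARD('n)) (apply_bcontfun f ` S) > 0}"
      using \<open>g \<in> Lip L\<close> by simp
  qed
qed auto

text \<open>The chart is now made of distance functions on the domain space. They are unbounded in general, so
they are truncated at a level \<open>R\<close> that is not reached on \<open>\<phi> ` A\<close>. Shrinking \<open>f\<close> by \<open>1 - \<eta>\<close> makes room in
the Lipschitz constant for the term \<open>t *\<^sub>R G\<close>.\<close>

theorem dense_positive_image: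
  fixes S :: "'a::complete_space set" and L :: real
  assumes S: "rectifiable TYPE('n::finite) S"
    and S_pos: "hausdorff_measure (real CARD('n)) S > 0"
    and fin: "\<exists>B :: 'v::real_normed_vector set. finite B \<and> span B = UNIV"
    and dim: "dim (UNIV :: 'v set) \<ge> CARD('n)"
    and L: "L > 0"
  shows "(Lip L :: ('a \<Rightarrow>\<^sub>C 'v) set) \<subseteq>
           closure {f \<in> Lip L. hausdorff_measure (real CARD('n)) (apply_bcontfun f ` S) > 0}"
proof
  fix f0 :: "'a \<Rightarrow>\<^sub>C 'v" assume "f0 \<in> Lip L"
  define f where "f = apply_bcontfun f0"
  have f: "L-lipschitz_on UNIV f" using \<open>f0 \<in> Lip L\<close> by (simp add: Lip_def f_def)
  obtain b where b: "\<And>x. norm (f x) \<le> b"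
    using bounded_apply_bcontfun[of f0] unfolding f_def bounded_iff by auto
  have b0: "b \<ge> 0" using b norm_ge_zero order.trans by blast
  have id: "1-lipschitz_on UNIV (\<lambda>x::'a. x)" by (rule lipschitz_on_id)
  obtain A :: "(real^'n) set" and \<phi> C where A: "A \<in> sets borel" "bounded A" "C-lipschitz_on A \<phi>" "\<phi> ` A \<subseteq> S"
    "hausdorff_measure CARD('n) (\<phi> ` A) > 0"
    using rectifiable_parametrized_piece[OF S id] S_pos by (auto simp: image_image)
  have Aleb: "A \<in> sets lebesgue" using A(1) by simp
  have C: "C \<ge> 0" by (rule lipschitz_on_nonneg[OF A(3)])
  obtain p :: "'n \<Rightarrow> 'a" and U where U: "\<And>j. C-lipschitz_on UNIV (\<lambda>x. U x $ j)"
    "\<And>x j. x \<in> A \<Longrightarrow> U x $ j = dist (p j) (\<phi> x)"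
    "\<not> negligible {x \<in> A. \<exists>D. (U has_derivative D) (at x) \<and> inj D}"
    using regular_distance_chart[OF Aleb A(2,3,5)] by blast
  obtain \<beta> :: "'n \<Rightarrow> 'v" and \<pi> :: "'v \<Rightarrow> real^'n" and K
    where \<pi>: "linear \<pi>" "K-lipschitz_on UNIV \<pi>" "\<And>j. \<pi> (\<beta> j) = axis j 1"
    using finite_dim_biorthogonal[OF fin dim] by blast
  have K: "K \<ge> 0" by (rule lipschitz_on_nonneg[OF \<pi>(2)])
  define M where "M = K * (L * C)"
  have M: "M \<ge> 0" using K L C by (simp add: M_def)
  have "\<exists>u. M-lipschitz_on UNIV u \<and> (\<forall>y\<in>A. u y = \<pi> (f (\<phi> y)) $ j)" for j
  proof (rule lipschitz_real_extension, rule lipschitz_onI)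
    fix y z assume yz: "y \<in> A" "z \<in> A"
    have "dist (\<pi> (f (\<phi> y)) $ j) (\<pi> (f (\<phi> z)) $ j) \<le> dist (\<pi> (f (\<phi> y))) (\<pi> (f (\<phi> z)))"
      by (rule dist_vec_nth_le)
    also have "\<dots> \<le> K * dist (f (\<phi> y)) (f (\<phi> z))" by (rule lipschitz_onD[OF \<pi>(2)]) auto
    also have "\<dots> \<le> K * (L * dist (\<phi> y) (\<phi> z))" using K by (intro mult_left_mono lipschitz_onD[OF f]) auto
    also have "\<dots> \<le> K * (L * (C * dist y z))" using K L yz by (intro mult_left_mono lipschitz_onD[OF A(3)]) auto
    finally show "dist (\<pi> (f (\<phi> y)) $ j) (\<pi> (f (\<phi> z)) $ j) \<le> M * dist y z" by (simp add: M_def mult.assoc)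
  qed (rule M)
  then obtain u where u: "\<And>j. M-lipschitz_on UNIV (u j)" "\<And>j y. y \<in> A \<Longrightarrow> u j y = \<pi> (f (\<phi> y)) $ j"
    by metis
  define F where "F y = (\<chi> j. u j y)" for y
  have F_A: "F y = \<pi> (f (\<phi> y))" if "y \<in> A" for y using u(2)[OF that] by (simp add: F_def vec_eq_iff)
  have "negligible (\<Union>j. {x. \<not> u j differentiable (at x)})"
    using rademacher[OF u(1)] by (intro negligible_countable_Union countable_image countable_finite) auto
  then have "negligible ((\<Union>j. {x. \<not> u j differentiable (at x)}) \<union> {x \<in> A. \<not> density_point A x})"
    using negligible_not_density_point[OF Aleb] by (rule negligible_Un)
  from exists_outside_negligible[OF U(3) this] obtain x D where x: "x \<in> A" "(U has_derivative D) (at x)" "inj D"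
    "density_point A x" "\<And>j. u j differentiable (at x)" by blast
  obtain E0 where E0: "\<And>j. (u j has_derivative E0 j) (at x)" using x(5) unfolding differentiable_def by metis
  define E where "E v = (\<chi> j. E0 j v)" for v
  have E: "(F has_derivative E) (at x)"
  proof (rule has_derivative_componentwise_within[THEN iffD2, rule_format])
    fix b :: "real^'n" assume "b \<in> Basis"
    then obtain j where b: "b = axis j 1" by (auto simp: Basis_vec_def)
    show "((\<lambda>x. F x \<bullet> b) has_derivative (\<lambda>v. E v \<bullet> b)) (at x)"
      using E0[of j] by (simp add: b F_def E_def inner_axis)
  qed
  have lin: "linear E" "linear D" using E x(2) has_derivative_linear by blast+
  show "f0 \<in> closure {f \<in> Lip L. hausdorff_measure (real CARD('n)) (apply_bcontfun f ` S) > 0}"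
    unfolding closure_approachable
  proof (intro allI impI)
    fix e :: real assume e: "e > 0"
    have cancel: "(c / d) * d = c" if "d > 0" for c d :: real using that by simp
    define \<eta> where "\<eta> = min (1 / 2) ((e / 4) / (b + 1))"
    have \<eta>: "\<eta> > 0" "\<eta> < 1" "\<eta> * b \<le> e / 4"
    proof -
      show "\<eta> > 0" "\<eta> < 1" using e b0 by (auto simp: \<eta>_def)
      have "\<eta> * b \<le> ((e / 4) / (b + 1)) * (b + 1)" using e b0 by (intro mult_mono) (auto simp: \<eta>_def)
      also have "\<dots> = e / 4" using b0 by (intro cancel) simp
      finally show "\<eta> * b \<le> e / 4" .
    qed
    obtain r where r: "\<And>y. y \<in> A \<Longrightarrow> dist x y \<le> r" using A(2) bounded_any_center[of A x] by auto
    define a0 R0 where "a0 = \<phi> x" and "R0 = C * r"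
    have R0: "dist a0 (\<phi> y) \<le> R0" if y: "y \<in> A" for y
      unfolding a0_def R0_def using lipschitz_onD[OF A(3) x(1) y] mult_left_mono[OF r[OF y] C] by linarith
    define R where "R = \<bar>R0\<bar> + (\<Sum>j\<in>UNIV. dist a0 (p j))"
    have R: "R \<ge> 0" by (simp add: R_def sum_nonneg)
    have dR: "dist (p j) (\<phi> y) \<le> R" if "y \<in> A" for y j
    proof -
      have "dist a0 (p j) \<le> (\<Sum>j\<in>UNIV. dist a0 (p j))" by (rule member_le_sum) auto
      then show ?thesis using dist_triangle3[of "p j" "\<phi> y" a0] R0[OF that] by (simp add: R_def)
    qed
    define \<psi> where "\<psi> j z = min (dist (p j) z) R" for j z
    have \<psi>: "\<bar>\<psi> j z\<bar> \<le> R" "\<bar>\<psi> j z - \<psi> j z'\<bar> \<le> dist z z'" for j z z'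
    proof -
      show "\<bar>\<psi> j z\<bar> \<le> R" using R by (simp add: \<psi>_def)
      have "dist (dist (p j) z) (dist (p j) z') \<le> 1 * dist z z'" by (rule lipschitz_onD[OF lipschitz_on_dist[of UNIV]]) auto
      then show "\<bar>\<psi> j z - \<psi> j z'\<bar> \<le> dist z z'" unfolding \<psi>_def dist_real_def by linarith
    qed
    define G where "G z = (\<Sum>j\<in>UNIV. \<psi> j z *\<^sub>R \<beta> j)" for z
    define q where "q = (\<Sum>j\<in>UNIV. norm (\<beta> j))"
    have q: "q \<ge> 0" by (simp add: q_def sum_nonneg)
    have G: "norm (G z) \<le> R * q" "dist (G z) (G z') \<le> q * dist z z'" for z z'
    proof -
      have "norm (G z) \<le> (\<Sum>j\<in>UNIV. norm (\<psi> j z *\<^sub>R \<beta> j))" unfolding G_def by (rule norm_sum)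
      also have "\<dots> \<le> (\<Sum>j\<in>UNIV. R * norm (\<beta> j))"
        using \<psi>(1) by (intro sum_mono) (simp add: mult_right_mono)
      finally show "norm (G z) \<le> R * q" by (simp add: q_def sum_distrib_left)
      have "G z - G z' = (\<Sum>j\<in>UNIV. (\<psi> j z - \<psi> j z') *\<^sub>R \<beta> j)"
        by (simp add: G_def sum_subtractf scaleR_diff_left)
      then have "dist (G z) (G z') \<le> (\<Sum>j\<in>UNIV. norm ((\<psi> j z - \<psi> j z') *\<^sub>R \<beta> j))"
        unfolding dist_norm by (simp only: norm_sum)
      also have "\<dots> \<le> (\<Sum>j\<in>UNIV. dist z z' * norm (\<beta> j))"
        using \<psi>(2) by (intro sum_mono) (simp add: mult_right_mono)
      finally show "dist (G z) (G z') \<le> q * dist z z'" by (simp add: q_def sum_distrib_left mult.commute)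
    qed
    have \<pi>G: "\<pi> (G (\<phi> y)) = U y" if y: "y \<in> A" for y
    proof -
      have "\<psi> j (\<phi> y) = U y $ j" for j using dR[OF y, of j] U(2)[OF y, of j] by (simp add: \<psi>_def)
      then have "\<pi> (G (\<phi> y)) = (\<Sum>j\<in>UNIV. U y $ j *\<^sub>R axis j 1)"
        by (simp add: G_def linear_sum[OF \<pi>(1)] linear_cmul[OF \<pi>(1)] \<pi>(3))
      also have "\<dots> = U y"
        using basis_expansion[of "U y"] by (simp add: scalar_mult_eq_scaleR)
      finally show ?thesis .
    qed
    define t0 where "t0 = min (\<eta> * L / (q + 1)) ((e / 4) / (R * q + 1))"
    have Rq: "R * q \<ge> 0" using R q by simp
    have t0: "t0 > 0" "t0 * q \<le> \<eta> * L" "t0 * (R * q) \<le> e / 4"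
    proof -
      show "t0 > 0" using \<eta>(1) L q e Rq by (auto simp: t0_def intro!: divide_pos_pos mult_pos_pos add_nonneg_pos)
      have "t0 * q \<le> (\<eta> * L / (q + 1)) * (q + 1)" using \<open>t0 > 0\<close> q by (intro mult_mono) (auto simp: t0_def)
      also have "\<dots> = \<eta> * L" using q by (intro cancel) simp
      finally show "t0 * q \<le> \<eta> * L" .
      have "t0 * (R * q) \<le> ((e / 4) / (R * q + 1)) * (R * q + 1)" using \<open>t0 > 0\<close> Rq by (intro mult_mono) (auto simp: t0_def)
      also have "\<dots> = e / 4" using Rq by (intro cancel) simp
      finally show "t0 * (R * q) \<le> e / 4" .
    qed
    have "det (matrix D) \<noteq> 0" using det_nz_iff_inj[OF lin(2)] x(3) by blast
    then have "finite {s. det (s *\<^sub>R ((1 - \<eta>) *\<^sub>R matrix E) + matrix D) = 0}" by (rule finite_singular_pencil)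
    moreover have "infinite {1 / t0<..}" by (rule infinite_Ioi)
    ultimately obtain s where s: "s > 1 / t0" "det (s *\<^sub>R ((1 - \<eta>) *\<^sub>R matrix E) + matrix D) \<noteq> 0"
      by (metis (mono_tags, lifting) greaterThan_iff finite_subset mem_Collect_eq subsetI)
    \<comment> \<open>the pencil is taken in \<open>s = 1 / t\<close>, where it is regular at 0; so large \<open>s\<close> give small \<open>t\<close>\<close>
    define t where "t = 1 / s"
    have "1 / t0 > 0" using t0(1) by simp
    then have "s > 0" using s(1) by linarith
    then have t: "t > 0" "t \<le> t0" using s(1) t0(1) by (auto simp: t_def field_simps)
    define D' where "D' v = (1 - \<eta>) *\<^sub>R E v + t *\<^sub>R D v" for v
    have injD': "inj D'"
    proof -
      define D'' where "D'' v = s *\<^sub>R ((1 - \<eta>) *\<^sub>R E v) + D v" for v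
      have "linear D''" unfolding D''_def using lin
        by (intro linear_compose_add linear_compose_scale_right)
      moreover have "matrix D'' = s *\<^sub>R ((1 - \<eta>) *\<^sub>R matrix E) + matrix D"
        by (simp add: matrix_def vec_eq_iff D''_def)
      ultimately have "inj D''" using det_nz_iff_inj s(2) by metis
      moreover have "D'' v = s *\<^sub>R D' v" for v
        using \<open>s > 0\<close> by (simp add: D''_def D'_def t_def scaleR_add_right)
      ultimately show ?thesis unfolding inj_def by metis
    qed
    define g where "g z = (1 - \<eta>) *\<^sub>R f z + t *\<^sub>R G z" for z
    have g_lip: "L-lipschitz_on UNIV g"
    proof (rule lipschitz_onI)
      fix z z'
      have "dist (g z) (g z') \<le> norm ((1 - \<eta>) *\<^sub>R (f z - f z')) + norm (t *\<^sub>R (G z - G z'))"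
        unfolding dist_norm g_def by (rule order.trans[OF _ norm_triangle_ineq]) (simp add: algebra_simps)
      also have "\<dots> = (1 - \<eta>) * dist (f z) (f z') + t * dist (G z) (G z')" using \<eta> t by (simp add: dist_norm)
      also have "\<dots> \<le> (1 - \<eta>) * (L * dist z z') + t * (q * dist z z')"
        using \<eta> t G(2) by (intro add_mono mult_left_mono lipschitz_onD[OF f]) auto
      also have "\<dots> = ((1 - \<eta>) * L + t * q) * dist z z'" by (simp add: algebra_simps)
      also have "\<dots> \<le> L * dist z z'"
      proof (rule mult_right_mono)
        have "t * q \<le> t0 * q" using t q by (intro mult_right_mono) auto
        then show "(1 - \<eta>) * L + t * q \<le> L" using t0(2) by (simp add: algebra_simps)
      qed simp
      finally show "dist (g z) (g z') \<le> L * dist z z'" .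
    qed (use L in simp)
    have g_near: "dist (g z) (f z) \<le> e / 2" for z
    proof -
      have "g z - f z = t *\<^sub>R G z - \<eta> *\<^sub>R f z" by (simp add: g_def algebra_simps)
      then have "dist (g z) (f z) \<le> norm (t *\<^sub>R G z) + norm (\<eta> *\<^sub>R f z)"
        unfolding dist_norm by (simp only: norm_triangle_ineq4)
      also have "\<dots> = t * norm (G z) + \<eta> * norm (f z)" using \<eta> t by simp
      also have "\<dots> \<le> t0 * (R * q) + \<eta> * b" using \<eta> t t0(1) G(1) b Rq by (intro add_mono mult_mono) auto
      also have "\<dots> \<le> e / 2" using t0(3) \<eta>(3) by simp
      finally show ?thesis .
    qed
    have "bounded (range g)"
      unfolding bounded_iff
    proof (intro exI[of _ "e / 2 + b"] ballI)
      fix v assume "v \<in> range g"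
      then obtain z where "v = g z" by blast
      then show "norm v \<le> e / 2 + b"
        using g_near[of z] b[of z] norm_triangle_ineq[of "g z - f z" "f z"] by (simp add: dist_norm)
    qed
    then obtain g0 :: "'a \<Rightarrow>\<^sub>C 'v" where g0: "g0 \<in> Lip L" "apply_bcontfun g0 = g"
      using image_apply_bcontfun_Lip[where 'a = 'a and 'b = 'v and L = L] g_lip by (smt (verit) image_iff mem_Collect_eq)
    define \<Phi> where "\<Phi> y = (1 - \<eta>) *\<^sub>R F y + t *\<^sub>R U y" for y
    define M' where "M' = \<bar>1 - \<eta>\<bar> * (real CARD('n) * M) + \<bar>t\<bar> * (real CARD('n) * C)"
    have \<Phi>_lip: "M'-lipschitz_on UNIV \<Phi>"
      unfolding \<Phi>_def M'_def
    proof (intro lipschitz_on_add lipschitz_on_cmult)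
      show "(real CARD('n) * M)-lipschitz_on UNIV F" by (rule lipschitz_on_vec) (simp add: F_def u(1))
      show "(real CARD('n) * C)-lipschitz_on UNIV U" using U(1) by (rule lipschitz_on_vec)
    qed
    have M': "M' \<ge> 0" by (rule lipschitz_on_nonneg[OF \<Phi>_lip])
    have \<Phi>_deriv: "(\<Phi> has_derivative D') (at x)"
      unfolding \<Phi>_def D'_def using E x(2) by (intro derivative_intros)
    have "hausdorff_measure DIM(real^'n) (\<Phi> ` A) > 0"
      using stable_positive_image[OF Aleb x(4) \<Phi>_lip \<Phi>_deriv injD' M'] \<Phi>_lip by (auto intro: less_imp_le)
    moreover have "\<Phi> ` A = \<pi> ` (g ` \<phi> ` A)"
    proof -
      have "\<Phi> y = \<pi> (g (\<phi> y))" if "y \<in> A" for y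
        using F_A[OF that] \<pi>G[OF that] by (simp add: \<Phi>_def g_def linear_add[OF \<pi>(1)] linear_cmul[OF \<pi>(1)])
      then show ?thesis by (auto simp: image_image)
    qed
    ultimately have "hausdorff_measure CARD('n) (\<pi> ` (g ` \<phi> ` A)) > 0" by simp
    then have "hausdorff_measure CARD('n) (g ` \<phi> ` A) \<noteq> 0"
      using hausdorff_measure_lipschitz_image_null[OF lipschitz_on_subset[OF \<pi>(2)], of _ "real CARD('n)"] by auto
    moreover have "hausdorff_measure CARD('n) (g ` \<phi> ` A) \<le> hausdorff_measure CARD('n) (g ` S)"
      using A(4) by (intro hausdorff_measure_mono image_mono)
    ultimately have "hausdorff_measure CARD('n) (g ` S) > 0" by (metis le_zero_eq not_gr_zero)
    moreover have "dist g0 f0 \<le> e / 2" by (rule dist_bound) (use g_near in \<open>simp add: g0(2) f_def\<close>)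
    then have "dist g0 f0 < e" using e by simp
    ultimately show "\<exists>h\<in>{f \<in> Lip L. hausdorff_measure (real CARD('n)) (apply_bcontfun f ` S) > 0}. dist h f0 < e"
      using g0 by blast
  qed
qed

theorem theorem7p1:
  fixes S :: "'a::complete_space set" and L :: real
  assumes "rectifiable TYPE('n::finite) S"
    and "hausdorff_measure (real CARD('n)) S > 0"
    and "\<exists>B :: 'v::banach set. finite B \<and> span B = UNIV"
    and "dim (UNIV :: 'v set) \<ge> CARD('n)"
    and "L > 0"
  shows "openin (top_of_set (Lip L))
           {f \<in> (Lip L :: ('a \<Rightarrow>\<^sub>C 'v) set).
              hausdorff_measure (real CARD('n)) (apply_bcontfun f ` S) > 0} \<and>
         (Lip L :: ('a \<Rightarrow>\<^sub>C 'v) set) \<subseteq>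
           closure {f \<in> Lip L. hausdorff_measure (real CARD('n)) (apply_bcontfun f ` S) > 0}"
  using openin_positive_image[OF assms(1)] dense_positive_image[OF assms] by (rule conjI)

end
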